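(* Let $b \geq 2$ be an integer. For any $f, g \in L^{\infty}(\lambda)$, $$\lim_{N \rightarrow \infty} \frac{1}{N} \sum_{n=0}^{N-1} f(T_b^{n}x)\, g(T_G^n x) = \int f \, d\lambda \cdot \int g \, d\mu_G$$ for ($\lambda$-)almost every $x \in [0,1]$.
   Context: $\lambda$ is Lebesgue measure on $[0,1]$. $T_b:[0,1]\to[0,1]$ is the times $b$ map $T_b x = bx \bmod 1$. $T_G:[0,1]\to[0,1]$ is the Gauss map $T_G(x) = \{1/x\}$ for $x \neq 0$ and $T_G(0)=0$, where $\{\cdot\}$ denotes the fractional part. $\mu_G$ is the Gauss measure $\mu_G(A) = \frac{1}{\log 2}\int_A \frac{1}{1+x}\,dx$ for measurable $A \subset [0,1]$; it is mutually absolutely continuous with $\lambda$, so $L^\infty(\lambda) = L^\infty(\mu_G)$. *)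

theory Defs
  imports "HOL-Analysis.Analysis"
begin

abbreviation unit_lebesgue :: "real measure" where
  "unit_lebesgue \<equiv> lebesgue_on {0..1}"

definition times_map :: "int \<Rightarrow> real \<Rightarrow> real" where
  "times_map b x = frac (of_int b * x)"

definition gauss_map :: "real \<Rightarrow> real" where
  "gauss_map x = (if x = 0 then 0 else frac (1 / x))"

definition gauss_measure :: "real measure" where
  "gauss_measure = density unit_lebesgue (\<lambda>x. ennreal (1 / ln 2 * (1 / (1 + x))))"

(* Essentially bounded measurable functions, as functions rather than as classes modulo
   almost everywhere equality. *)
definition L_infinity :: "'a measure \<Rightarrow> ('a \<Rightarrow> complex) set" where
  "L_infinity M = {f \<in> borel_measurable M. \<exists>C::real. AE x in M. norm (f x) \<le> C}"

end

(* Let h be the Lyapunov exponent of the Gauss map; truncating the geometric series in the integral of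
   -2 ln x shows ln 10 < h < ln 11. So on almost every orbit the cylinders of n continued fraction
   digits are much longer than b^-n when b >= 11 and much shorter when b <= 10.

   Take f(x) = exp(2 pi i k x) and g depending on finitely many digits. If b >= 11 and k is nonzero,
   then g(T_G^n x) is constant on cylinders that are long compared with the period b^-n of f(T_b^n x),
   so the products for different n are nearly orthogonal. If b <= 10, then f(T_b^n x) is nearly
   constant on cylinders of (1 - 1/q) n digits, and for g of mean zero the exponential mixing of T_G
   conditionally on these digits gives the same near orthogonality. A second moment estimate along
   N = M^2 then yields almost sure convergence. Birkhoff's theorem for each of the two maps carries the
   result over from these f and g to their L^1 closures, hence to all bounded functions. *)
theory Submission
  imports Defs "HOL-Probability.Probability" "HOL-Real_Asymp.Real_Asymp"
begin

section \<open>Averages of weakly correlated functions\<close>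

text \<open>Birkhoff's theorem for the product of the two maps concerns almost every pair of points,
  and the pairs (x, x) form a null set; what replaces it is a comparison of scales. The exponent is
  h = pi^2 / (6 ln 2) = 2.373..., so exp h = 10.7... and no integer b matches the rate at which
  cylinders shrink: two integer bounds settle every b. The source of cancellation depends on the
  side, the oscillating character for large b and the digits not yet read for small b. The obstacle
  is that cylinder lengths follow this rate only asymptotically, with constants depending on x,
  while correlation bounds have to be uniform. Hence every product is exchanged for a term
  \<open>Y n\<close> that is tame everywhere: words with too short cylinders are dropped in one
  case, the character is frozen at a point of the cylinder in the other. Only the comparison with
  the original product is pointwise. Mixing comes from an explicit one-parameter family of
  conditional laws, stable under reading a digit; the induced transition on the parameter contracts
  Lipschitz constants by 7/8.\<close>

lemma tendsto_average_from_squares: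
  fixes Y :: "nat \<Rightarrow> complex"
  assumes bd: "\<And>n. norm (Y n) \<le> B"
    and sq: "(\<lambda>M. (\<Sum>n<M\<^sup>2. Y n) / of_nat (M\<^sup>2)) \<longlonglongrightarrow> 0"
  shows "(\<lambda>N. (\<Sum>n<N. Y n) / of_nat N) \<longlonglongrightarrow> 0"
proof -
  have B0: "0 \<le> B" using norm_ge_zero bd order_trans by blast
  \<comment> \<open>Integer square root. Past the square \<open>(r N)^2\<close> at most
    \<open>2 * r N\<close> terms remain below \<open>N\<close>, each bounded by \<open>B\<close>,
    which is negligible against \<open>(r N)^2\<close>.\<close>
  define r where "r N = nat \<lfloor>sqrt (real N)\<rfloor>" for N
  have r_le: "(r N)\<^sup>2 \<le> N" for N
  proof -
    have "(real (r N))\<^sup>2 \<le> (sqrt (real N))\<^sup>2"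
      unfolding r_def by (intro power_mono) auto
    then show ?thesis by (simp flip: of_nat_power)
  qed
  have r_gt: "N < (r N + 1)\<^sup>2" for N
  proof -
    have "(sqrt (real N))\<^sup>2 < (real (r N) + 1)\<^sup>2"
      unfolding r_def by (intro power_strict_mono; linarith?) auto
    then have "real N < real ((r N + 1)\<^sup>2)" by (simp add: add.commute)
    then show ?thesis by linarith
  qed
  have r_lim: "filterlim r at_top at_top"
    unfolding filterlim_at_top
  proof
    fix Z
    show "\<forall>\<^sub>F N in sequentially. Z \<le> r N"
      using eventually_ge_at_top[of "Z\<^sup>2"]
    proof eventually_elim
      case (elim N)
      then have "Z\<^sup>2 < (r N + 1)\<^sup>2" using r_gt[of N] by linarith
      then have "Z < r N + 1" by (rule power_less_imp_less_base) simp
      then show ?case by simp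
    qed
  qed
  have "(\<lambda>N. norm ((\<Sum>n<(r N)\<^sup>2. Y n) / of_nat ((r N)\<^sup>2)) + 3 * B / real (r N)) \<longlonglongrightarrow> 0"
  proof (intro tendsto_add_zero)
    show "(\<lambda>N. norm ((\<Sum>n<(r N)\<^sup>2. Y n) / of_nat ((r N)\<^sup>2))) \<longlonglongrightarrow> 0"
      using filterlim_compose[OF sq r_lim] by (simp add: tendsto_norm_zero_iff)
    show "(\<lambda>N. 3 * B / real (r N)) \<longlonglongrightarrow> 0"
      using filterlim_compose[OF lim_const_over_n r_lim] .
  qed
  then show ?thesis
  proof (rule Lim_null_comparison[rotated])
    show "\<forall>\<^sub>F N in sequentially. norm ((\<Sum>n<N. Y n) / of_nat N)
        \<le> norm ((\<Sum>n<(r N)\<^sup>2. Y n) / of_nat ((r N)\<^sup>2)) + 3 * B / real (r N)"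
      using eventually_ge_at_top[of 1]
    proof eventually_elim
      case (elim N)
      have r0: "r N > 0" using r_gt[of N] elim by (cases "r N = 0") auto
      let ?S = "\<lambda>N. \<Sum>n<N. Y n"
      have "?S N = ?S ((r N)\<^sup>2) + (\<Sum>n=(r N)\<^sup>2..<N. Y n)"
        using r_le[of N] by (metis lessThan_atLeast0 sum.atLeastLessThan_concat zero_le)
      moreover have "norm (\<Sum>n=(r N)\<^sup>2..<N. Y n) \<le> real (N - (r N)\<^sup>2) * B"
        using sum_norm_bound[of "{(r N)\<^sup>2..<N}" Y B] bd by simp
      moreover have "real (N - (r N)\<^sup>2) * B \<le> 3 * real (r N) * B"
      proof (intro mult_right_mono B0)
        have "N - (r N)\<^sup>2 \<le> 3 * r N"
          using r_gt[of N] r0 by (simp add: power2_eq_square algebra_simps)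
        then show "real (N - (r N)\<^sup>2) \<le> 3 * real (r N)" by linarith
      qed
      ultimately have 1: "norm (?S N) \<le> norm (?S ((r N)\<^sup>2)) + 3 * real (r N) * B"
        by (metis (no_types, lifting) add_left_mono norm_triangle_ineq order_trans)
      have "norm (?S N / of_nat N) \<le> (norm (?S ((r N)\<^sup>2)) + 3 * real (r N) * B) / real N"
        using 1 elim by (simp add: norm_divide divide_right_mono)
      also have "\<dots> \<le> (norm (?S ((r N)\<^sup>2)) + 3 * real (r N) * B) / real ((r N)\<^sup>2)"
        using r_le[of N] r0 B0 elim by (intro divide_left_mono) (auto simp del: of_nat_power)
      also have "\<dots> = norm (?S ((r N)\<^sup>2) / of_nat ((r N)\<^sup>2)) + 3 * B / real (r N)"
        using r0 by (simp add: norm_divide norm_mult norm_power add_divide_distrib power2_eq_square)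
      finally show ?case .
    qed
  qed
qed

lemma borel_measurable_cnj [measurable (raw)]:
  "f \<in> borel_measurable M \<Longrightarrow> (\<lambda>x. cnj (f x)) \<in> borel_measurable M"
  by (rule borel_measurable_continuous_on[of cnj]) (auto intro: continuous_intros)

context prob_space
begin

lemma norm_integral_le:
  fixes f :: "'a \<Rightarrow> 'b::{banach, second_countable_topology}"
  assumes [measurable]: "f \<in> borel_measurable M" and bd: "\<And>x. norm (f x) \<le> K"
  shows "norm (integral\<^sup>L M f) \<le> K"
proof -
  have "norm (integral\<^sup>L M f) \<le> (\<integral>x. norm (f x) \<partial>M)" by (rule integral_norm_bound)
  also have "\<dots> \<le> K"
    by (intro integral_le_const integrable_const_bound[where B = K]) (auto intro!: AE_I2 bd)
  finally show ?thesis .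
qed

text \<open>Bounded row sums of the correlations give a second moment of order \<open>N\<close>, so
  along squares the squared averages have summable integrals. Of the two decay terms,
  \<open>\<theta> ^ n\<close> serves correlations that are small in the later index alone,
  \<open>\<theta> ^ (n - m)\<close> those that are small in the gap; the latter also leaves room for
  the diagonal.\<close>

lemma averages_tendsto_0:
  fixes Y :: "nat \<Rightarrow> 'a \<Rightarrow> complex"
  assumes meas [measurable]: "\<And>n. Y n \<in> borel_measurable M"
    and bd: "\<And>n x. norm (Y n x) \<le> B"
    and th: "0 \<le> \<theta>" "\<theta> < 1"
    and corr: "\<And>m n. m \<le> n \<Longrightarrow> norm (\<integral>x. Y m x * cnj (Y n x) \<partial>M) \<le> C * (\<theta> ^ n + \<theta> ^ (n - m))"
  shows "AE x in M. (\<lambda>N. (\<Sum>n<N. Y n x) / of_nat N) \<longlonglongrightarrow> 0"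
proof -
  have B0: "0 \<le> B" using norm_ge_zero bd order_trans by blast
  have C0: "0 \<le> C" using corr[of 0 0] order_trans[OF norm_ge_zero corr[of 0 0]] by simp
  \<comment> \<open>Each row sums to at most \<open>2 * C / (1 - \<theta>) = K / 2\<close>. Passing
    from \<open>N\<close> to \<open>N + 1\<close> adds that row on both sides of the diagonal, hence
    at most \<open>K\<close>.\<close>
  define K where "K = 4 * C / (1 - \<theta>)"
  have K0: "0 \<le> K" using C0 th by (simp add: K_def)
  have int: "integrable M (\<lambda>x. Y m x * cnj (Y n x))" for m n
    by (rule integrable_const_bound[where B = "B * B"])
      (auto simp: norm_mult intro!: mult_mono bd B0 AE_I2)
  have pow_sum: "(\<Sum>m\<le>n. \<theta> ^ m) \<le> 1 / (1 - \<theta>)" for n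
    using sum_le_suminf[of "\<lambda>m. \<theta> ^ m" "{..n}"] th by (simp add: suminf_geometric summable_geometric)
  have row: "(\<Sum>m\<le>n. C * (\<theta> ^ n + \<theta> ^ (n - m))) \<le> K / 2" for n
  proof -
    have "(\<Sum>m\<le>n. \<theta> ^ n) \<le> (\<Sum>m\<le>n. \<theta> ^ m)"
      using th by (intro sum_mono power_decreasing) auto
    moreover have "(\<Sum>m\<le>n. \<theta> ^ (n - m)) = (\<Sum>m\<le>n. \<theta> ^ m)"
      by (rule sum.reindex_bij_witness[of _ "\<lambda>i. n - i" "\<lambda>i. n - i"]) auto
    ultimately have "(\<Sum>m\<le>n. \<theta> ^ n + \<theta> ^ (n - m)) \<le> 2 * (1 / (1 - \<theta>))"
      using pow_sum[of n] unfolding sum.distrib by linarith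
    then have "C * (\<Sum>m\<le>n. \<theta> ^ n + \<theta> ^ (n - m)) \<le> C * (2 * (1 / (1 - \<theta>)))"
      using C0 by (rule mult_left_mono)
    moreover have "C * (2 * (1 / (1 - \<theta>))) = K / 2"
      using th by (simp add: K_def field_simps)
    ultimately show ?thesis by (simp add: sum_distrib_left)
  qed
  define S where "S N x = (\<Sum>n<N. Y n x)" for N x
  have S_meas [measurable]: "S N \<in> borel_measurable M" for N unfolding S_def by measurable
  have S_bd: "norm (S N x) \<le> real N * B" for N x
    unfolding S_def using sum_norm_bound[of "{..<N}" "\<lambda>n. Y n x" B] bd by simp
  have S_int: "integrable M (\<lambda>x. S N x * cnj (S N x))" for N
    by (rule integrable_const_bound[where B = "(real N * B) * (real N * B)"])
      (auto simp: norm_mult intro!: mult_mono mult_nonneg_nonneg S_bd B0 AE_I2)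
  have second_moment: "norm (\<integral>x. S N x * cnj (S N x) \<partial>M) \<le> K * real N" for N
  proof (induction N)
    case 0
    then show ?case by (simp add: S_def)
  next
    case (Suc N)
    have cr: "integrable M (\<lambda>x. S N x * cnj (Y N x))" "integrable M (\<lambda>x. Y N x * cnj (S N x))"
    proof -
      show "integrable M (\<lambda>x. S N x * cnj (Y N x))"
        by (rule integrable_const_bound[where B = "(real N * B) * B"])
          (auto simp: norm_mult intro!: mult_mono mult_nonneg_nonneg S_bd bd B0 AE_I2)
      from integrable_cnj[OF this] show "integrable M (\<lambda>x. Y N x * cnj (S N x))"
        by (simp add: mult.commute)
    qed
    have e1: "(\<integral>x. S N x * cnj (Y N x) \<partial>M) = (\<Sum>m<N. \<integral>x. Y m x * cnj (Y N x) \<partial>M)"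
      unfolding S_def sum_distrib_right by (rule Bochner_Integration.integral_sum) (rule int)
    have e2: "(\<integral>x. Y N x * cnj (S N x) \<partial>M) = cnj (\<integral>x. S N x * cnj (Y N x) \<partial>M)"
      by (simp flip: Bochner_Integration.integral_cnj add: mult.commute)
    have "(\<integral>x. S (Suc N) x * cnj (S (Suc N) x) \<partial>M) =
      (\<integral>x. S N x * cnj (S N x) + S N x * cnj (Y N x) + Y N x * cnj (S N x) + Y N x * cnj (Y N x) \<partial>M)"
      by (simp add: S_def algebra_simps)
    also have "\<dots> = (\<integral>x. S N x * cnj (S N x) \<partial>M) + (\<integral>x. S N x * cnj (Y N x) \<partial>M)
        + (\<integral>x. Y N x * cnj (S N x) \<partial>M) + (\<integral>x. Y N x * cnj (Y N x) \<partial>M)"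
      using S_int[of N] cr int[of N N] by simp
    finally have "norm (\<integral>x. S (Suc N) x * cnj (S (Suc N) x) \<partial>M) \<le>
      norm (\<integral>x. S N x * cnj (S N x) \<partial>M) + norm (\<integral>x. S N x * cnj (Y N x) \<partial>M)
        + norm (\<integral>x. Y N x * cnj (S N x) \<partial>M) + norm (\<integral>x. Y N x * cnj (Y N x) \<partial>M)"
      using norm_triangle_le norm_triangle_ineq by (smt (verit) norm_add_rule_thm)
    also have "norm (\<integral>x. Y N x * cnj (S N x) \<partial>M) = norm (\<integral>x. S N x * cnj (Y N x) \<partial>M)"
      unfolding e2 by simp
    also have "norm (\<integral>x. S N x * cnj (S N x) \<partial>M) + norm (\<integral>x. S N x * cnj (Y N x) \<partial>M)
        + norm (\<integral>x. S N x * cnj (Y N x) \<partial>M) + norm (\<integral>x. Y N x * cnj (Y N x) \<partial>M)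
        \<le> K * real N + 2 * (norm (\<integral>x. S N x * cnj (Y N x) \<partial>M) + norm (\<integral>x. Y N x * cnj (Y N x) \<partial>M))"
    proof -
      have "a + b + b + d \<le> k + 2 * (b + d)" if "a \<le> k" "0 \<le> d" for a b d k :: real
        using that by argo
      then show ?thesis using Suc.IH norm_ge_zero by blast
    qed
    also have "norm (\<integral>x. S N x * cnj (Y N x) \<partial>M) + norm (\<integral>x. Y N x * cnj (Y N x) \<partial>M)
        \<le> (\<Sum>m\<le>N. norm (\<integral>x. Y m x * cnj (Y N x) \<partial>M))"
      unfolding e1 lessThan_Suc_atMost[symmetric] sum.lessThan_Suc by (intro add_mono norm_sum) auto
    also have "\<dots> \<le> K / 2"
      by (rule order_trans[OF sum_mono row]) (rule corr, simp)
    finally show ?case by (simp add: algebra_simps)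
  qed
  \<comment> \<open>Squared averages along the squares. Their integrals are at most
    \<open>K / j^2\<close>, so the sum over \<open>j\<close> is finite almost everywhere and its
    terms tend to 0.\<close>
  define Z where "Z j x = (norm (S (j\<^sup>2) x / of_nat (j\<^sup>2)))\<^sup>2" for j x
  have Z_meas [measurable]: "Z j \<in> borel_measurable M" for j unfolding Z_def by measurable
  have Z_int: "(\<integral>\<^sup>+x. ennreal (Z j x) \<partial>M) \<le> ennreal (K / (real j)\<^sup>2)" for j
  proof -
    have sq: "S (j\<^sup>2) x * cnj (S (j\<^sup>2) x) = of_real ((norm (S (j\<^sup>2) x))\<^sup>2)" for x
      by (rule complex_norm_square[symmetric])
    have "integrable M (\<lambda>x. (norm (S (j\<^sup>2) x))\<^sup>2)"
      by (rule integrable_const_bound[where B = "(real (j\<^sup>2) * B)\<^sup>2"])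
        (auto intro!: AE_I2 power_mono S_bd simp del: of_nat_power)
    then have "(\<integral>\<^sup>+x. ennreal ((norm (S (j\<^sup>2) x))\<^sup>2) \<partial>M) = ennreal (\<integral>x. (norm (S (j\<^sup>2) x))\<^sup>2 \<partial>M)"
      by (rule nn_integral_eq_integral) auto
    moreover have "(\<integral>x. (norm (S (j\<^sup>2) x))\<^sup>2 \<partial>M) \<le> K * real (j\<^sup>2)"
      using second_moment[of "j\<^sup>2"] unfolding sq integral_complex_of_real norm_of_real by linarith
    ultimately have *: "(\<integral>\<^sup>+x. ennreal ((norm (S (j\<^sup>2) x))\<^sup>2) \<partial>M) \<le> ennreal (K * real (j\<^sup>2))"
      by (simp add: ennreal_leI)
    have "(\<integral>\<^sup>+x. ennreal (Z j x) \<partial>M) = (\<integral>\<^sup>+x. ennreal (1 / (real (j\<^sup>2))\<^sup>2) * ennreal ((norm (S (j\<^sup>2) x))\<^sup>2) \<partial>M)"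
      by (intro nn_integral_cong) (simp add: Z_def norm_divide norm_power power_divide flip: ennreal_mult)
    also have "\<dots> = ennreal (1 / (real (j\<^sup>2))\<^sup>2) * (\<integral>\<^sup>+x. ennreal ((norm (S (j\<^sup>2) x))\<^sup>2) \<partial>M)"
      by (rule nn_integral_cmult) measurable
    also have "\<dots> \<le> ennreal (1 / (real (j\<^sup>2))\<^sup>2) * ennreal (K * real (j\<^sup>2))"
      by (rule mult_left_mono[OF *]) simp
    also have "\<dots> = ennreal (K / (real j)\<^sup>2)"
      using K0 by (subst ennreal_mult[symmetric]) (auto simp: power2_eq_square)
    finally show ?thesis .
  qed
  have "summable (\<lambda>j. K / (real j)\<^sup>2)"
    using inverse_power_summable[of 2, where 'a = real] by (auto simp: divide_inverse intro!: summable_mult)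
  then have fin: "(\<Sum>j. ennreal (K / (real j)\<^sup>2)) < \<infinity>"
    using K0 by (subst suminf_ennreal2) auto
  have "(\<integral>\<^sup>+x. (\<Sum>j. ennreal (Z j x)) \<partial>M) = (\<Sum>j. \<integral>\<^sup>+x. ennreal (Z j x) \<partial>M)"
    by (rule nn_integral_suminf) measurable
  also have "\<dots> \<le> (\<Sum>j. ennreal (K / (real j)\<^sup>2))"
    by (intro suminf_le Z_int) auto
  finally have "(\<integral>\<^sup>+x. (\<Sum>j. ennreal (Z j x)) \<partial>M) \<noteq> \<infinity>" using fin by auto
  then have "AE x in M. (\<Sum>j. ennreal (Z j x)) \<noteq> \<infinity>"
    by (intro nn_integral_PInf_AE) auto
  then show ?thesis
  proof eventually_elim
    case (elim x)
    have "summable (\<lambda>j. Z j x)"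
      by (rule summable_suminf_not_top) (use elim in \<open>auto simp: Z_def\<close>)
    then have "(\<lambda>j. Z j x) \<longlonglongrightarrow> 0" by (rule summable_LIMSEQ_zero)
    then have "(\<lambda>j. sqrt (Z j x)) \<longlonglongrightarrow> sqrt 0" by (rule tendsto_real_sqrt)
    then have "(\<lambda>j. S (j\<^sup>2) x / of_nat (j\<^sup>2)) \<longlonglongrightarrow> 0"
      unfolding Z_def by (simp add: tendsto_norm_zero_iff)
    then show ?case
      unfolding S_def by (intro tendsto_average_from_squares[where B = B] bd)
  qed
qed

end

section \<open>The ergodic theorem\<close>

text \<open>Ergodicity is stated for strictly invariant sets. The set of points with unbounded
  Birkhoff sums, to which it will be applied, is strictly invariant.\<close>

locale ergodic_map = prob_space M for M :: "'a measure" +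
  fixes T :: "'a \<Rightarrow> 'a"
  assumes T_measurable [measurable]: "T \<in> measurable M M"
    and T_preserves: "distr M M T = M"
    and ergodic: "\<And>A. A \<in> sets M \<Longrightarrow> T -` A \<inter> space M = A \<Longrightarrow> prob A = 0 \<or> prob A = 1"
begin

lemma funpow_measurable [measurable]: "(T ^^ n) \<in> measurable M M"
  by (induction n) (auto simp: o_def id_def intro: measurable_comp)

lemma distr_funpow: "distr M M (T ^^ n) = M"
proof (induction n)
  case 0
  then show ?case by (simp add: id_def distr_id)
next
  case (Suc n)
  have "distr M M (T ^^ Suc n) = distr (distr M M (T ^^ n)) M T"
    by (subst distr_distr) auto
  then show ?case unfolding Suc T_preserves .
qed

lemma integrable_comp_funpow:
  fixes f :: "'a \<Rightarrow> 'b::{banach, second_countable_topology}"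
  assumes "integrable M f"
  shows "integrable M (\<lambda>x. f ((T ^^ n) x))"
  using assms integrable_distr[of "T ^^ n" M M f] by (simp add: distr_funpow)

lemma integral_comp_funpow:
  fixes f :: "'a \<Rightarrow> 'b::{banach, second_countable_topology}"
  assumes [measurable]: "f \<in> borel_measurable M"
  shows "integral\<^sup>L M (\<lambda>x. f ((T ^^ n) x)) = integral\<^sup>L M f"
  using integral_distr[of "T ^^ n" M M f] by (simp add: distr_funpow)

text \<open>By invariance the preimage of a null set under any iterate is null, and there are
  countably many iterates. Functions that agree almost everywhere may thus be exchanged along entire
  orbits.\<close>

lemma AE_funpow:
  assumes "AE x in M. P x"
  shows "AE x in M. \<forall>n. P ((T ^^ n) x)"
proof -
  have "AE x in M. P ((T ^^ n) x)" for n
  proof -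
    obtain N where N: "N \<in> null_sets M" "{x \<in> space M. \<not> P x} \<subseteq> N"
      using assms by (auto elim!: AE_E simp: null_sets_def)
    have [measurable]: "N \<in> sets M" using N by auto
    have "AE x in distr M M (T ^^ n). x \<notin> N"
      unfolding distr_funpow using N(1) by (rule AE_not_in)
    then have "AE x in M. (T ^^ n) x \<notin> N"
      by (subst (asm) AE_distr_iff) auto
    then show ?thesis
      using AE_space
    proof eventually_elim
      case (elim x)
      have "(T ^^ n) x \<in> space M" using measurable_space[OF funpow_measurable] elim by auto
      then show ?case using N(2) elim by blast
    qed
  qed
  then show ?thesis by (simp add: AE_all_countable)
qed

definition birkhoff_sum :: "('a \<Rightarrow> real) \<Rightarrow> nat \<Rightarrow> 'a \<Rightarrow> real" where
  "birkhoff_sum f n x = (\<Sum>k<n. f ((T ^^ k) x))"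

lemma birkhoff_sum_Suc: "birkhoff_sum f (Suc n) x = f x + birkhoff_sum f n (T x)"
  unfolding birkhoff_sum_def by (subst sum.lessThan_Suc_shift) (simp add: funpow_swap1)

lemma birkhoff_sum_measurable [measurable]:
  assumes [measurable]: "f \<in> borel_measurable M"
  shows "birkhoff_sum f n \<in> borel_measurable M"
  unfolding birkhoff_sum_def by measurable

lemma integrable_birkhoff_sum: "integrable M f \<Longrightarrow> integrable M (birkhoff_sum f n)"
  unfolding birkhoff_sum_def by (auto intro: integrable_comp_funpow)

text \<open>Garsia's argument. With \<open>F\<close> the maximum of the sums of length at most
  \<open>n\<close>, a positive maximum is attained at a positive length, so
  \<open>F x \<le> f x + F (T x)\<close>; elsewhere \<open>F x = 0 \<le> F (T x)\<close>. Thus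
  \<open>F x - F (T x)\<close> lies below the integrand, and its integral is 0.\<close>

lemma maximal_ergodic:
  assumes f: "integrable M f"
  shows "0 \<le> (\<integral>x. indicator {x. \<exists>k\<le>n. 0 < birkhoff_sum f k x} x * f x \<partial>M)"
proof -
  have [measurable]: "f \<in> borel_measurable M" using f by auto
  define F where "F x = Max ((\<lambda>k. birkhoff_sum f k x) ` {..n})" for x
  have F_ge: "birkhoff_sum f k x \<le> F x" if "k \<le> n" for k x
    unfolding F_def using that by (intro Max_ge) auto
  have F0: "0 \<le> F x" for x using F_ge[of 0 x] by (simp add: birkhoff_sum_def)
  have F_in: "\<exists>k\<le>n. F x = birkhoff_sum f k x" for x
  proof -
    have "F x \<in> (\<lambda>k. birkhoff_sum f k x) ` {..n}" unfolding F_def by (intro Max_in) auto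
    then show ?thesis by auto
  qed
  have F_meas [measurable]: "F \<in> borel_measurable M"
    unfolding F_def by measurable
  have F_int: "integrable M F"
  proof (rule Bochner_Integration.integrable_bound)
    show "integrable M (\<lambda>x. \<Sum>k\<le>n. \<bar>birkhoff_sum f k x\<bar>)"
      using f by (auto intro!: integrable_birkhoff_sum)
    show "AE x in M. norm (F x) \<le> norm (\<Sum>k\<le>n. \<bar>birkhoff_sum f k x\<bar>)"
    proof (rule AE_I2)
      fix x
      obtain k where "k \<le> n" "F x = birkhoff_sum f k x" using F_in by blast
      moreover have "\<bar>birkhoff_sum f k x\<bar> \<le> (\<Sum>k\<le>n. \<bar>birkhoff_sum f k x\<bar>)"
        using \<open>k \<le> n\<close> by (intro member_le_sum) auto
      ultimately show "norm (F x) \<le> norm (\<Sum>k\<le>n. \<bar>birkhoff_sum f k x\<bar>)" by simp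
    qed
  qed auto
  have FT_int: "integrable M (\<lambda>x. F (T x))"
    using integrable_comp_funpow[OF F_int, of 1] by simp
  have key: "F x - F (T x) \<le> indicator {x. \<exists>k\<le>n. 0 < birkhoff_sum f k x} x * f x" for x
  proof (cases "\<exists>k\<le>n. 0 < birkhoff_sum f k x")
    case True
    obtain k where k: "k \<le> n" "F x = birkhoff_sum f k x" using F_in by blast
    have "0 < F x" using True F_ge by (meson less_le_trans)
    then obtain j where j: "k = Suc j" using k by (cases k) (auto simp: birkhoff_sum_def)
    have "F x = f x + birkhoff_sum f j (T x)" using k j by (simp add: birkhoff_sum_Suc)
    also have "\<dots> \<le> f x + F (T x)" using k j F_ge[of j "T x"] by simp
    finally show ?thesis using True by simp
  next
    case False
    obtain k where k: "k \<le> n" "F x = birkhoff_sum f k x" using F_in by blast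
    then show ?thesis using False F0[of "T x"] F0[of x] by force
  qed
  have "0 = integral\<^sup>L M F - integral\<^sup>L M (\<lambda>x. F (T x))"
    using integral_comp_funpow[OF F_meas, of 1] by simp
  also have "\<dots> = (\<integral>x. F x - F (T x) \<partial>M)"
    using F_int FT_int by simp
  also have "\<dots> \<le> (\<integral>x. indicator {x. \<exists>k\<le>n. 0 < birkhoff_sum f k x} x * f x \<partial>M)"
  proof (rule integral_mono[OF _ _ key])
    have "integrable M (\<lambda>x. indicator {x \<in> space M. \<exists>k\<le>n. 0 < birkhoff_sum f k x} x * f x)"
      using integrable_real_mult_indicator[OF _ f, of "{x \<in> space M. \<exists>k\<le>n. 0 < birkhoff_sum f k x}"]
      by (simp add: mult.commute)
    also have "?this \<longleftrightarrow> integrable M (\<lambda>x. indicator {x. \<exists>k\<le>n. 0 < birkhoff_sum f k x} x * f x)"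
      by (intro Bochner_Integration.integrable_cong) (auto simp: indicator_def)
    finally show "integrable M (\<lambda>x. indicator {x. \<exists>k\<le>n. 0 < birkhoff_sum f k x} x * f x)" .
  qed (use F_int FT_int in auto)
  finally show ?thesis .
qed

text \<open>The points with unbounded sums form an invariant set. If it had probability 1, the sets
  in the maximal inequality would grow to almost the whole space, and the limit would make the
  integral of \<open>f\<close> nonnegative.\<close>

lemma birkhoff_sum_bounded_above:
  assumes f: "integrable M f" and neg: "integral\<^sup>L M f < 0"
  shows "AE x in M. \<exists>B. \<forall>n. birkhoff_sum f n x \<le> B"
proof -
  have [measurable]: "f \<in> borel_measurable M" using f by auto
  \<comment> \<open>Natural thresholds keep this a countable combination of measurable sets.\<close>
  define A where "A = {x \<in> space M. \<forall>B::nat. \<exists>n. real B < birkhoff_sum f n x}"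
  have [measurable]: "A \<in> sets M" unfolding A_def by measurable
  have A_alt: "x \<in> A \<longleftrightarrow> x \<in> space M \<and> (\<forall>B. \<exists>n. B < birkhoff_sum f n x)" for x
    unfolding A_def by (auto, meson less_le_trans real_arch_simple less_trans le_less_trans)
  have inv: "T -` A \<inter> space M = A"
  proof (intro equalityI subsetI)
    fix x assume "x \<in> T -` A \<inter> space M"
    then have x: "x \<in> space M" "\<And>B. \<exists>n. B < birkhoff_sum f n (T x)" by (auto simp: A_alt)
    have "\<exists>n. B < birkhoff_sum f n x" for B
    proof -
      obtain n where "B - f x < birkhoff_sum f n (T x)" using x by blast
      then have "B < birkhoff_sum f (Suc n) x" by (simp add: birkhoff_sum_Suc)
      then show ?thesis by blast
    qed
    then show "x \<in> A" using x by (simp add: A_alt)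
  next
    fix x assume "x \<in> A"
    then have x: "x \<in> space M" "\<And>B. \<exists>n. B < birkhoff_sum f n x" by (auto simp: A_alt)
    have "\<exists>n. B < birkhoff_sum f n (T x)" for B
    proof -
      obtain n where n: "max 0 (B + f x) < birkhoff_sum f n x" using x by blast
      then obtain m where "n = Suc m" by (cases n) (auto simp: birkhoff_sum_def)
      then have "B < birkhoff_sum f m (T x)" using n by (simp add: birkhoff_sum_Suc)
      then show ?thesis by blast
    qed
    moreover have "T x \<in> space M" using x measurable_space[OF T_measurable] by auto
    ultimately show "x \<in> T -` A \<inter> space M" using x by (auto simp: A_alt)
  qed
  have "prob A \<noteq> 1"
  proof
    assume "prob A = 1"
    then have AE_A: "AE x in M. x \<in> A" by (simp add: prob_eq_1)
    have "(\<lambda>n. \<integral>x. indicator {x. \<exists>k\<le>n. 0 < birkhoff_sum f k x} x * f x \<partial>M) \<longlonglongrightarrow> (\<integral>x. f x \<partial>M)"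
    proof (rule integral_dominated_convergence[where w = "\<lambda>x. \<bar>f x\<bar>"])
      show "AE x in M. (\<lambda>n. indicator {x. \<exists>k\<le>n. 0 < birkhoff_sum f k x} x * f x) \<longlonglongrightarrow> f x"
        using AE_A
      proof eventually_elim
        case (elim x)
        then obtain k where k: "0 < birkhoff_sum f k x" by (auto simp: A_alt)
        have "eventually (\<lambda>n. indicator {x. \<exists>k\<le>n. 0 < birkhoff_sum f k x} x * f x = f x) sequentially"
          using eventually_ge_at_top[of k] by eventually_elim (use k in \<open>auto simp: indicator_def\<close>)
        then show ?case by (rule tendsto_eventually)
      qed
    qed (use f in \<open>auto simp: indicator_def\<close>)
    then have "0 \<le> (\<integral>x. f x \<partial>M)"
      by (rule LIMSEQ_le_const) (use maximal_ergodic[OF f] in auto)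
    then show False using neg by simp
  qed
  then have "prob A = 0" using ergodic[OF _ inv] by auto
  then have "AE x in M. x \<notin> A" by (simp add: prob_eq_0)
  then show ?thesis
    by (rule AE_mp) (auto intro!: AE_I2 simp: A_alt not_less)
qed

text \<open>Subtracting a constant above the mean makes the mean negative. The bound holds for every
  \<open>n\<close> with a constant depending on the point, which is the form in which cylinder
  lengths are controlled.\<close>

lemma birkhoff_sum_le:
  assumes f: "integrable M f" and c: "integral\<^sup>L M f < c"
  shows "AE x in M. \<exists>B. \<forall>n. birkhoff_sum f n x \<le> c * real n + B"
proof -
  have "AE x in M. \<exists>B. \<forall>n. birkhoff_sum (\<lambda>x. f x - c) n x \<le> B"
    by (rule birkhoff_sum_bounded_above) (use f c prob_space in auto)
  then show ?thesis
    by eventually_elim (auto simp: birkhoff_sum_def sum_subtractf algebra_simps)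
qed

lemma birkhoff_upper:
  assumes f: "integrable M f"
  shows "AE x in M. \<forall>e>0. \<forall>\<^sub>F n in sequentially.
    birkhoff_sum f n x / real n \<le> integral\<^sup>L M f + e"
proof -
  have "AE x in M. \<forall>j. \<exists>B. \<forall>n. birkhoff_sum f n x \<le> (integral\<^sup>L M f + 1 / real (Suc j)) * real n + B"
    unfolding AE_all_countable by (intro allI birkhoff_sum_le[OF f]) auto
  then show ?thesis
  proof eventually_elim
    case (elim x)
    show ?case
    proof (intro allI impI)
      fix e :: real assume "e > 0"
      then obtain j where j: "1 / real (Suc j) < e / 2" using nat_approx_posE[of "e/2"] by auto
      obtain B where B: "\<And>n. birkhoff_sum f n x \<le> (integral\<^sup>L M f + 1 / real (Suc j)) * real n + B"
        using elim by blast
      have "(\<lambda>n. B / real n) \<longlonglongrightarrow> 0" by (rule lim_const_over_n)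
      then have "\<forall>\<^sub>F n in sequentially. B / real n < e / 2"
        using \<open>e > 0\<close> by (intro order_tendstoD(2)) auto
      then show "\<forall>\<^sub>F n in sequentially. birkhoff_sum f n x / real n \<le> integral\<^sup>L M f + e"
        using eventually_gt_at_top[of 0]
      proof eventually_elim
        case (elim n)
        have "birkhoff_sum f n x / real n \<le> ((integral\<^sup>L M f + 1 / real (Suc j)) * real n + B) / real n"
          using B[of n] by (intro divide_right_mono) auto
        also have "\<dots> = integral\<^sup>L M f + 1 / real (Suc j) + B / real n"
          using elim by (simp add: field_simps)
        also have "\<dots> \<le> integral\<^sup>L M f + e / 2 + e / 2"
          using j elim by (intro add_mono) auto
        finally show ?case by simp
      qed
    qed
  qed
qed

lemma birkhoff_real:
  assumes f: "integrable M f"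
  shows "AE x in M. (\<lambda>n. birkhoff_sum f n x / real n) \<longlonglongrightarrow> integral\<^sup>L M f"
proof -
  have "integrable M (\<lambda>x. - f x)" using f by simp
  from birkhoff_upper[OF this] birkhoff_upper[OF f] show ?thesis
  proof eventually_elim
    case (elim x)
    have neg: "birkhoff_sum (\<lambda>x. - f x) n x = - birkhoff_sum f n x" for n
      by (simp add: birkhoff_sum_def sum_negf)
    show ?case
    proof (rule tendstoI)
      fix e :: real assume "e > 0"
      then have "e/2 > 0" by simp
      from elim(1)[rule_format, OF this] elim(2)[rule_format, OF this]
      show "\<forall>\<^sub>F n in sequentially. dist (birkhoff_sum f n x / real n) (integral\<^sup>L M f) < e"
        by eventually_elim (use \<open>e > 0\<close> in \<open>auto simp: neg dist_real_def abs_less_iff\<close>)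
    qed
  qed
qed

theorem birkhoff_complex:
  fixes f :: "'a \<Rightarrow> complex"
  assumes f: "integrable M f"
  shows "AE x in M. (\<lambda>n. (\<Sum>k<n. f ((T ^^ k) x)) / of_nat n) \<longlonglongrightarrow> integral\<^sup>L M f"
proof -
  have "AE x in M. (\<lambda>n. birkhoff_sum (\<lambda>x. Re (f x)) n x / real n) \<longlonglongrightarrow> integral\<^sup>L M (\<lambda>x. Re (f x))"
    "AE x in M. (\<lambda>n. birkhoff_sum (\<lambda>x. Im (f x)) n x / real n) \<longlonglongrightarrow> integral\<^sup>L M (\<lambda>x. Im (f x))"
    by (intro birkhoff_real integrable_Re integrable_Im f)+
  then show ?thesis
    by eventually_elim (use f in \<open>auto simp: tendsto_complex_iff birkhoff_sum_def\<close>)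
qed

end

section \<open>Bounds for the Lyapunov exponent of the Gauss map\<close>

text \<open>Expanding 1 / (1 + x) geometrically in the integral of - ln x / (1 + x) produces these
  integrals with alternating signs.\<close>

lemma integral_power_ln:
  fixes i :: nat
  shows "has_bochner_integral lborel (\<lambda>x::real. indicator {0..1} x * (x ^ i * (- ln x))) (1 / (real i + 1)\<^sup>2)"
proof -
  \<comment> \<open>Antiderivative by parts. The value 0 at 0 is the limit there, since x ln x tends
    to 0, so \<open>F\<close> is continuous on the closed interval while the derivative is needed
    only in the interior.\<close>
  define F where "F x = (if x = 0 then 0 else x ^ Suc i / (real i + 1)\<^sup>2 - x ^ Suc i * ln x / (real i + 1))" for x :: real
  have cont: "continuous_on {0..1} F"
    unfolding continuous_on_eq_continuous_within
  proof
    fix x :: real assume x: "x \<in> {0..1}"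
    show "continuous (at x within {0..1}) F"
    proof (cases "x = 0")
      case True
      have "((\<lambda>x::real. x ^ Suc i / (real i + 1)\<^sup>2 - x ^ i * (x * ln x) / (real i + 1)) \<longlongrightarrow>
           0 ^ Suc i / (real i + 1)\<^sup>2 - 0 ^ i * 0 / (real i + 1)) (at_right 0)"
        by (intro tendsto_intros) (auto, real_asymp)
      then have "((\<lambda>x::real. x ^ Suc i / (real i + 1)\<^sup>2 - x ^ i * (x * ln x) / (real i + 1)) \<longlongrightarrow> 0) (at_right 0)"
        by simp
      then have "(F \<longlongrightarrow> 0) (at_right 0)"
        by (rule Lim_transform_eventually) (auto simp: F_def eventually_at_filter mult_ac)
      then show ?thesis
        using True by (simp add: continuous_within F_def at_within_Icc_at_right)
    next
      case False
      then have "isCont (\<lambda>x. x ^ Suc i / (real i + 1)\<^sup>2 - x ^ Suc i * ln x / (real i + 1)) x"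
        using x by (intro continuous_intros) auto
      moreover have "\<forall>\<^sub>F y in nhds x. F y = y ^ Suc i / (real i + 1)\<^sup>2 - y ^ Suc i * ln y / (real i + 1)"
        using t1_space_nhds[OF False] by eventually_elim (auto simp: F_def)
      ultimately have "isCont F x" by (simp add: isCont_cong)
      then show ?thesis by (rule continuous_at_imp_continuous_at_within)
    qed
  qed
  have deriv: "(F has_real_derivative x ^ i * (- ln x)) (at x)" if "0 < x" for x
  proof -
    have "((\<lambda>x. x ^ Suc i / (real i + 1)\<^sup>2 - x ^ Suc i * ln x / (real i + 1)) has_real_derivative x ^ i * (- ln x)) (at x)"
    proof -
      define c where "c = real i + 1"
      have "c \<noteq> 0" unfolding c_def by linarith
      have d: "((\<lambda>x. x ^ Suc i) has_real_derivative c * x ^ i) (at x)"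
        using DERIV_pow[of "Suc i" x] by (simp add: c_def add.commute)
      have "((\<lambda>x. x ^ Suc i / c\<^sup>2 - x ^ Suc i * ln x / c) has_real_derivative
          (c * x ^ i) / c\<^sup>2 - (c * x ^ i * ln x + 1 / x * x ^ Suc i) / c) (at x)"
        using that by (intro DERIV_diff DERIV_cdivide DERIV_mult d DERIV_ln_divide)
      also have "(c * x ^ i) / c\<^sup>2 - (c * x ^ i * ln x + 1 / x * x ^ Suc i) / c = x ^ i * (- ln x)"
        using that \<open>c \<noteq> 0\<close> by (simp add: field_simps power2_eq_square)
      finally show ?thesis unfolding c_def .
    qed
    moreover have "\<forall>\<^sub>F y in nhds x. F y = y ^ Suc i / (real i + 1)\<^sup>2 - y ^ Suc i * ln y / (real i + 1)"
      using t1_space_nhds[of x 0] that by (auto elim!: eventually_mono simp: F_def)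
    ultimately show ?thesis by (subst DERIV_cong_ev[OF refl _ refl])
  qed
  have "((\<lambda>x. x ^ i * (- ln x)) has_integral F 1 - F 0) {0..1}"
    by (rule fundamental_theorem_of_calculus_interior)
      (use cont deriv in \<open>auto simp: has_real_derivative_iff_has_vector_derivative\<close>)
  then have *: "((\<lambda>x. x ^ i * (- ln x)) has_integral 1 / (real i + 1)\<^sup>2) {0..1}" by (simp add: F_def)
  have "((\<lambda>x. indicator {0..1} x * (x ^ i * (- ln x))) has_integral 1 / (real i + 1)\<^sup>2) UNIV"
  proof -
    have "(\<lambda>x::real. indicator {0..1} x * (x ^ i * (- ln x))) = (\<lambda>x. if x \<in> {0..1} then x ^ i * (- ln x) else 0)"
      by (auto simp: indicator_def)
    then show ?thesis using * by (simp only: has_integral_restrict_UNIV)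
  qed
  moreover have g0: "0 \<le> indicator {0..1} x * (x ^ i * (- ln x))" for x :: real
    by (cases "0 < x \<and> x \<le> 1") (auto simp: indicator_def mult_nonneg_nonpos)
  ultimately have "integral\<^sup>N lborel (\<lambda>x::real. ennreal (indicator {0..1} x * (x ^ i * (- ln x)))) = ennreal (1 / (real i + 1)\<^sup>2)"
    by (intro nn_integral_has_integral_lborel[where f = "\<lambda>x. indicator {0..1} x * (x ^ i * (- ln x))"]) auto
  then show ?thesis
    by (intro has_bochner_integral_nn_integral) (use g0 in auto)
qed

lemma alternating_geometric:
  fixes x :: real
  assumes "0 \<le> x"
  shows "(\<Sum>i<n. (- x) ^ i) = (1 - (- x) ^ n) / (1 + x)"
  using assms sum_gp_strict[of "- x" n] by auto

text \<open>The integral is pi^2 / 12 = 0.8224..., the alternating sum of 1 / (i + 1)^2. Truncating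
  the geometric series multiplies the integrand by \<open>1 - (- x) ^ n\<close>, which lowers it for
  even \<open>n\<close> and raises it for odd \<open>n\<close>. Six and nine terms separate the
  exponent from ln 10 and ln 11.\<close>

lemma
  shows integrable_ln_over_1_plus: "integrable lborel (\<lambda>x::real. indicator {0..1} x * (- ln x / (1 + x)))"
    and integral_ln_over_1_plus_gt: "0.81 < (LINT x::real|lborel. indicator {0..1} x * (- ln x / (1 + x)))"
    and integral_ln_over_1_plus_lt: "(LINT x::real|lborel. indicator {0..1} x * (- ln x / (1 + x))) < (0.829::real)"
proof -
  define A where "A n x = indicator {0..1} x * (- ln x) * (\<Sum>i<n. (- x) ^ i)" for n and x :: real
  have A: "has_bochner_integral lborel (A n) (\<Sum>i<n. (- 1) ^ i / (real i + 1)\<^sup>2)" for n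
  proof -
    have "has_bochner_integral lborel (\<lambda>x. \<Sum>i<n. (- 1) ^ i * (indicator {0..1} x * (x ^ i * (- ln x)))) (\<Sum>i<n. (- 1) ^ i * (1 / (real i + 1)\<^sup>2))"
      by (intro has_bochner_integral_sum has_bochner_integral_mult_right integral_power_ln)
    also have "(\<lambda>x. \<Sum>i<n. (- 1) ^ i * (indicator {0..1} x * (x ^ i * (- ln x)))) = A n"

    proof
      fix x :: real
      have "(- x) ^ i = (- 1) ^ i * x ^ i" for i by (rule power_minus)
      then show "(\<Sum>i<n. (- 1) ^ i * (indicator {0..1} x * (x ^ i * (- ln x)))) = A n x"
        unfolding A_def sum_distrib_left by (intro sum.cong) auto
    qed
    finally show ?thesis by simp
  qed
  let ?f = "\<lambda>x::real. indicator {0..1} x * (- ln x / (1 + x))"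
  have ln0: "- ln x \<ge> 0" if "x \<in> {0..1}" for x :: real using that by (cases "x = 0") auto
  have A_eq: "A n x = ?f x * (1 - (- x) ^ n)" for n x
    using alternating_geometric[of x n] by (auto simp: A_def indicator_def)
  have f0: "0 \<le> ?f x" for x using ln0[of x] by (auto simp: indicator_def divide_nonpos_nonneg)
  have le: "?f x \<le> A 9 x" and ge: "A 6 x \<le> ?f x" for x
  proof -
    have "?f x * 1 \<le> ?f x * (1 - (- x) ^ 9)" if "x \<ge> 0"
      by (intro mult_left_mono f0) (use that in \<open>simp add: power_minus_odd\<close>)
    then show "?f x \<le> A 9 x" unfolding A_eq by (cases "x \<ge> 0") auto
    have "?f x * (1 - (- x) ^ 6) \<le> ?f x * 1" if "x \<ge> 0"
      by (intro mult_left_mono f0) (use that in \<open>simp add: power_minus_even\<close>)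
    then show "A 6 x \<le> ?f x" unfolding A_eq by (cases "x \<ge> 0") auto
  qed
  have A_int: "integrable lborel (A n)" for n using A by (rule integrable.intros)
  show int: "integrable lborel ?f"
  proof (rule Bochner_Integration.integrable_bound[OF A_int[of 9]])
    show "AE x in lborel. norm (?f x) \<le> norm (A 9 x)"
    proof (rule AE_I2)
      fix x :: real
      have "norm (?f x) = ?f x" by (simp only: real_norm_def abs_of_nonneg[OF f0])
      also have "\<dots> \<le> A 9 x" by (rule le)
      also have "\<dots> \<le> norm (A 9 x)" by (simp only: real_norm_def abs_ge_self)
      finally show "norm (?f x) \<le> norm (A 9 x)" .
    qed
    show "?f \<in> borel_measurable lborel" by measurable
  qed
  have "0.81 < (\<Sum>i<6::nat. (- 1) ^ i / (real i + 1)\<^sup>2)"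
    by (simp add: lessThan_nat_numeral lessThan_Suc)
  also have "\<dots> = integral\<^sup>L lborel (A 6)" using has_bochner_integral_integral_eq[OF A[of 6]] by (rule sym)
  also have "\<dots> \<le> integral\<^sup>L lborel ?f"
    using A_int int ge by (rule integral_mono)
  finally show "0.81 < integral\<^sup>L lborel ?f" .
  have "integral\<^sup>L lborel ?f \<le> integral\<^sup>L lborel (A 9)"
    using int A_int le by (rule integral_mono)
  also have "\<dots> = (\<Sum>i<9::nat. (- 1) ^ i / (real i + 1)\<^sup>2)" by (rule has_bochner_integral_integral_eq[OF A[of 9]])
  also have "\<dots> < 0.829"
    by (simp add: lessThan_nat_numeral lessThan_Suc)
  finally show "integral\<^sup>L lborel ?f < 0.829" .
qed

lemma ln2_bounds: "0.693 \<le> ln (2::real)" "ln (2::real) \<le> 0.6932"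
  using ln_approx_bounds[of 2 3, simplified, simplified eval_nat_numeral, simplified] by (simp_all add: field_simps)

text \<open>This is 1000 \<le> 1024. The loss is small because 10/3 is a convergent of the continued
  fraction of the binary logarithm of 10.\<close>

lemma ln10_le: "ln (10::real) \<le> 10 / 3 * ln 2"
proof -
  have "3 * ln (10::real) = ln (10 ^ 3)" by (subst ln_realpow) auto
  also have "\<dots> \<le> ln (2 ^ 10)" by (subst ln_le_cancel_iff) auto
  also have "\<dots> = 10 * ln 2" by (subst ln_realpow) auto
  finally show ?thesis by simp
qed

text \<open>Again 38/11 is a convergent, of the binary logarithm of 11. The precision matters: the
  upper bound for the exponent compares 1.658 with a number close to 1.659.\<close>

lemma ln11_ge: "38 / 11 * ln 2 \<le> ln (11::real)"
proof -
  have "38 * ln 2 = ln (2 ^ 38 :: real)" by (subst ln_realpow) auto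
  also have "\<dots> \<le> ln (11 ^ 11)" by (subst ln_le_cancel_iff) auto
  also have "\<dots> = 11 * ln 11" by (subst ln_realpow) auto
  finally show ?thesis by simp
qed

lemma gauss_exponent_bounds:
  defines "J \<equiv> LINT x::real|lborel. indicator {0..1} x * (- ln x / (1 + x))"
  shows "ln 10 < 2 * J / ln 2" "2 * J / ln 2 < ln 11"
proof -
  have "ln 10 * ln 2 \<le> 10 / 3 * (ln 2 * ln (2::real))" using ln10_le by simp
  also have "\<dots> \<le> 10 / 3 * (0.6932 * 0.6932)" using ln2_bounds by (intro mult_left_mono mult_mono) auto
  also have "\<dots> < 2 * J" using integral_ln_over_1_plus_gt by (simp add: J_def)
  finally show "ln 10 < 2 * J / ln 2" by (simp add: field_simps)
  have "2 * J < 38 / 11 * (0.693 * 0.693)" using integral_ln_over_1_plus_lt by (simp add: J_def)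
  also have "\<dots> \<le> 38 / 11 * (ln 2 * ln (2::real))" using ln2_bounds by (intro mult_left_mono mult_mono) auto
  also have "\<dots> \<le> ln 11 * ln 2" using ln11_ge by simp
  finally show "2 * J / ln 2 < ln 11" by (simp add: field_simps)
qed

section \<open>Conditional laws of the Gauss orbit\<close>

text \<open>Borel versions of \<open>unit_lebesgue\<close> and \<open>gauss_measure\<close>. Their space is the whole real line, so that
  measurability for them is plain Borel measurability.\<close>
definition unit_measure :: "real measure" where
  "unit_measure = density lborel (indicator {0..1})"

text \<open>Given digits with convergents p_n / q_n, a point is (p_n + y p_(n-1)) / (q_n + y
  q_(n-1)), where y is its n-th Gauss iterate. The Jacobian is 1 / (q_n + y q_(n-1))^2 up to sign,
  and normalising it gives this density with s = q_(n-1) / q_n. At s = 0 it is the density of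
  Lebesgue measure.\<close>

definition levy_density :: "real \<Rightarrow> real \<Rightarrow> real" where
  "levy_density s y = (1 + s) / (1 + s * y)\<^sup>2"

definition levy_measure :: "real \<Rightarrow> real measure" where
  "levy_measure s = density unit_measure (\<lambda>y. ennreal (levy_density s y))"

definition gauss_density :: "real \<Rightarrow> real" where
  "gauss_density x = 1 / (ln 2 * (1 + x))"

definition gauss_borel :: "real measure" where
  "gauss_borel = density unit_measure (\<lambda>x. ennreal (gauss_density x))"

lemma sets_unit_measure [simp, measurable_cong]: "sets unit_measure = sets borel"
  and space_unit_measure [simp]: "space unit_measure = UNIV"
  and sets_levy_measure [simp, measurable_cong]: "sets (levy_measure s) = sets borel"
  and space_levy_measure [simp]: "space (levy_measure s) = UNIV"
  and sets_gauss_borel [simp, measurable_cong]: "sets gauss_borel = sets borel"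
  and space_gauss_borel [simp]: "space gauss_borel = UNIV"
  by (simp_all add: unit_measure_def levy_measure_def gauss_borel_def)

lemma levy_density_measurable [measurable]: "levy_density s \<in> borel_measurable borel"
  unfolding levy_density_def by measurable

lemma gauss_density_measurable [measurable]: "gauss_density \<in> borel_measurable borel"
  unfolding gauss_density_def by measurable

lemma prob_space_unit_measure: "prob_space unit_measure"
  by (intro prob_spaceI) (simp add: unit_measure_def emeasure_density)

interpretation unit: prob_space unit_measure by (rule prob_space_unit_measure)

lemma AE_unit_measure_iff: "(AE x in unit_measure. P x) \<longleftrightarrow> (AE x in lborel. x \<in> {0..1} \<longrightarrow> P x)"
proof -
  have "(AE x in unit_measure. P x) \<longleftrightarrow> (AE x in lborel. (0::ennreal) < indicator {0..1} x \<longrightarrow> P x)"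
    unfolding unit_measure_def by (subst AE_density) auto
  also have "\<dots> \<longleftrightarrow> (AE x in lborel. x \<in> {0..1} \<longrightarrow> P x)"
    by (rule AE_cong) (auto simp: indicator_def)
  finally show ?thesis .
qed

lemma AE_unit_interior: "AE x in unit_measure. 0 < x \<and> x < (1::real)"
  unfolding AE_unit_measure_iff
  using AE_lborel_singleton[of "0::real"] AE_lborel_singleton[of "1::real"]
  by eventually_elim auto

lemma levy_density_pos: "0 \<le> s \<Longrightarrow> 0 \<le> y \<Longrightarrow> 0 < levy_density s y"
  unfolding levy_density_def by (intro divide_pos_pos zero_less_power) (auto intro: add_pos_nonneg)

lemma levy_density_le: "s \<in> {0..1} \<Longrightarrow> 0 \<le> y \<Longrightarrow> levy_density s y \<le> 2"
proof -
  assume s: "s \<in> {0..1}" and y: "0 \<le> y"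
  have "levy_density s y \<le> 2 / 1"
    unfolding levy_density_def
    by (intro frac_le one_le_power) (use s y in auto)
  then show ?thesis by simp
qed

lemma gauss_density_pos: "0 \<le> x \<Longrightarrow> 0 < gauss_density x"
  unfolding gauss_density_def by (auto intro!: divide_pos_pos mult_pos_pos)

lemma gauss_density_le: "0 \<le> x \<Longrightarrow> gauss_density x \<le> 1 / ln 2"
  unfolding gauss_density_def by (intro divide_left_mono) auto

lemma AE_levy_measure:
  assumes "0 \<le> s"
  shows "(AE x in levy_measure s. P x) \<longleftrightarrow> (AE x in unit_measure. P x)"
proof -
  have "(AE x in levy_measure s. P x) \<longleftrightarrow> (AE x in unit_measure. 0 < levy_density s x \<longrightarrow> P x)"
    unfolding levy_measure_def by (subst AE_density) auto
  also have "\<dots> \<longleftrightarrow> (AE x in unit_measure. P x)"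
    unfolding AE_unit_measure_iff using levy_density_pos[OF assms] by (intro AE_cong) auto
  finally show ?thesis .
qed

lemma AE_gauss_borel: "(AE x in gauss_borel. P x) \<longleftrightarrow> (AE x in unit_measure. P x)"
proof -
  have "(AE x in gauss_borel. P x) \<longleftrightarrow> (AE x in unit_measure. 0 < gauss_density x \<longrightarrow> P x)"
    unfolding gauss_borel_def by (subst AE_density) auto
  also have "\<dots> \<longleftrightarrow> (AE x in unit_measure. P x)"
    unfolding AE_unit_measure_iff using gauss_density_pos by (intro AE_cong) auto
  finally show ?thesis .
qed

lemma integral_unit_measure:
  fixes f :: "real \<Rightarrow> 'b::{banach, second_countable_topology}"
  assumes [measurable]: "f \<in> borel_measurable borel"
  shows "integral\<^sup>L unit_measure f = (\<integral>x. indicator {0..1} x *\<^sub>R f x \<partial>lborel)"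
proof -
  have eq: "unit_measure = density lborel (\<lambda>x. ennreal (indicator {0..1} x))"
    unfolding unit_measure_def by (intro density_cong) (auto simp: indicator_def)
  show ?thesis unfolding eq by (subst integral_density) auto
qed

lemma integral_levy_measure:
  fixes f :: "real \<Rightarrow> 'b::{banach, second_countable_topology}"
  assumes [measurable]: "f \<in> borel_measurable borel" and "0 \<le> s"
  shows "integral\<^sup>L (levy_measure s) f = (\<integral>x. levy_density s x *\<^sub>R f x \<partial>unit_measure)"
  unfolding levy_measure_def
  by (rule integral_density)
    (use assms AE_unit_interior in \<open>auto elim!: eventually_mono intro!: less_imp_le[OF levy_density_pos]\<close>)

lemma integral_gauss_borel:
  fixes f :: "real \<Rightarrow> 'b::{banach, second_countable_topology}"
  assumes [measurable]: "f \<in> borel_measurable borel"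
  shows "integral\<^sup>L gauss_borel f = (\<integral>x. gauss_density x *\<^sub>R f x \<partial>unit_measure)"
  unfolding gauss_borel_def
  by (rule integral_density)
    (use assms AE_unit_interior in \<open>auto elim!: eventually_mono intro!: less_imp_le[OF gauss_density_pos]\<close>)

lemma nn_integral_unit_measure:
  assumes [measurable]: "f \<in> borel_measurable borel"
  shows "integral\<^sup>N unit_measure f = (\<integral>\<^sup>+x. indicator {0..1} x * f x \<partial>lborel)"
  unfolding unit_measure_def by (rule nn_integral_density) auto

lemma nn_integral_unit_FTC:
  assumes "\<And>x. x \<in> {0..1} \<Longrightarrow> 0 \<le> w x" "w \<in> borel_measurable borel"
    and "\<And>x. x \<in> {0..1} \<Longrightarrow> (F has_real_derivative w x) (at x)"
  shows "(\<integral>\<^sup>+x. ennreal (w x) \<partial>unit_measure) = ennreal (F 1 - F 0)"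
proof -
  note [measurable] = assms(2)
  have "(\<integral>\<^sup>+x. ennreal (w x) \<partial>unit_measure) = (\<integral>\<^sup>+x. ennreal (w x) * indicator {0..1} x \<partial>lborel)"
    by (simp add: nn_integral_unit_measure mult.commute)
  also have "\<dots> = ennreal (F 1 - F 0)"
    by (rule nn_integral_FTC_Icc) (use assms in auto)
  finally show ?thesis .
qed

lemma DERIV_levy:
  assumes "0 \<le> s" "0 \<le> y"
  shows "((\<lambda>y. (1 + s) * y / (1 + s * y)) has_real_derivative levy_density s y) (at y)"
proof -
  have "1 + s * y \<noteq> 0" using assms mult_nonneg_nonneg[OF assms] by linarith
  then show ?thesis
    unfolding levy_density_def by (auto intro!: derivative_eq_intros simp: field_simps power2_eq_square)
qed

lemma prob_space_levy_measure:
  assumes "0 \<le> s"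
  shows "prob_space (levy_measure s)"
proof (rule prob_spaceI)
  have "emeasure (levy_measure s) (space (levy_measure s)) = (\<integral>\<^sup>+y. ennreal (levy_density s y) \<partial>unit_measure)"
    unfolding levy_measure_def by (subst emeasure_density) auto
  also have "\<dots> = ennreal ((1 + s) * 1 / (1 + s * 1) - (1 + s) * 0 / (1 + s * 0))"
    by (rule nn_integral_unit_FTC)
      (use assms DERIV_levy levy_density_pos in \<open>auto intro: less_imp_le\<close>)
  finally show "emeasure (levy_measure s) (space (levy_measure s)) = 1" using assms by simp
qed

lemma prob_space_gauss_borel: "prob_space gauss_borel"
proof (rule prob_spaceI)
  have "emeasure gauss_borel (space gauss_borel) = (\<integral>\<^sup>+y. ennreal (gauss_density y) \<partial>unit_measure)"
    unfolding gauss_borel_def by (subst emeasure_density) auto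
  also have "\<dots> = ennreal (ln (1 + 1) / ln 2 - ln (1 + 0) / ln 2)"
  proof (rule nn_integral_unit_FTC)
    fix x :: real assume x: "x \<in> {0..1}"
    then have "((\<lambda>x. ln (1 + x)) has_real_derivative 1 / (1 + x)) (at x)"
      by (auto intro!: derivative_eq_intros)
    from DERIV_cdivide[OF this, of "ln 2"]
    show "((\<lambda>x. ln (1 + x) / ln 2) has_real_derivative gauss_density x) (at x)"
      by (simp add: gauss_density_def mult.commute)
  qed (auto intro: less_imp_le gauss_density_pos)
  finally show "emeasure gauss_borel (space gauss_borel) = 1" by simp
qed

interpretation gauss: prob_space gauss_borel by (rule prob_space_gauss_borel)

lemma levy_measure_0: "levy_measure 0 = unit_measure"
  unfolding levy_measure_def levy_density_def by (simp add: density_1)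

section \<open>Digit cells and the inverse branches of the Gauss map\<close>

text \<open>Index \<open>a\<close> stands for the digit a + 1, so the natural numbers enumerate the
  digits. The right end belongs to the cell because 1 / x = a + 1 has floor a + 1.\<close>

definition digit_cell :: "nat \<Rightarrow> real set" where
  "digit_cell a = {1 / (real a + 2)<..1 / (real a + 1)}"

lemma digit_cell_measurable [measurable]: "digit_cell a \<in> sets borel"
  unfolding digit_cell_def by measurable

lemma digit_cell_iff:
  assumes "0 < x"
  shows "x \<in> digit_cell a \<longleftrightarrow> \<lfloor>1 / x\<rfloor> = int a + 1"
  unfolding digit_cell_def floor_eq_iff using assms by (auto simp: field_simps)

lemma digit_cell_subset: "digit_cell a \<subseteq> {0<..1}"
proof
  fix x assume "x \<in> digit_cell a"
  then have "1 / (real a + 2) < x" "x \<le> 1 / (real a + 1)" by (auto simp: digit_cell_def)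
  moreover have "0 < 1 / (real a + 2)" "1 / (real a + 1) \<le> 1" by auto
  ultimately show "x \<in> {0<..1}" unfolding greaterThanAtMost_iff by linarith
qed

lemma digit_cell_unique:
  assumes "x \<in> {0<..1}"
  shows "\<exists>i. \<forall>a. x \<in> digit_cell a \<longleftrightarrow> a = i"
proof (intro exI allI)
  fix a
  have "1 \<le> \<lfloor>1 / x\<rfloor>" using assms by (simp add: le_floor_iff)
  then show "x \<in> digit_cell a \<longleftrightarrow> a = nat (\<lfloor>1 / x\<rfloor> - 1)"
    using digit_cell_iff[of x a] assms by auto
qed

lemma nn_integral_digit_cell:
  assumes [measurable]: "F \<in> borel_measurable borel"
  shows "(\<integral>\<^sup>+x. F x * indicator (digit_cell a) x \<partial>lborel) =
    (\<integral>\<^sup>+y. F (1 / (real a + 1 + y)) * ennreal (1 / (real a + 1 + y)\<^sup>2) \<partial>unit_measure)"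
proof -
  \<comment> \<open>The branch \<open>1 / (real a + 1 + y)\<close> decreases, while the substitution
    rule is for increasing functions. So \<open>g\<close> is the branch at \<open>y = 1 - t\<close>,
    and the reflection is undone afterwards.\<close>
  define g where "g t = 1 / (real a + 2 - t)" for t :: real
  define g' where "g' t = 1 / (real a + 2 - t)\<^sup>2" for t :: real
  have g01: "g 0 = 1 / (real a + 2)" "g 1 = 1 / (real a + 1)" by (auto simp: g_def)
  have "(\<integral>\<^sup>+x. F x * indicator (digit_cell a) x \<partial>lborel) = (\<integral>\<^sup>+x. F x * indicator {g 0..g 1} x \<partial>lborel)"
  proof (rule nn_integral_cong_AE)
    show "AE x in lborel. F x * indicator (digit_cell a) x = F x * indicator {g 0..g 1} x"
      using AE_lborel_singleton[of "g 0"]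
      by eventually_elim (auto simp: digit_cell_def g01 indicator_def)
  qed
  also have "\<dots> = (\<integral>\<^sup>+t. F (g t) * ennreal (g' t) * indicator {0..1} t \<partial>lborel)"
  proof (rule nn_integral_substitution_aux)
    fix t :: real assume t: "t \<in> {0..1}"
    then have "real a + 2 - t \<noteq> 0" by auto
    then show "(g has_real_derivative g' t) (at t)"
      unfolding g_def g'_def by (auto intro!: derivative_eq_intros simp: power2_eq_square)
  next
    show "continuous_on {0..1} g'"
      unfolding g'_def by (intro continuous_intros) auto
  qed (auto simp: g'_def)
  also have "\<dots> = (\<integral>\<^sup>+y. F (g (1 + - 1 * y)) * ennreal (g' (1 + - 1 * y)) * indicator {0..1} (1 + - 1 * y) \<partial>lborel)"
    unfolding g_def g'_def by (subst nn_integral_real_affine[where t = 1 and c = "- 1"]) auto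
  also have "\<dots> = (\<integral>\<^sup>+y. indicator {0..1} y * (F (1 / (real a + 1 + y)) * ennreal (1 / (real a + 1 + y)\<^sup>2)) \<partial>lborel)"
    by (intro nn_integral_cong) (auto simp: g_def g'_def indicator_def add_ac)
  also have "\<dots> = (\<integral>\<^sup>+y. F (1 / (real a + 1 + y)) * ennreal (1 / (real a + 1 + y)\<^sup>2) \<partial>unit_measure)"
    by (subst nn_integral_unit_measure) auto
  finally show ?thesis .
qed

lemma integral_digit_cell:
  fixes F :: "real \<Rightarrow> 'b::{banach, second_countable_topology}"
  assumes [measurable]: "F \<in> borel_measurable borel"
  shows "(\<integral>x. indicator (digit_cell a) x *\<^sub>R F x \<partial>lborel) =
    (\<integral>y. (1 / (real a + 1 + y)\<^sup>2) *\<^sub>R F (1 / (real a + 1 + y)) \<partial>unit_measure)"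
proof -
  let ?\<psi> = "\<lambda>y::real. 1 / (real a + 1 + y)" and ?J = "\<lambda>y::real. 1 / (real a + 1 + y)\<^sup>2"
  \<comment> \<open>An equality of measures carries the substitution from nonnegative functions to
    Banach space valued ones.\<close>
  have "distr (density unit_measure (\<lambda>y. ennreal (?J y))) borel ?\<psi> = density lborel (\<lambda>x. ennreal (indicator (digit_cell a) x))"
  proof (rule measure_eqI)
    fix A assume "A \<in> sets (distr (density unit_measure (\<lambda>y. ennreal (?J y))) borel ?\<psi>)"
    then have [measurable]: "A \<in> sets borel" by simp
    have "emeasure (distr (density unit_measure (\<lambda>y. ennreal (?J y))) borel ?\<psi>) A
      = (\<integral>\<^sup>+y. ennreal (?J y) * indicator (?\<psi> -` A) y \<partial>unit_measure)"
      by (subst emeasure_distr, simp, simp, subst emeasure_density) (auto intro!: measurable_sets_borel[of ?\<psi> borel])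
    also have "\<dots> = (\<integral>\<^sup>+y. indicator A (?\<psi> y) * ennreal (?J y) \<partial>unit_measure)"
      by (intro nn_integral_cong) (auto simp: indicator_def)
    also have "\<dots> = (\<integral>\<^sup>+x. indicator A x * indicator (digit_cell a) x \<partial>lborel)"
      by (rule nn_integral_digit_cell[symmetric]) simp
    also have "\<dots> = emeasure (density lborel (\<lambda>x. ennreal (indicator (digit_cell a) x))) A"
      by (subst emeasure_density) (auto intro!: nn_integral_cong simp: indicator_def)
    finally show "emeasure (distr (density unit_measure (\<lambda>y. ennreal (?J y))) borel ?\<psi>) A =
      emeasure (density lborel (\<lambda>x. ennreal (indicator (digit_cell a) x))) A" .
  qed simp
  then have "integral\<^sup>L (distr (density unit_measure (\<lambda>y. ennreal (?J y))) borel ?\<psi>) F =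
    integral\<^sup>L (density lborel (\<lambda>x. ennreal (indicator (digit_cell a) x))) F" by simp
  then show ?thesis
    by (simp add: integral_distr integral_density)
qed

text \<open>Under \<open>levy_measure s\<close> the first digit is \<open>a + 1\<close> with probability \<open>digit_prob s a\<close>, and given that
  digit the Gauss map pushes the measure to \<open>levy_measure (1 / (a + 1 + s))\<close>; for \<open>s = q\<^sub>n\<^sub>-\<^sub>1/q\<^sub>n\<close> these are
  the conditional laws of the Gauss orbit given the first digits.\<close>
definition digit_prob :: "real \<Rightarrow> nat \<Rightarrow> real" where
  "digit_prob s a = (1 + s) / ((real a + 1 + s) * (real a + 2 + s))"

text \<open>Probability under \<open>levy_measure s\<close> that the first digit exceeds
  \<open>a\<close>, that is, the distribution function at 1 / (a + 1).\<close>

definition digit_tail :: "real \<Rightarrow> nat \<Rightarrow> real" where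
  "digit_tail s a = (1 + s) / (real a + 1 + s)"

lemma digit_prob_eq_diff: "0 \<le> s \<Longrightarrow> digit_prob s a = digit_tail s a - digit_tail s (Suc a)"
  unfolding digit_prob_def digit_tail_def by (simp add: field_simps)

lemma digit_prob_nonneg: "0 \<le> s \<Longrightarrow> 0 \<le> digit_prob s a"
  unfolding digit_prob_def by simp

lemma digit_tail_lim: "digit_tail s \<longlonglongrightarrow> 0"
  unfolding digit_tail_def by real_asymp

lemma digit_prob_sums: "0 \<le> s \<Longrightarrow> digit_prob s sums 1"
proof -
  assume s: "0 \<le> s"
  have "(\<lambda>a. digit_tail s a - digit_tail s (Suc a)) sums (digit_tail s 0 - 0)"
    by (rule telescope_sums'[OF digit_tail_lim])
  also have "(\<lambda>a. digit_tail s a - digit_tail s (Suc a)) = digit_prob s"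
    using digit_prob_eq_diff[OF s] by auto
  finally show ?thesis using s by (simp add: digit_tail_def)
qed

lemma integral_levy_branch:
  fixes f :: "real \<Rightarrow> 'b::{banach, second_countable_topology}"
  assumes [measurable]: "f \<in> borel_measurable borel" and s: "0 \<le> s"
  shows "(\<integral>x. indicator (digit_cell a) x *\<^sub>R f x \<partial>levy_measure s) =
    digit_prob s a *\<^sub>R (\<integral>y. f (1 / (real a + 1 + y)) \<partial>levy_measure (1 / (real a + 1 + s)))"
proof -
  \<comment> \<open>The family is closed under inverse branches: Jacobian times density along the
    branch is again a density of the family, at the new parameter and with
    \<open>digit_prob s a\<close> as its mass.\<close>
  have ident: "(1 / (real a + 1 + y)\<^sup>2) * levy_density s (1 / (real a + 1 + y)) =
      digit_prob s a * levy_density (1 / (real a + 1 + s)) y" if "0 < y" for y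
  proof -
    have pos: "real a + 1 + y > 0" "real a + 1 + s > 0" "real a + 2 + s > 0" "real a + 1 + s + y > 0" using that s by auto
    have 1: "1 + s * (1 / (real a + 1 + y)) = (real a + 1 + s + y) / (real a + 1 + y)"
      using pos by (simp add: field_simps)
    have 2: "1 + 1 / (real a + 1 + s) * y = (real a + 1 + s + y) / (real a + 1 + s)"
      using pos by (simp add: field_simps)
    have 3: "1 + 1 / (real a + 1 + s) = (real a + 2 + s) / (real a + 1 + s)"
      using pos by (simp add: field_simps)
    show ?thesis
      unfolding levy_density_def digit_prob_def 1 2 3 using pos
      by (simp add: power2_eq_square)
  qed
  have "(\<integral>x. indicator (digit_cell a) x *\<^sub>R f x \<partial>levy_measure s) =
    (\<integral>x. levy_density s x *\<^sub>R (indicator (digit_cell a) x *\<^sub>R f x) \<partial>unit_measure)"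
    using s by (subst integral_levy_measure) auto
  also have "\<dots> = (\<integral>x. indicator {0..1} x *\<^sub>R (levy_density s x *\<^sub>R (indicator (digit_cell a) x *\<^sub>R f x)) \<partial>lborel)"
    by (subst integral_unit_measure) auto
  also have "\<dots> = (\<integral>x. indicator (digit_cell a) x *\<^sub>R (levy_density s x *\<^sub>R f x) \<partial>lborel)"
  proof -
    have "digit_cell a \<subseteq> {0..1}" using digit_cell_subset[of a] by auto
    then show ?thesis
      by (intro Bochner_Integration.integral_cong) (auto simp: indicator_def)
  qed
  also have "\<dots> = (\<integral>y. (1 / (real a + 1 + y)\<^sup>2) *\<^sub>R (levy_density s (1 / (real a + 1 + y)) *\<^sub>R f (1 / (real a + 1 + y))) \<partial>unit_measure)"
    by (rule integral_digit_cell) simp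
  also have "\<dots> = (\<integral>y. digit_prob s a *\<^sub>R (levy_density (1 / (real a + 1 + s)) y *\<^sub>R f (1 / (real a + 1 + y))) \<partial>unit_measure)"
  proof (rule integral_cong_AE)
    show "AE y in unit_measure. (1 / (real a + 1 + y)\<^sup>2) *\<^sub>R (levy_density s (1 / (real a + 1 + y)) *\<^sub>R f (1 / (real a + 1 + y))) =
       digit_prob s a *\<^sub>R (levy_density (1 / (real a + 1 + s)) y *\<^sub>R f (1 / (real a + 1 + y)))"
      using AE_unit_interior by eventually_elim (auto simp only: scaleR_scaleR ident)
  qed auto
  also have "\<dots> = digit_prob s a *\<^sub>R (\<integral>y. f (1 / (real a + 1 + y)) \<partial>levy_measure (1 / (real a + 1 + s)))"
    unfolding integral_scaleR_right using s by (subst integral_levy_measure) auto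
  finally show ?thesis .
qed

lemma AE_levy_interior: "0 \<le> s \<Longrightarrow> AE x in levy_measure s. 0 < x \<and> x < 1"
  using AE_levy_measure[of s "\<lambda>x. 0 < x \<and> x < 1"] AE_unit_interior by blast

text \<open>Disintegration along the first digit. The branch integrals are dominated by
  \<open>digit_prob s a * B\<close>, which is summable, so sum and integral may be
  exchanged.\<close>

lemma levy_branch_sums:
  fixes f :: "real \<Rightarrow> complex"
  assumes [measurable]: "f \<in> borel_measurable borel" and s: "0 \<le> s" and bd: "\<And>x. norm (f x) \<le> B"
  shows "(\<lambda>a. digit_prob s a *\<^sub>R (\<integral>y. f (1 / (real a + 1 + y)) \<partial>levy_measure (1 / (real a + 1 + s))))
    sums integral\<^sup>L (levy_measure s) f"
proof -
  interpret prob_space "levy_measure s" using s by (rule prob_space_levy_measure)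
  let ?f = "\<lambda>a x. indicator (digit_cell a) x *\<^sub>R f x"
  have single: "(\<lambda>a. indicator (digit_cell a) x *\<^sub>R c) sums c" if "0 < x" "x < 1" for x and c :: "'c::real_normed_vector"
  proof -
    have "x \<in> {0<..1}" using that by simp
    then obtain i where "\<forall>a. x \<in> digit_cell a \<longleftrightarrow> a = i" using digit_cell_unique by blast
    then have "indicator (digit_cell a) x *\<^sub>R c = (if a = i then c else 0)" for a by (simp add: indicator_def)
    then show ?thesis using sums_single[of i "\<lambda>_. c"] by simp
  qed
  have int: "integrable (levy_measure s) (?f a)" for a
    by (rule integrable_const_bound[where B = B]) (auto simp: indicator_def intro!: AE_I2 bd order_trans[OF norm_ge_zero bd])
  have "(\<lambda>a. integral\<^sup>L (levy_measure s) (?f a)) sums (\<integral>x. (\<Sum>a. ?f a x) \<partial>levy_measure s)"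
  proof (rule sums_integral)
    show "AE x in levy_measure s. summable (\<lambda>a. norm (?f a x))"
      using AE_levy_interior[OF s]
    proof eventually_elim
      case (elim x)
      then show ?case using single[of x "norm (f x)"] by (auto simp: sums_iff)
    qed
    show "summable (\<lambda>a. \<integral>x. norm (?f a x) \<partial>levy_measure s)"
    proof (rule summable_comparison_test')
      show "summable (\<lambda>a. digit_prob s a * B)"
        using digit_prob_sums[OF s] by (intro summable_mult2) (auto simp: sums_iff)
      fix a :: nat assume "0 \<le> a"
      let ?t = "1 / (real a + 1 + s)"
      interpret t: prob_space "levy_measure ?t" using s by (intro prob_space_levy_measure) simp
      have "(\<integral>x. norm (?f a x) \<partial>levy_measure s) = digit_prob s a *\<^sub>R (\<integral>y. norm (f (1 / (real a + 1 + y))) \<partial>levy_measure ?t)"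
        using integral_levy_branch[of "\<lambda>x. norm (f x)" s a] s by simp
      also have "\<dots> \<le> digit_prob s a * B"
        unfolding real_scaleR_def
        by (intro mult_left_mono digit_prob_nonneg s t.integral_le_const t.integrable_const_bound[where B = B])
          (auto intro!: AE_I2 bd)
      finally show "norm (\<integral>x. norm (?f a x) \<partial>levy_measure s) \<le> digit_prob s a * B"
        by simp
    qed
  qed (rule int)
  also have "(\<integral>x. (\<Sum>a. ?f a x) \<partial>levy_measure s) = integral\<^sup>L (levy_measure s) f"
  proof (rule integral_cong_AE)
    show "AE x in levy_measure s. (\<Sum>a. ?f a x) = f x"
      using AE_levy_interior[OF s] by eventually_elim (use single in \<open>auto simp: sums_iff\<close>)
  qed auto
  finally show ?thesis using integral_levy_branch[OF assms(1) s] by simp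
qed

section \<open>Exponential mixing of the Gauss map\<close>

lemma digit_tail_diff:
  assumes "0 \<le> s" "0 \<le> t"
  shows "digit_tail s a - digit_tail t a = real a * (s - t) / ((real a + 1 + s) * (real a + 1 + t))"
proof -
  have "real a + 1 + s \<noteq> 0" "real a + 1 + t \<noteq> 0" using assms by auto
  then show ?thesis unfolding digit_tail_def by (simp add: field_simps)
qed

text \<open>Each term is below the telescoping 1 / ((M + 1) (M + 2) (M + 3)), because (M + 1) (M +
  3) < (M + 2)^2. The induction carries the tail that is still to come.\<close>

lemma inverse_cubes_le: "(\<Sum>a<M. 1 / (real a + 2) ^ 3) \<le> 1 / 4"
proof -
  have "(\<Sum>a<M. 1 / (real a + 2) ^ 3) \<le> 1 / 4 - 1 / (2 * (real M + 1) * (real M + 2))"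
  proof (induction M)
    case (Suc M)
    have "1 / (real M + 2) ^ 3 \<le> 1 / ((real M + 1) * (real M + 2) * (real M + 3))"
    proof (rule divide_left_mono)
      show "(real M + 1) * (real M + 2) * (real M + 3) \<le> (real M + 2) ^ 3"
        by (simp add: power3_eq_cube algebra_simps)
    qed auto
    also have "\<dots> = 1 / (2 * (real M + 1) * (real M + 2)) - 1 / (2 * (real (Suc M) + 1) * (real (Suc M) + 2))"
      by (simp add: divide_simps) (simp add: algebra_simps)
    finally show ?case using Suc by simp
  qed simp
  also have "\<dots> \<le> 1 / 4" by simp
  finally show ?thesis .
qed

lemma abel_summation:
  fixes \<phi> :: "nat \<Rightarrow> 'b::real_vector"
  shows "(\<Sum>a<M. (D a - D (Suc a)) *\<^sub>R \<phi> a) = D 0 *\<^sub>R \<phi> 0 + (\<Sum>a<M. D (Suc a) *\<^sub>R (\<phi> (Suc a) - \<phi> a)) - D M *\<^sub>R \<phi> M"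
  by (induction M) (auto simp: algebra_simps)

text \<open>The first digit is stochastically increasing in \<open>s\<close>, so Abel summation against its tails
  couples the digits for \<open>s\<close> and \<open>t\<close>.\<close>
lemma levy_transition_contracts:
  fixes \<Phi> \<Psi> :: "real \<Rightarrow> 'b::real_normed_vector"
  assumes lip: "\<And>u v. u \<in> {0..1} \<Longrightarrow> v \<in> {0..1} \<Longrightarrow> norm (\<Phi> u - \<Phi> v) \<le> L * \<bar>u - v\<bar>"
    and step: "\<And>s. s \<in> {0..1} \<Longrightarrow> (\<lambda>a. digit_prob s a *\<^sub>R \<Phi> (1 / (real a + 1 + s))) sums \<Psi> s"
    and st: "s \<in> {0..1}" "t \<in> {0..1}"
  shows "norm (\<Psi> s - \<Psi> t) \<le> 7 / 8 * L * \<bar>s - t\<bar>"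
proof -
  have L0: "0 \<le> L" using order_trans[OF norm_ge_zero lip[of 0 1]] by simp
  have s0: "0 \<le> s" "s \<le> 1" "0 \<le> t" "t \<le> 1" using st by auto
  define u where "u a = 1 / (real a + 1 + s)" for a
  define v where "v a = 1 / (real a + 1 + t)" for a
  define D where "D a = digit_tail s a - digit_tail t a" for a
  have u01: "u a \<in> {0..1}" for a using s0 by (auto simp: u_def)
  have v01: "v a \<in> {0..1}" for a using s0 by (auto simp: v_def)
  have uv: "\<bar>u a - v a\<bar> \<le> (1 / (real a + 1)\<^sup>2) * \<bar>s - t\<bar>" for a
  proof -
    have pos: "0 < real a + 1 + s" "0 < real a + 1 + t" using s0 by auto
    then have "u a - v a = (t - s) / ((real a + 1 + s) * (real a + 1 + t))"
      unfolding u_def v_def by (simp add: field_simps)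
    then have "\<bar>u a - v a\<bar> = \<bar>s - t\<bar> / ((real a + 1 + s) * (real a + 1 + t))"
      using pos by (simp add: abs_mult abs_minus_commute)
    also have "\<dots> \<le> \<bar>s - t\<bar> / ((real a + 1) * (real a + 1))"
      using s0 by (intro divide_left_mono mult_mono) (auto intro!: mult_pos_pos)
    finally show ?thesis by (simp add: power2_eq_square)
  qed
  have vv: "\<bar>v (Suc a) - v a\<bar> \<le> 1 / ((real a + 1) * (real a + 2))" for a
  proof -
    have pos: "0 < real a + 1 + t" "0 < real a + 2 + t" using s0 by auto
    then have "v a - v (Suc a) = 1 / ((real a + 1 + t) * (real a + 2 + t))"
      unfolding v_def by (simp add: field_simps)
    moreover have "\<dots> \<le> 1 / ((real a + 1) * (real a + 2))"
      using s0 by (intro divide_left_mono mult_mono) (auto intro!: mult_pos_pos)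
    moreover have "0 \<le> 1 / ((real a + 1 + t) * (real a + 2 + t))" using pos by simp
    ultimately show ?thesis by linarith
  qed
  have Dbd: "\<bar>D (Suc a)\<bar> \<le> (real a + 1) / (real a + 2)\<^sup>2 * \<bar>s - t\<bar>" for a
  proof -
    have pos: "0 < real a + 2 + s" "0 < real a + 2 + t" using s0 by auto
    have "D (Suc a) = (real a + 1) * (s - t) / ((real a + 2 + s) * (real a + 2 + t))"
      unfolding D_def digit_tail_diff[OF s0(1,3)] by (simp add: add_ac)
    then have "\<bar>D (Suc a)\<bar> = (real a + 1) * \<bar>s - t\<bar> / ((real a + 2 + s) * (real a + 2 + t))"
      using pos by (simp add: abs_mult)
    also have "\<dots> \<le> (real a + 1) * \<bar>s - t\<bar> / ((real a + 2) * (real a + 2))"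
      using s0 by (intro divide_left_mono mult_mono) (auto intro!: mult_pos_pos)
    finally show ?thesis by (simp add: power2_eq_square)
  qed
  have D0: "D 0 = 0" using s0 by (simp add: D_def digit_tail_def)
  have D_lim: "D \<longlonglongrightarrow> 0"
    unfolding D_def using tendsto_diff[OF digit_tail_lim digit_tail_lim] by simp
  \<comment> \<open>Same digit, two parameters: the branch with digit a + 1 contracts by 1 / (a +
    1)^2. Digit 1 need not contract but has probability at most 1/2, and all others contract by at
    most 1/4, so the mean factor is at most 1/4 + 3/4 * 1/2 = 5/8.\<close>
  have part1: "norm (\<Sum>a<M. digit_prob s a *\<^sub>R (\<Phi> (u a) - \<Phi> (v a))) \<le> 5 / 8 * L * \<bar>s - t\<bar>" for M
  proof -
    have psum: "(\<Sum>a<M. digit_prob s a) \<le> 1"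
      using digit_prob_sums[OF s0(1)] digit_prob_nonneg[OF s0(1)]
      by (metis sum_le_suminf sums_iff finite_lessThan)
    have p0: "digit_prob s 0 \<le> 1 / 2"
    proof -
      have "digit_prob s 0 = 1 / (2 + s)" using s0 by (simp add: digit_prob_def)
      also have "\<dots> \<le> 1 / 2" using s0 by (intro divide_left_mono) auto
      finally show ?thesis .
    qed
    have "norm (\<Sum>a<M. digit_prob s a *\<^sub>R (\<Phi> (u a) - \<Phi> (v a))) \<le>
      (\<Sum>a<M. digit_prob s a * (L * ((1 / (real a + 1)\<^sup>2) * \<bar>s - t\<bar>)))"
      by (rule sum_norm_le, unfold norm_scaleR,
          intro mult_mono order_trans[OF lip[OF u01 v01]] mult_left_mono uv L0)
        (use digit_prob_nonneg[OF s0(1)] in auto)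
    also have "\<dots> = L * \<bar>s - t\<bar> * (\<Sum>a<M. digit_prob s a * (1 / (real a + 1)\<^sup>2))"
      by (simp add: sum_distrib_left mult_ac)
    finally have 1: "norm (\<Sum>a<M. digit_prob s a *\<^sub>R (\<Phi> (u a) - \<Phi> (v a))) \<le>
      L * \<bar>s - t\<bar> * (\<Sum>a<M. digit_prob s a * (1 / (real a + 1)\<^sup>2))" .
    have "(\<Sum>a<M. digit_prob s a * (1 / (real a + 1)\<^sup>2)) \<le> (\<Sum>a<M. digit_prob s a * (1 / 4) + (if a = 0 then 3 / 8 else 0))"
    proof (rule sum_mono)
      fix a :: nat
      show "digit_prob s a * (1 / (real a + 1)\<^sup>2) \<le> digit_prob s a * (1 / 4) + (if a = 0 then 3 / 8 else 0)"
      proof (cases "a = 0")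
        case True
        then show ?thesis using p0 by simp
      next
        case False
        then have "2\<^sup>2 \<le> (real a + 1)\<^sup>2" by (intro power_mono) auto
        then have "1 / (real a + 1)\<^sup>2 \<le> 1 / 4" by (simp add: divide_simps)
        from mult_left_mono[OF this digit_prob_nonneg[OF s0(1), of a]] show ?thesis
          using False by simp
      qed
    qed
    also have "\<dots> \<le> 1 * (1 / 4) + 3 / 8"
      unfolding sum.distrib sum_distrib_right[symmetric]
      by (intro add_mono mult_right_mono psum) (auto simp: sum.delta)
    finally have "L * \<bar>s - t\<bar> * (\<Sum>a<M. digit_prob s a * (1 / (real a + 1)\<^sup>2)) \<le> L * \<bar>s - t\<bar> * (1 * (1 / 4) + 3 / 8)"
      using L0 by (intro mult_left_mono) auto
    with 1 show ?thesis by (simp add: mult_ac)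
  qed
  \<comment> \<open>Same branches, two digit laws. Abel summation pairs the tail differences
    \<open>D\<close> with the jumps of \<open>\<Phi>\<close> along \<open>v\<close>; a product is at
    most \<open>1 / (real a + 2) ^ 3\<close> up to the factor \<open>L * \<bar>s - t\<bar>\<close>,
    and these sum to at most 1/4. One boundary term is 0 since both tails start at 1, the other
    vanishes in the limit. In total 5/8 + 1/4 = 7/8.\<close>
  have part2: "norm (\<Sum>a<M. (digit_prob s a - digit_prob t a) *\<^sub>R \<Phi> (v a)) \<le> 1 / 4 * L * \<bar>s - t\<bar> + \<bar>D M\<bar> * (norm (\<Phi> 0) + L)" for M
  proof -
    have "(\<Sum>a<M. (digit_prob s a - digit_prob t a) *\<^sub>R \<Phi> (v a)) = (\<Sum>a<M. (D a - D (Suc a)) *\<^sub>R \<Phi> (v a))"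
      using s0 by (intro sum.cong) (auto simp: D_def digit_prob_eq_diff algebra_simps)
    also have "\<dots> = (\<Sum>a<M. D (Suc a) *\<^sub>R (\<Phi> (v (Suc a)) - \<Phi> (v a))) - D M *\<^sub>R \<Phi> (v M)"
      by (subst abel_summation) (simp add: D0)
    also have "norm \<dots> \<le> (\<Sum>a<M. L * \<bar>s - t\<bar> * (1 / (real a + 2) ^ 3)) + \<bar>D M\<bar> * (norm (\<Phi> 0) + L)"
    proof (rule order_trans[OF norm_triangle_ineq4], rule add_mono)
      show "norm (\<Sum>a<M. D (Suc a) *\<^sub>R (\<Phi> (v (Suc a)) - \<Phi> (v a))) \<le> (\<Sum>a<M. L * \<bar>s - t\<bar> * (1 / (real a + 2) ^ 3))"
      proof (rule sum_norm_le)
        fix a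
        have "norm (D (Suc a) *\<^sub>R (\<Phi> (v (Suc a)) - \<Phi> (v a))) \<le>
            ((real a + 1) / (real a + 2)\<^sup>2 * \<bar>s - t\<bar>) * (L * (1 / ((real a + 1) * (real a + 2))))"
          unfolding norm_scaleR
          by (intro mult_mono Dbd order_trans[OF lip[OF v01 v01]] mult_left_mono vv L0) auto
        also have "\<dots> = L * \<bar>s - t\<bar> * (1 / (real a + 2) ^ 3)"
        proof -
          have "(c / d\<^sup>2 * z) * (L * (1 / (c * d))) = L * z * (1 / d ^ 3)" if "c \<noteq> 0" for c d z :: real
            using that by (simp add: power2_eq_square power3_eq_cube mult_ac)
          note this[of "real a + 1"]
          then show ?thesis by (metis add_nonneg_pos less_numeral_extra(1) of_nat_0_le_iff order_less_irrefl)
        qed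
        finally show "norm (D (Suc a) *\<^sub>R (\<Phi> (v (Suc a)) - \<Phi> (v a))) \<le> L * \<bar>s - t\<bar> * (1 / (real a + 2) ^ 3)" .
      qed
      have "norm (\<Phi> (v M)) \<le> norm (\<Phi> 0) + norm (\<Phi> (v M) - \<Phi> 0)"
        by (metis add.commute diff_add_cancel norm_triangle_ineq)
      also have "norm (\<Phi> (v M) - \<Phi> 0) \<le> L * \<bar>v M - 0\<bar>" by (rule lip[OF v01]) simp
      also have "\<dots> \<le> L * 1" using v01[of M] by (intro mult_left_mono L0) auto
      finally show "norm (D M *\<^sub>R \<Phi> (v M)) \<le> \<bar>D M\<bar> * (norm (\<Phi> 0) + L)"
        unfolding norm_scaleR by (intro mult_left_mono) auto
    qed
    also have "\<dots> \<le> L * \<bar>s - t\<bar> * (1 / 4) + \<bar>D M\<bar> * (norm (\<Phi> 0) + L)"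
      unfolding sum_distrib_left[symmetric]
      by (intro add_right_mono mult_left_mono inverse_cubes_le mult_nonneg_nonneg L0) auto
    finally show ?thesis by (simp add: mult_ac)
  qed
  have bound: "norm ((\<Sum>a<M. digit_prob s a *\<^sub>R \<Phi> (u a)) - (\<Sum>a<M. digit_prob t a *\<^sub>R \<Phi> (v a)))
      \<le> 7 / 8 * L * \<bar>s - t\<bar> + \<bar>D M\<bar> * (norm (\<Phi> 0) + L)" for M
  proof -
    have "(\<Sum>a<M. digit_prob s a *\<^sub>R \<Phi> (u a)) - (\<Sum>a<M. digit_prob t a *\<^sub>R \<Phi> (v a)) =
      (\<Sum>a<M. digit_prob s a *\<^sub>R (\<Phi> (u a) - \<Phi> (v a))) + (\<Sum>a<M. (digit_prob s a - digit_prob t a) *\<^sub>R \<Phi> (v a))"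
      by (simp add: sum_subtractf[symmetric] sum.distrib[symmetric] algebra_simps)
    then show ?thesis using norm_triangle_le[OF add_mono[OF part1[of M] part2[of M]]] by (simp add: algebra_simps)
  qed
  have "(\<lambda>M. norm ((\<Sum>a<M. digit_prob s a *\<^sub>R \<Phi> (u a)) - (\<Sum>a<M. digit_prob t a *\<^sub>R \<Phi> (v a)))) \<longlonglongrightarrow> norm (\<Psi> s - \<Psi> t)"
    using step[OF st(1)] step[OF st(2)] unfolding sums_def u_def v_def by (intro tendsto_norm tendsto_diff)
  moreover have "(\<lambda>M. 7 / 8 * L * \<bar>s - t\<bar> + \<bar>D M\<bar> * (norm (\<Phi> 0) + L)) \<longlonglongrightarrow> 7 / 8 * L * \<bar>s - t\<bar> + \<bar>0\<bar> * (norm (\<Phi> 0) + L)"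
    by (intro tendsto_intros D_lim)
  ultimately have "norm (\<Psi> s - \<Psi> t) \<le> 7 / 8 * L * \<bar>s - t\<bar> + \<bar>0\<bar> * (norm (\<Phi> 0) + L)"
    by (rule LIMSEQ_le) (use bound in auto)
  then show ?thesis by simp
qed

lemma levy_density_diff:
  assumes "s \<in> {0..1}" "t \<in> {0..1}" "y \<in> {0..1}"
  shows "\<bar>levy_density s y - levy_density t y\<bar> \<le> 4 * \<bar>s - t\<bar>"
proof -
  have pos: "1 \<le> 1 + s * y" "1 \<le> 1 + t * y" using assms by auto
  have sq: "1 \<le> (1 + s * y)\<^sup>2" "1 \<le> (1 + t * y)\<^sup>2" using pos by (auto intro!: one_le_power)
  have "levy_density s y - levy_density t y =
    ((1 + s) * (1 + t * y)\<^sup>2 - (1 + t) * (1 + s * y)\<^sup>2) / ((1 + s * y)\<^sup>2 * (1 + t * y)\<^sup>2)"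
    unfolding levy_density_def using pos by (simp add: diff_frac_eq)
  also have "(1 + s) * (1 + t * y)\<^sup>2 - (1 + t) * (1 + s * y)\<^sup>2 =
    (s - t) * (1 - 2 * y - y\<^sup>2 * (s + t) - y\<^sup>2 * (s * t))"
    by (simp add: power2_eq_square algebra_simps)
  finally have eq: "levy_density s y - levy_density t y =
    (s - t) * (1 - 2 * y - y\<^sup>2 * (s + t) - y\<^sup>2 * (s * t)) / ((1 + s * y)\<^sup>2 * (1 + t * y)\<^sup>2)" .
  have y2: "0 \<le> y\<^sup>2" "y\<^sup>2 \<le> 1" using assms by (auto intro: power_le_one)
  have abs4: "0 \<le> y\<^sup>2 * (s + t)" "y\<^sup>2 * (s + t) \<le> 1 * 2" "0 \<le> y\<^sup>2 * (s * t)" "y\<^sup>2 * (s * t) \<le> 1 * (1 * 1)"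
  proof -
    show "y\<^sup>2 * (s + t) \<le> 1 * 2" using assms y2 by (intro mult_mono) auto
    show "y\<^sup>2 * (s * t) \<le> 1 * (1 * 1)" using assms y2 by (intro mult_mono) auto
  qed (use assms in auto)
  \<comment> \<open>The expression lies between 1 - 2 - 2 - 1 = - 4 and 1.\<close>
  have "\<bar>1 - 2 * y - y\<^sup>2 * (s + t) - y\<^sup>2 * (s * t)\<bar> \<le> 4"
    using abs4 assms(3) unfolding abs_le_iff atLeastAtMost_iff by linarith
  then have "\<bar>s - t\<bar> * \<bar>1 - 2 * y - y\<^sup>2 * (s + t) - y\<^sup>2 * (s * t)\<bar> / ((1 + s * y)\<^sup>2 * (1 + t * y)\<^sup>2) \<le> \<bar>s - t\<bar> * 4 / (1 * 1)"
    using sq by (intro frac_le mult_mono mult_left_mono) auto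
  then show ?thesis unfolding eq by (simp add: abs_mult)
qed

lemma levy_integral_lipschitz:
  fixes f :: "real \<Rightarrow> complex"
  assumes [measurable]: "f \<in> borel_measurable borel" and bd: "\<And>x. norm (f x) \<le> B"
    and st: "s \<in> {0..1}" "t \<in> {0..1}"
  shows "norm (integral\<^sup>L (levy_measure s) f - integral\<^sup>L (levy_measure t) f) \<le> 4 * B * \<bar>s - t\<bar>"
proof -
  have B0: "0 \<le> B" using order_trans[OF norm_ge_zero bd] .
  have int: "integrable unit_measure (\<lambda>x. levy_density r x *\<^sub>R f x)" if "r \<in> {0..1}" for r
  proof (rule unit.integrable_const_bound[where B = "2 * B"])
    show "AE x in unit_measure. norm (levy_density r x *\<^sub>R f x) \<le> 2 * B"
      using AE_unit_interior
    proof eventually_elim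
      case (elim x)
      then show ?case
        using levy_density_le[OF that, of x] levy_density_pos[of r x] that bd[of x] B0
        by (auto intro!: mult_mono)
    qed
  qed auto
  have "integral\<^sup>L (levy_measure s) f - integral\<^sup>L (levy_measure t) f =
    (\<integral>x. levy_density s x *\<^sub>R f x - levy_density t x *\<^sub>R f x \<partial>unit_measure)"
    using st int by (simp add: integral_levy_measure)
  also have "norm \<dots> \<le> (\<integral>x. norm (levy_density s x *\<^sub>R f x - levy_density t x *\<^sub>R f x) \<partial>unit_measure)"
    by (rule integral_norm_bound)
  also have "\<dots> \<le> 4 * B * \<bar>s - t\<bar>"
  proof (rule unit.integral_le_const)
    show "integrable unit_measure (\<lambda>x. norm (levy_density s x *\<^sub>R f x - levy_density t x *\<^sub>R f x))"
      using int st by (intro integrable_norm Bochner_Integration.integrable_diff)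
    show "AE x in unit_measure. norm (levy_density s x *\<^sub>R f x - levy_density t x *\<^sub>R f x) \<le> 4 * B * \<bar>s - t\<bar>"
      using AE_unit_interior
    proof eventually_elim
      case (elim x)
      have "norm (levy_density s x *\<^sub>R f x - levy_density t x *\<^sub>R f x) = \<bar>levy_density s x - levy_density t x\<bar> * norm (f x)"
        by (simp flip: scaleR_diff_left)
      also have "\<dots> \<le> (4 * \<bar>s - t\<bar>) * B"
        using elim st by (intro mult_mono levy_density_diff bd) auto
      finally show ?case by (simp add: mult_ac)
    qed
  qed
  finally show ?thesis .
qed

section \<open>The Gauss map acting on the conditional laws\<close>

lemma gauss_map_measurable [measurable]: "gauss_map \<in> borel_measurable borel"
  unfolding gauss_map_def frac_def by measurable

lemma gauss_map_funpow_measurable [measurable]: "(gauss_map ^^ n) \<in> borel_measurable borel"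
  by (induction n) (auto simp: o_def id_def intro: measurable_compose[OF _ gauss_map_measurable])

lemma gauss_map_branch:
  assumes "0 < y" "y < 1"
  shows "gauss_map (1 / (real a + 1 + y)) = y"
proof -
  have "frac (real a + 1 + y) = y" using assms by (subst frac_unique_iff) auto
  then show ?thesis using assms by (auto simp: gauss_map_def)
qed

text \<open>The Gauss map acts on the parameter as a Markov chain that moves from \<open>s\<close>
  to \<open>1 / (real a + 1 + s)\<close> with probability \<open>digit_prob s a\<close>. Mixing
  becomes a statement about this chain on [0, 1] instead of a spectral property of a transfer
  operator.\<close>

lemma levy_gauss_step:
  fixes f :: "real \<Rightarrow> complex"
  assumes [measurable]: "f \<in> borel_measurable borel" and s: "0 \<le> s" and bd: "\<And>x. norm (f x) \<le> B"
  shows "(\<lambda>a. digit_prob s a *\<^sub>R (integral\<^sup>L (levy_measure (1 / (real a + 1 + s))) f))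
    sums (\<integral>x. f (gauss_map x) \<partial>levy_measure s)"
proof -
  have "(\<integral>y. f (gauss_map (1 / (real a + 1 + y))) \<partial>levy_measure (1 / (real a + 1 + s))) =
    integral\<^sup>L (levy_measure (1 / (real a + 1 + s))) f" for a
  proof (rule integral_cong_AE)
    show "AE y in levy_measure (1 / (real a + 1 + s)). f (gauss_map (1 / (real a + 1 + y))) = f y"
    proof -
      have "0 \<le> 1 / (real a + 1 + s)" using s by simp
      from AE_levy_interior[OF this] show ?thesis
        by eventually_elim (simp add: gauss_map_branch)
    qed
  qed auto
  then show ?thesis
    using levy_branch_sums[of "\<lambda>x. f (gauss_map x)" s B] s bd by simp
qed

text \<open>Each step of the chain multiplies the Lipschitz constant in the parameter by 7/8; the
  initial constant \<open>4 * B\<close> comes from the densities themselves.\<close>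

lemma levy_iterate_lipschitz:
  fixes f :: "real \<Rightarrow> complex"
  assumes [measurable]: "f \<in> borel_measurable borel" and bd: "\<And>x. norm (f x) \<le> B"
    and "s \<in> {0..1}" "t \<in> {0..1}"
  shows "norm ((\<integral>x. f ((gauss_map ^^ n) x) \<partial>levy_measure s) - (\<integral>x. f ((gauss_map ^^ n) x) \<partial>levy_measure t))
    \<le> (7 / 8) ^ n * (4 * B) * \<bar>s - t\<bar>"
  using assms(3,4)
proof (induction n arbitrary: s t)
  case 0
  then show ?case using levy_integral_lipschitz[OF assms(1) bd] by simp
next
  case (Suc n)
  define \<Phi> where "\<Phi> s = (\<integral>x. f ((gauss_map ^^ n) x) \<partial>levy_measure s)" for s
  define \<Psi> where "\<Psi> s = (\<integral>x. f ((gauss_map ^^ Suc n) x) \<partial>levy_measure s)" for s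
  have "norm (\<Psi> s - \<Psi> t) \<le> 7 / 8 * ((7 / 8) ^ n * (4 * B)) * \<bar>s - t\<bar>"
  proof (rule levy_transition_contracts[where \<Phi> = \<Phi>])
    fix s :: real assume "s \<in> {0..1}"
    then show "(\<lambda>a. digit_prob s a *\<^sub>R \<Phi> (1 / (real a + 1 + s))) sums \<Psi> s"
      unfolding \<Phi>_def \<Psi>_def funpow_Suc_right o_def
      by (intro levy_gauss_step[where B = B] bd) auto
  qed (use Suc \<Phi>_def in auto)
  then show ?case unfolding \<Psi>_def by simp
qed

section \<open>Invariance of the Gauss measure and its mixture formula\<close>

lemma inverse_products_sum:
  assumes "0 \<le> (y::real)"
  shows "(\<lambda>a. 1 / ((real a + 1 + y) * (real a + 2 + y))) sums (1 / (1 + y))"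
proof -
  have "(\<lambda>a. 1 / (real a + 1 + y)) \<longlonglongrightarrow> 0" by real_asymp
  from telescope_sums'[OF this] have "(\<lambda>a. 1 / (real a + 1 + y) - 1 / (real (Suc a) + 1 + y)) sums (1 / (1 + y))" by simp
  also have "(\<lambda>a. 1 / (real a + 1 + y) - 1 / (real (Suc a) + 1 + y)) = (\<lambda>a. 1 / ((real a + 1 + y) * (real a + 2 + y)))"
  proof
    fix a
    have "real a + 1 + y \<noteq> 0" "real a + 2 + y \<noteq> 0" using assms by auto
    then show "1 / (real a + 1 + y) - 1 / (real (Suc a) + 1 + y) = 1 / ((real a + 1 + y) * (real a + 2 + y))"
      by (simp add: field_simps)
  qed
  finally show ?thesis .
qed

lemma nn_integral_digit_cells:
  assumes [measurable]: "F \<in> borel_measurable borel"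
  shows "(\<integral>\<^sup>+x. F x \<partial>unit_measure) =
    (\<Sum>a. \<integral>\<^sup>+y. F (1 / (real a + 1 + y)) * ennreal (1 / (real a + 1 + y)\<^sup>2) \<partial>unit_measure)"
proof -
  have "(\<integral>\<^sup>+x. F x \<partial>unit_measure) = (\<integral>\<^sup>+x. indicator {0..1} x * F x \<partial>lborel)"
    by (rule nn_integral_unit_measure) measurable
  also have "\<dots> = (\<integral>\<^sup>+x. (\<Sum>a. F x * indicator (digit_cell a) x) \<partial>lborel)"
  proof (rule nn_integral_cong_AE)
    show "AE x in lborel. indicator {0..1} x * F x = (\<Sum>a. F x * indicator (digit_cell a) x)"
      using AE_lborel_singleton[of "0::real"]
    proof eventually_elim
      case (elim x)
      show ?case
      proof (cases "x \<in> {0<..1}")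
        case True
        obtain i where "\<forall>a. x \<in> digit_cell a \<longleftrightarrow> a = i" using digit_cell_unique[OF True] by auto
        then have "F x * indicator (digit_cell a) x = (if a = i then F x else 0)" for a by (simp add: indicator_def)
        then show ?thesis using sums_single[of i "\<lambda>_. F x"] True by (auto simp: sums_iff)
      next
        case False
        then have "x \<notin> digit_cell a" for a using digit_cell_subset by blast
        then show ?thesis using False elim by auto
      qed
    qed
  qed
  also have "\<dots> = (\<Sum>a. \<integral>\<^sup>+x. F x * indicator (digit_cell a) x \<partial>lborel)"
    by (rule nn_integral_suminf) measurable
  finally show ?thesis by (simp add: nn_integral_digit_cell)
qed

text \<open>Density times Jacobian on the inverse branch with digit a + 1 is 1 / (ln 2 (a + 1 + y)
  (a + 2 + y)), and the sum over the branches telescopes to the density at y.\<close>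

lemma gauss_borel_invariant: "distr gauss_borel gauss_borel gauss_map = gauss_borel"
proof (rule measure_eqI)
  fix A assume "A \<in> sets (distr gauss_borel gauss_borel gauss_map)"
  then have [measurable]: "A \<in> sets borel" by simp
  have "emeasure (distr gauss_borel gauss_borel gauss_map) A = emeasure gauss_borel (gauss_map -` A)"
    by (subst emeasure_distr) auto
  also have "\<dots> = (\<integral>\<^sup>+x. indicator (gauss_map -` A) x \<partial>gauss_borel)"
    using measurable_sets_borel[OF gauss_map_measurable, of A] by (intro nn_integral_indicator[symmetric]) simp
  also have "\<dots> = (\<integral>\<^sup>+x. indicator A (gauss_map x) \<partial>gauss_borel)"
    by (intro nn_integral_cong) (auto simp: indicator_def)
  also have "\<dots> = (\<integral>\<^sup>+x. ennreal (gauss_density x) * indicator A (gauss_map x) \<partial>unit_measure)"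
    unfolding gauss_borel_def by (subst nn_integral_density) auto
  also have "\<dots> = (\<Sum>a. \<integral>\<^sup>+y. ennreal (gauss_density (1 / (real a + 1 + y))) * indicator A (gauss_map (1 / (real a + 1 + y)))
      * ennreal (1 / (real a + 1 + y)\<^sup>2) \<partial>unit_measure)"
    by (rule nn_integral_digit_cells) measurable
  also have "\<dots> = (\<Sum>a. \<integral>\<^sup>+y. ennreal (1 / ln 2 * (1 / ((real a + 1 + y) * (real a + 2 + y)))) * indicator A y \<partial>unit_measure)"
  proof (intro arg_cong[where f = suminf] ext nn_integral_cong_AE)
    fix a
    show "AE y in unit_measure. ennreal (gauss_density (1 / (real a + 1 + y))) * indicator A (gauss_map (1 / (real a + 1 + y)))
      * ennreal (1 / (real a + 1 + y)\<^sup>2) = ennreal (1 / ln 2 * (1 / ((real a + 1 + y) * (real a + 2 + y)))) * indicator A y"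
      using AE_unit_interior
    proof eventually_elim
      case (elim y)
      have pos: "0 < real a + 1 + y" "0 < real a + 2 + y" using elim by auto
      have 1: "1 + 1 / (real a + 1 + y) = (real a + 2 + y) / (real a + 1 + y)" using pos by (simp add: field_simps)
      have "gauss_density (1 / (real a + 1 + y)) * (1 / (real a + 1 + y)\<^sup>2) = 1 / ln 2 * (1 / ((real a + 1 + y) * (real a + 2 + y)))"
        unfolding gauss_density_def 1 using pos by (simp add: power2_eq_square)
      moreover have "0 \<le> gauss_density (1 / (real a + 1 + y))" using pos by (intro less_imp_le gauss_density_pos) auto
      ultimately have "ennreal (gauss_density (1 / (real a + 1 + y))) * ennreal (1 / (real a + 1 + y)\<^sup>2) = ennreal (1 / ln 2 * (1 / ((real a + 1 + y) * (real a + 2 + y))))"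
        by (subst ennreal_mult[symmetric]) auto
      then show ?case using elim by (simp add: gauss_map_branch mult_ac)
    qed
  qed
  also have "\<dots> = (\<integral>\<^sup>+y. (\<Sum>a. ennreal (1 / ln 2 * (1 / ((real a + 1 + y) * (real a + 2 + y)))) * indicator A y) \<partial>unit_measure)"
    by (rule nn_integral_suminf[symmetric]) measurable
  also have "\<dots> = (\<integral>\<^sup>+y. ennreal (gauss_density y) * indicator A y \<partial>unit_measure)"
  proof (rule nn_integral_cong_AE)
    show "AE y in unit_measure. (\<Sum>a. ennreal (1 / ln 2 * (1 / ((real a + 1 + y) * (real a + 2 + y)))) * indicator A y) = ennreal (gauss_density y) * indicator A y"
      using AE_unit_interior
    proof eventually_elim
      case (elim y)
      have "(\<Sum>a. ennreal (1 / ln 2 * (1 / ((real a + 1 + y) * (real a + 2 + y))))) = ennreal (1 / ln 2 * (1 / (1 + y)))"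
        using elim by (intro suminf_ennreal_eq sums_mult inverse_products_sum) auto
      then show ?case by (simp add: gauss_density_def)
    qed
  qed
  also have "\<dots> = emeasure gauss_borel A"
    unfolding gauss_borel_def by (subst emeasure_density) auto
  finally show "emeasure (distr gauss_borel gauss_borel gauss_map) A = emeasure gauss_borel A" .
qed simp

text \<open>If the parameter is Gauss distributed, so is the point. The joint density 1 / (ln 2 (1 +
  s y)^2), that of the natural extension of the Gauss map, is symmetric in \<open>s\<close> and
  \<open>y\<close>, so both marginals agree.\<close>

lemma integral_inverse_square_mix:
  assumes "0 \<le> y"
  shows "(\<integral>s. gauss_density s * levy_density s y \<partial>unit_measure) = gauss_density y"
proof -
  have "(\<integral>s. gauss_density s * levy_density s y \<partial>unit_measure) = (\<integral>s. 1 / ln 2 * (1 / (1 + s * y)\<^sup>2) \<partial>unit_measure)"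
  proof (rule integral_cong_AE)
    show "AE s in unit_measure. gauss_density s * levy_density s y = 1 / ln 2 * (1 / (1 + s * y)\<^sup>2)"
      using AE_unit_interior by eventually_elim (auto simp: gauss_density_def levy_density_def)
  qed (unfold levy_density_def, measurable)
  also have "\<dots> = 1 / ln 2 * (\<integral>s. 1 / (1 + s * y)\<^sup>2 \<partial>unit_measure)"
    by (rule integral_mult_right_zero)
  also have "(\<integral>s. 1 / (1 + s * y)\<^sup>2 \<partial>unit_measure) = (\<integral>s. 1 / (1 + s * y)\<^sup>2 * indicator {0..1} s \<partial>lborel)"
    by (subst integral_unit_measure) (auto simp: mult.commute)
  also have "\<dots> = 1 / (1 + 1 * y) - 0 / (1 + 0 * y)"
  proof (rule integral_FTC_Icc_nonneg[where F = "\<lambda>s. s / (1 + s * y)"])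
    fix s :: real assume "s \<in> {0..1}"
    then have s: "0 \<le> s" by simp
    have "1 + s * y \<noteq> 0" using s mult_nonneg_nonneg[OF s assms] by linarith
    then show "((\<lambda>s. s / (1 + s * y)) has_real_derivative 1 / (1 + s * y)\<^sup>2) (at s)"
      by (auto intro!: derivative_eq_intros simp: field_simps power2_eq_square)
  qed auto
  finally show ?thesis by (simp add: gauss_density_def)
qed

lemma gauss_mixture:
  fixes f :: "real \<Rightarrow> complex"
  assumes [measurable]: "f \<in> borel_measurable borel" and bd: "\<And>x. norm (f x) \<le> B"
  shows "(\<integral>s. integral\<^sup>L (levy_measure s) f \<partial>gauss_borel) = integral\<^sup>L gauss_borel f"
    and "(\<lambda>s. integral\<^sup>L (levy_measure s) f) \<in> borel_measurable borel"
proof -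
  interpret pair_prob_space unit_measure unit_measure ..
  have "integral\<^sup>L (levy_measure s) f = (\<integral>y. max 0 (levy_density s y) *\<^sub>R f y \<partial>unit_measure)" for s
  proof -
    \<comment> \<open>For \<open>s < - 1\<close> the formula for the density is negative and
      \<open>ennreal\<close> cuts it to 0. Writing the cut as \<open>max 0\<close> gives one
      expression valid for all real \<open>s\<close>, as measurability in \<open>s\<close> on the
      whole line requires.\<close>
    have eq: "levy_measure s = density unit_measure (\<lambda>y. ennreal (max 0 (levy_density s y)))"
      unfolding levy_measure_def by (intro density_cong) (auto simp: max_def ennreal_neg)
    show ?thesis unfolding eq by (rule integral_density) auto
  qed
  moreover have "(\<lambda>s. \<integral>y. max 0 (levy_density s y) *\<^sub>R f y \<partial>unit_measure) \<in> borel_measurable borel"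
    unfolding levy_density_def by measurable
  ultimately show meas [measurable]: "(\<lambda>s. integral\<^sup>L (levy_measure s) f) \<in> borel_measurable borel"
    by simp
  \<comment> \<open>The indicators make the kernel nonnegative and bounded everywhere, which gives
    integrability on the product directly.\<close>
  define k :: "real \<Rightarrow> real \<Rightarrow> real" where
    "k s y = indicator {0..1} s * indicator {0..1} y * (gauss_density s * levy_density s y)" for s y
  have k_meas [measurable]: "(\<lambda>(s, y). k s y) \<in> borel_measurable (borel \<Otimes>\<^sub>M borel)"
    unfolding k_def gauss_density_def levy_density_def by measurable
  have k_meas1 [measurable]: "(\<lambda>y. k s y) \<in> borel_measurable borel" for s
    unfolding k_def gauss_density_def levy_density_def by measurable
  have k_meas2 [measurable]: "(\<lambda>s. k s y) \<in> borel_measurable borel" for y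
    unfolding k_def gauss_density_def levy_density_def by measurable
  have k_bd: "0 \<le> k s y" "k s y \<le> 1 / ln 2 * 2" for s y
  proof -
    show "0 \<le> k s y"
      unfolding k_def using gauss_density_pos[of s] levy_density_pos[of s y] by (auto simp: indicator_def)
    show "k s y \<le> 1 / ln 2 * 2"
    proof (cases "s \<in> {0..1} \<and> y \<in> {0..1}")
      case True
      then have "gauss_density s * levy_density s y \<le> 1 / ln 2 * 2"
        by (intro mult_mono gauss_density_le levy_density_le less_imp_le[OF levy_density_pos]) auto
      then show ?thesis using True by (simp add: k_def)
    qed (auto simp: k_def indicator_def)
  qed
  have B0: "0 \<le> B" using order_trans[OF norm_ge_zero bd] .
  have int: "integrable (unit_measure \<Otimes>\<^sub>M unit_measure) (\<lambda>(s, y). k s y *\<^sub>R f y)"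
  proof (rule integrable_const_bound[where B = "1 / ln 2 * 2 * B"])
    show "AE z in unit_measure \<Otimes>\<^sub>M unit_measure. norm (case z of (s, y) \<Rightarrow> k s y *\<^sub>R f y) \<le> 1 / ln 2 * 2 * B"
    proof (intro AE_I2, clarify)
      fix s y
      show "norm (k s y *\<^sub>R f y) \<le> 1 / ln 2 * 2 * B"
        unfolding norm_scaleR abs_of_nonneg[OF k_bd(1)] by (intro mult_mono k_bd bd) auto
    qed
  qed (simp add: split_beta)
  have "(\<integral>s. integral\<^sup>L (levy_measure s) f \<partial>gauss_borel) = (\<integral>s. gauss_density s *\<^sub>R integral\<^sup>L (levy_measure s) f \<partial>unit_measure)"
    by (rule integral_gauss_borel) measurable
  also have "\<dots> = (\<integral>s. (\<integral>y. k s y *\<^sub>R f y \<partial>unit_measure) \<partial>unit_measure)"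
  proof (rule integral_cong_AE)
    show "AE s in unit_measure. gauss_density s *\<^sub>R integral\<^sup>L (levy_measure s) f = (\<integral>y. k s y *\<^sub>R f y \<partial>unit_measure)"
      using AE_unit_interior
    proof eventually_elim
      case (elim s)
      have "gauss_density s *\<^sub>R integral\<^sup>L (levy_measure s) f = (\<integral>y. gauss_density s *\<^sub>R (levy_density s y *\<^sub>R f y) \<partial>unit_measure)"
        using elim by (subst integral_levy_measure) (simp_all only: integral_scaleR_right, auto)
      also have "\<dots> = (\<integral>y. k s y *\<^sub>R f y \<partial>unit_measure)"
      proof (rule integral_cong_AE)
        show "AE y in unit_measure. gauss_density s *\<^sub>R (levy_density s y *\<^sub>R f y) = k s y *\<^sub>R f y"
          using AE_unit_interior by eventually_elim (use elim in \<open>auto simp: k_def\<close>)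
      qed auto
      finally show ?case .
    qed
  qed measurable
  also have "\<dots> = (\<integral>y. (\<integral>s. k s y *\<^sub>R f y \<partial>unit_measure) \<partial>unit_measure)"
    by (rule Fubini_integral[symmetric]) (rule int)
  also have "\<dots> = (\<integral>y. gauss_density y *\<^sub>R f y \<partial>unit_measure)"
  proof (rule integral_cong_AE)
    show "AE y in unit_measure. (\<integral>s. k s y *\<^sub>R f y \<partial>unit_measure) = gauss_density y *\<^sub>R f y"
      using AE_unit_interior
    proof eventually_elim
      case (elim y)
      have "integrable unit_measure (\<lambda>s. k s y)"
        by (rule unit.integrable_const_bound[where B = "1 / ln 2 * 2"]) (use k_bd in \<open>auto intro!: AE_I2\<close>)
      then have "(\<integral>s. k s y *\<^sub>R f y \<partial>unit_measure) = (\<integral>s. k s y \<partial>unit_measure) *\<^sub>R f y"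
        by (intro integral_scaleR_left)
      also have "(\<integral>s. k s y \<partial>unit_measure) = (\<integral>s. gauss_density s * levy_density s y \<partial>unit_measure)"
      proof (rule integral_cong_AE)
        show "AE s in unit_measure. k s y = gauss_density s * levy_density s y"
          using AE_unit_interior by eventually_elim (use elim in \<open>auto simp: k_def\<close>)
      qed (unfold levy_density_def, measurable)
      also have "\<dots> = gauss_density y" using elim by (intro integral_inverse_square_mix) auto
      finally show ?case .
    qed
  qed measurable
  also have "\<dots> = integral\<^sup>L gauss_borel f" by (rule integral_gauss_borel[symmetric]) measurable
  finally show "(\<integral>s. integral\<^sup>L (levy_measure s) f \<partial>gauss_borel) = integral\<^sup>L gauss_borel f" .
qed

lemma gauss_funpow_invariant: "distr gauss_borel gauss_borel (gauss_map ^^ n) = gauss_borel"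
proof (induction n)
  case 0
  then show ?case by (simp add: id_def distr_id)
next
  case (Suc n)
  have "distr gauss_borel gauss_borel (gauss_map ^^ Suc n) = distr (distr gauss_borel gauss_borel (gauss_map ^^ n)) gauss_borel gauss_map"
    by (subst distr_distr) auto
  then show ?case unfolding Suc gauss_borel_invariant .
qed

text \<open>Average the Lipschitz bound over a Gauss distributed \<open>t\<close>. By the mixture
  formula and invariance the mean of \<open>\<Phi> t\<close> is the Gauss integral of
  \<open>f\<close>, and two parameters in [0, 1] are at distance at most 1.\<close>

lemma levy_iterate_mixing:
  fixes f :: "real \<Rightarrow> complex"
  assumes [measurable]: "f \<in> borel_measurable borel" and bd: "\<And>x. norm (f x) \<le> B"
    and s: "s \<in> {0..1}"
  shows "norm ((\<integral>x. f ((gauss_map ^^ n) x) \<partial>levy_measure s) - integral\<^sup>L gauss_borel f) \<le> 4 * B * (7 / 8) ^ n"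
proof -
  have B0: "0 \<le> B" using order_trans[OF norm_ge_zero bd] .
  define \<Phi> where "\<Phi> t = (\<integral>x. f ((gauss_map ^^ n) x) \<partial>levy_measure t)" for t
  have bdn: "norm (f ((gauss_map ^^ n) x)) \<le> B" for x by (rule bd)
  have \<Phi>_meas [measurable]: "\<Phi> \<in> borel_measurable borel"
    using gauss_mixture(2)[OF _ bdn] unfolding \<Phi>_def[abs_def] by measurable
  have AE01: "AE t in gauss_borel. t \<in> {0..1}"
    unfolding AE_gauss_borel using AE_unit_interior by eventually_elim auto
  have \<Phi>_bd: "norm (\<Phi> t) \<le> B" if "t \<in> {0..1}" for t
  proof -
    interpret t: prob_space "levy_measure t" using that by (intro prob_space_levy_measure) auto
    show ?thesis unfolding \<Phi>_def by (rule t.norm_integral_le) (auto intro: bd)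
  qed
  have \<Phi>_int: "integrable gauss_borel \<Phi>"
  proof (rule gauss.integrable_const_bound[where B = B])
    show "AE t in gauss_borel. norm (\<Phi> t) \<le> B"
      using AE01 by eventually_elim (rule \<Phi>_bd)
  qed measurable
  have "integral\<^sup>L gauss_borel f = (\<integral>x. f ((gauss_map ^^ n) x) \<partial>gauss_borel)"
    using integral_distr[of "gauss_map ^^ n" gauss_borel gauss_borel f] by (simp add: gauss_funpow_invariant)
  also have "\<dots> = integral\<^sup>L gauss_borel \<Phi>"
    unfolding \<Phi>_def by (rule gauss_mixture(1)[symmetric, OF _ bdn]) measurable
  finally have "\<Phi> s - integral\<^sup>L gauss_borel f = (\<integral>t. \<Phi> s - \<Phi> t \<partial>gauss_borel)"
    using \<Phi>_int gauss.prob_space by simp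
  also have "norm \<dots> \<le> (\<integral>t. norm (\<Phi> s - \<Phi> t) \<partial>gauss_borel)" by (rule integral_norm_bound)
  also have "\<dots> \<le> 4 * B * (7 / 8) ^ n"
  proof (rule gauss.integral_le_const)
    show "integrable gauss_borel (\<lambda>t. norm (\<Phi> s - \<Phi> t))" using \<Phi>_int by simp
    show "AE t in gauss_borel. norm (\<Phi> s - \<Phi> t) \<le> 4 * B * (7 / 8) ^ n"
      using AE01
    proof eventually_elim
      case (elim t)
      have "norm (\<Phi> s - \<Phi> t) \<le> (7 / 8) ^ n * (4 * B) * \<bar>s - t\<bar>"
        unfolding \<Phi>_def by (rule levy_iterate_lipschitz[OF _ bd s elim]) measurable
      also have "\<dots> \<le> (7 / 8) ^ n * (4 * B) * 1"
        using elim s B0 by (intro mult_left_mono) auto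
      finally show ?case by (simp add: mult_ac)
    qed
  qed
  finally show ?thesis unfolding \<Phi>_def .
qed

text \<open>From the point where an orbit reaches 0 on, all digits are \<open>\<lfloor>1 / 0\<rfloor> = 0\<close>.\<close>
fun cf_digits :: "nat \<Rightarrow> real \<Rightarrow> int list" where
  "cf_digits 0 x = []"
| "cf_digits (Suc n) x = \<lfloor>1 / x\<rfloor> # cf_digits n (gauss_map x)"

lemma cf_digits_measurable [measurable]: "cf_digits n \<in> measurable borel (count_space UNIV)"
proof (induction n)
  case (Suc n)
  have [measurable]: "(\<lambda>x. cf_digits n (gauss_map x)) \<in> measurable borel (count_space UNIV)"
    using measurable_compose[OF gauss_map_measurable Suc] .
  have "(\<lambda>x. \<lfloor>1 / x\<rfloor> # cf_digits n (gauss_map x)) \<in> measurable borel (count_space UNIV)"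
    by (rule measurable_compose_countable[where f = "\<lambda>i x. i # cf_digits n (gauss_map x)" and g = "\<lambda>x. \<lfloor>1 / x\<rfloor>"])
      (auto intro: measurable_compose[where g = "\<lambda>l. i # l" for i])
  then show ?case by simp
qed simp

lemma cf_digits_fun_measurable [measurable]:
  "(\<lambda>x. \<eta> (cf_digits n x)) \<in> borel_measurable borel"
  by (rule measurable_compose[OF cf_digits_measurable]) simp

lemma cf_digits_branch:
  assumes "0 < y" "y < 1"
  shows "cf_digits (Suc n) (1 / (real a + 1 + y)) = (int a + 1) # cf_digits n y"
proof -
  have "\<lfloor>real a + 1 + y\<rfloor> = int a + 1" using assms by (intro floor_unique) auto
  then show ?thesis using gauss_map_branch[OF assms] by simp
qed

text \<open>Given the first \<open>p\<close> digits, the iterate at time \<open>p\<close> has a law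
  of the family, and the mixing bound is uniform in its parameter; this is why \<open>p\<close> does
  not enter the estimate. The induction conditions on one digit, which moves \<open>s\<close> to the
  next parameter and is absorbed into \<open>\<eta>\<close>.\<close>

lemma digits_mixing:
  fixes g :: "real \<Rightarrow> complex" and \<eta> :: "int list \<Rightarrow> complex"
  assumes [measurable]: "g \<in> borel_measurable borel" and bd: "\<And>x. norm (g x) \<le> B"
    and mean: "integral\<^sup>L gauss_borel g = 0"
    and "s \<in> {0..1}" "\<And>l. norm (\<eta> l) \<le> K"
  shows "norm (\<integral>x. \<eta> (cf_digits p x) * g ((gauss_map ^^ (p + n)) x) \<partial>levy_measure s) \<le> 4 * B * K * (7 / 8) ^ n"
  using assms(4,5)
proof (induction p arbitrary: s \<eta>)
  case 0
  have B0: "0 \<le> B" using order_trans[OF norm_ge_zero bd] .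
  have "norm (\<eta> []) * norm (\<integral>x. g ((gauss_map ^^ n) x) \<partial>levy_measure s) \<le> K * (4 * B * (7 / 8) ^ n)"
    using levy_iterate_mixing[OF assms(1) bd 0(1), of n] mean 0(2)[of "[]"] order_trans[OF norm_ge_zero 0(2)[of "[]"]] by (intro mult_mono) auto
  then show ?case by (simp add: norm_mult mult_ac)
next
  case (Suc p)
  define F where "F x = \<eta> (cf_digits (Suc p) x) * g ((gauss_map ^^ (Suc p + n)) x)" for x
  have K0: "0 \<le> K" using order_trans[OF norm_ge_zero Suc.prems(2)] .
  have F_meas [measurable]: "F \<in> borel_measurable borel" unfolding F_def by measurable
  have F_bd: "norm (F x) \<le> K * B" for x
    unfolding F_def norm_mult by (intro mult_mono Suc.prems bd K0) auto
  have s0: "0 \<le> s" using Suc.prems by auto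
  have sums: "(\<lambda>a. digit_prob s a *\<^sub>R (\<integral>y. F (1 / (real a + 1 + y)) \<partial>levy_measure (1 / (real a + 1 + s)))) sums integral\<^sup>L (levy_measure s) F"
    by (rule levy_branch_sums[OF F_meas s0 F_bd])
  have term_le: "norm (digit_prob s a *\<^sub>R (\<integral>y. F (1 / (real a + 1 + y)) \<partial>levy_measure (1 / (real a + 1 + s)))) \<le> digit_prob s a * (4 * B * K * (7 / 8) ^ n)" for a
  proof -
    let ?t = "1 / (real a + 1 + s)"
    have t: "?t \<in> {0..1}" using s0 by (auto simp: divide_simps)
    have "(\<integral>y. F (1 / (real a + 1 + y)) \<partial>levy_measure ?t) =
      (\<integral>y. \<eta> ((int a + 1) # cf_digits p y) * g ((gauss_map ^^ (p + n)) y) \<partial>levy_measure ?t)"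
    proof (rule integral_cong_AE)
      have "0 \<le> ?t" using s0 by simp
      from AE_levy_interior[OF this]
      show "AE y in levy_measure ?t. F (1 / (real a + 1 + y)) = \<eta> ((int a + 1) # cf_digits p y) * g ((gauss_map ^^ (p + n)) y)"
      proof eventually_elim
        case (elim y)
        have "(gauss_map ^^ (Suc p + n)) (1 / (real a + 1 + y)) = (gauss_map ^^ (p + n)) y"
          using gauss_map_branch[of y a] elim by (simp only: add_Suc funpow_Suc_right o_apply)
        then show ?case unfolding F_def using cf_digits_branch[of y p a] elim by simp
      qed
    qed auto
    also have "norm \<dots> \<le> 4 * B * K * (7 / 8) ^ n"
      by (rule Suc.IH[OF t]) (rule Suc.prems)
    finally show ?thesis
      using digit_prob_nonneg[OF s0, of a] by (simp add: mult_left_mono)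
  qed
  have "summable (\<lambda>a. digit_prob s a * (4 * B * K * (7 / 8) ^ n))" and val: "(\<Sum>a. digit_prob s a * (4 * B * K * (7 / 8) ^ n)) = 4 * B * K * (7 / 8) ^ n"
    using sums_mult2[OF digit_prob_sums[OF s0], of "4 * B * K * (7 / 8) ^ n"] by (auto simp: sums_iff)
  then have "norm (\<Sum>a. digit_prob s a *\<^sub>R (\<integral>y. F (1 / (real a + 1 + y)) \<partial>levy_measure (1 / (real a + 1 + s)))) \<le> (\<Sum>a. digit_prob s a * (4 * B * K * (7 / 8) ^ n))"
    using term_le by (intro norm_suminf_le) auto
  then have "norm (integral\<^sup>L (levy_measure s) F) \<le> 4 * B * K * (7 / 8) ^ n"
    unfolding sums_unique[OF sums, symmetric] val .
  then show ?case unfolding F_def .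
qed

section \<open>Cylinders of the Gauss map\<close>

lemma gauss_map_range: "gauss_map x \<in> {0..<1}"
  unfolding gauss_map_def using frac_ge_0[of "1 / x"] frac_lt_1[of "1 / x"] by auto

lemma gauss_funpow_range: "x \<in> {0..<1} \<Longrightarrow> (gauss_map ^^ n) x \<in> {0..<1}"
  by (cases n) (use gauss_map_range in auto)

text \<open>In [0, 1) only 0 has first digit 0, by the convention 1 / 0 = 0; other points have a
  digit of at least 1. A common digit cancels in the difference of the images.\<close>

lemma same_first_digit:
  assumes "u \<in> {0..<1}" "v \<in> {0..<1}" "\<lfloor>1 / u\<rfloor> = \<lfloor>1 / v\<rfloor>"
  shows "u = 0 \<longleftrightarrow> v = 0" "u \<noteq> 0 \<Longrightarrow> gauss_map u - gauss_map v = 1 / u - 1 / v"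
proof -
  have ge1: "1 \<le> \<lfloor>1 / w\<rfloor>" if "w \<in> {0..<1}" "w \<noteq> 0" for w :: real
    using that by (simp add: le_floor_iff)
  show *: "u = 0 \<longleftrightarrow> v = 0" using ge1[OF assms(1)] ge1[OF assms(2)] assms(3)
    by (cases "u = 0"; cases "v = 0") auto
  show "gauss_map u - gauss_map v = 1 / u - 1 / v" if "u \<noteq> 0"
    using that * assms(3) by (simp add: gauss_map_def frac_def)
qed

text \<open>On a common branch |u - v| = u v |T_G u - T_G v| exactly, since the integer parts
  cancel. The identity stays exact under iteration, so distortion enters only through the orbit
  products.\<close>

lemma cylinder_distance:
  assumes "u \<in> {0..<1}" "v \<in> {0..<1}" "cf_digits n u = cf_digits n v"
  shows "\<bar>u - v\<bar> = \<bar>(gauss_map ^^ n) u - (gauss_map ^^ n) v\<bar> * (\<Prod>k<n. (gauss_map ^^ k) u * (gauss_map ^^ k) v)"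
  using assms
proof (induction n arbitrary: u v)
  case (Suc n)
  have d: "\<lfloor>1 / u\<rfloor> = \<lfloor>1 / v\<rfloor>" "cf_digits n (gauss_map u) = cf_digits n (gauss_map v)" using Suc.prems by auto
  note sf = same_first_digit[OF Suc.prems(1,2) d(1)]
  have "\<bar>u - v\<bar> = \<bar>gauss_map u - gauss_map v\<bar> * (u * v)"
  proof (cases "u = 0")
    case False
    then have "0 < u" "0 < v" using sf(1) Suc.prems by auto
    then have "(1 / u - 1 / v) = (v - u) / (u * v)" by (simp add: field_simps)
    then show ?thesis using sf(2)[OF False] \<open>0 < u\<close> \<open>0 < v\<close> by (simp add: abs_mult abs_minus_commute)
  qed (use sf in auto)
  also have "\<bar>gauss_map u - gauss_map v\<bar> = \<bar>(gauss_map ^^ n) (gauss_map u) - (gauss_map ^^ n) (gauss_map v)\<bar> *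
      (\<Prod>k<n. (gauss_map ^^ k) (gauss_map u) * (gauss_map ^^ k) (gauss_map v))"
    by (rule Suc.IH[OF gauss_map_range gauss_map_range d(2)])
  finally show ?case
    by (simp add: prod.lessThan_Suc_shift funpow_swap1 mult_ac del: prod.lessThan_Suc)
qed simp

lemma orbit_prod_nonneg: "x \<in> {0..<1} \<Longrightarrow> 0 \<le> (\<Prod>k<n. (gauss_map ^^ k) x)"
  using gauss_funpow_range by (intro prod_nonneg) auto

text \<open>Two consecutive factors multiply to at most 1/2: clear for x \<le> 1/2, and otherwise
  the digit is 1 and the product of x with its image is 1 - x.\<close>

lemma orbit_prod_le: "x \<in> {0..<1} \<Longrightarrow> (\<Prod>k<2 * m. (gauss_map ^^ k) x) \<le> (1 / 2) ^ m"
proof (induction m arbitrary: x)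
  case (Suc m)
  let ?T = gauss_map
  have half: "x * ?T x \<le> 1 / 2"
  proof (cases "x \<le> 1 / 2")
    case True
    then show ?thesis using gauss_map_range[of x] Suc.prems mult_mono[of x "1/2" "?T x" 1] by auto
  next
    case False
    then have "\<lfloor>1 / x\<rfloor> = 1" using Suc.prems by (intro floor_unique) (auto simp: field_simps)
    then have "x * ?T x = 1 - x" using False by (simp add: gauss_map_def frac_def field_simps)
    then show ?thesis using False by simp
  qed
  have "(\<Prod>k<2 * Suc m. (?T ^^ k) x) = x * ?T x * (\<Prod>k<2 * m. (?T ^^ k) (?T (?T x)))"
    by (simp add: prod.lessThan_Suc_shift funpow_swap1 del: prod.lessThan_Suc)
  also have "\<dots> \<le> 1 / 2 * (1 / 2) ^ m"
    using half gauss_map_range by (intro mult_mono Suc.IH orbit_prod_nonneg) auto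
  finally show ?case by simp
qed simp

lemma cylinder_distance_le:
  assumes uv: "u \<in> {0..<1}" "v \<in> {0..<1}" "cf_digits n u = cf_digits n v"
  shows "\<bar>u - v\<bar> \<le> (\<Prod>k<n. (gauss_map ^^ k) u) * (\<Prod>k<n. (gauss_map ^^ k) v)"
proof -
  have "\<bar>(gauss_map ^^ n) u - (gauss_map ^^ n) v\<bar> \<le> 1"
    using gauss_funpow_range[OF uv(1), of n] gauss_funpow_range[OF uv(2), of n] by (auto simp: abs_le_iff)
  then have "\<bar>u - v\<bar> \<le> 1 * (\<Prod>k<n. (gauss_map ^^ k) u * (gauss_map ^^ k) v)"
    unfolding cylinder_distance[OF uv] prod.distrib
    using orbit_prod_nonneg uv by (intro mult_right_mono mult_nonneg_nonneg) auto
  then show ?thesis by (simp add: prod.distrib)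
qed

lemma cylinder_diameter:
  assumes uv: "u \<in> {0..<1}" "v \<in> {0..<1}" "cf_digits (2 * m) u = cf_digits (2 * m) v"
  shows "\<bar>u - v\<bar> \<le> (1 / 2) ^ m"
proof -
  have "\<bar>u - v\<bar> \<le> (1 / 2) ^ m * (1 / 2) ^ m"
    by (rule order_trans[OF cylinder_distance_le[OF uv]])
      (intro mult_mono orbit_prod_le orbit_prod_nonneg uv; simp)
  also have "\<dots> \<le> (1 / 2) ^ m * 1" by (intro mult_left_mono power_le_one) auto
  finally show ?thesis by simp
qed

lemma cylinder_convex:
  assumes "u \<in> {0..<1}" "z \<in> {0..<1}" "cf_digits n u = cf_digits n z" "u \<le> v" "v \<le> z"
  shows "cf_digits n v = cf_digits n u"
proof -
  \<comment> \<open>Every branch reverses the order, so the induction runs over both orders at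
    once.\<close>
  have "cf_digits n v = cf_digits n u"
    if "u \<in> {0..<1}" "z \<in> {0..<1}" "cf_digits n u = cf_digits n z" "u \<le> v \<and> v \<le> z \<or> z \<le> v \<and> v \<le> u" for u v z
    using that
  proof (induction n arbitrary: u v z)
    case (Suc n)
    have d: "\<lfloor>1 / u\<rfloor> = \<lfloor>1 / z\<rfloor>" "cf_digits n (gauss_map u) = cf_digits n (gauss_map z)" using Suc.prems by auto
    note sf = same_first_digit[OF Suc.prems(1,2) d(1)]
    show ?case
    proof (cases "u = 0")
      case True
      then show ?thesis using sf(1) Suc.prems by auto
    next
      case False
      then have pos: "0 < u" "0 < z" "0 < v" using sf(1) Suc.prems by auto
      have ord: "1 / z \<le> 1 / v \<and> 1 / v \<le> 1 / u \<or> 1 / u \<le> 1 / v \<and> 1 / v \<le> 1 / z"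
        using Suc.prems(4) pos by (auto simp: frac_le)
      then have fl: "\<lfloor>1 / v\<rfloor> = \<lfloor>1 / u\<rfloor>"
        using d(1) floor_mono[of "1 / z" "1 / v"] floor_mono[of "1 / v" "1 / u"]
          floor_mono[of "1 / u" "1 / v"] floor_mono[of "1 / v" "1 / z"] by linarith
      have "cf_digits n (gauss_map v) = cf_digits n (gauss_map u)"
      proof (rule Suc.IH[OF gauss_map_range gauss_map_range d(2)])
        show "gauss_map u \<le> gauss_map v \<and> gauss_map v \<le> gauss_map z \<or> gauss_map z \<le> gauss_map v \<and> gauss_map v \<le> gauss_map u"
          using ord fl d(1) pos by (auto simp: gauss_map_def frac_def)
      qed
      then show ?thesis using fl by simp
    qed
  qed simp
  from this[of u z v] show ?thesis using assms by blast
qed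

text \<open>The branches are onto, so inverse branches carrying the digits of \<open>x\<close> can
  be applied to any target. This yields points of a cylinder with prescribed n-th iterates, whose
  distances are then explicit.\<close>

lemma cylinder_surjective:
  assumes "x \<in> {0<..<1}" "\<And>k. k < n \<Longrightarrow> 0 < (gauss_map ^^ k) x" "t \<in> {0<..<1}"
  shows "\<exists>v\<in>{0<..<1}. cf_digits n v = cf_digits n x \<and> (gauss_map ^^ n) v = t \<and> (\<forall>k<n. 0 < (gauss_map ^^ k) v)"
  using assms(1,2)
proof (induction n arbitrary: x)
  case 0
  then show ?case using assms(3) by auto
next
  case (Suc n)
  \<comment> \<open>For \<open>n = 0\<close> the image \<open>gauss_map x\<close> may be 0, outside
    the reach of the induction hypothesis; the empty word is matched by \<open>t\<close>
    itself.\<close>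
  have *: "\<exists>v\<in>{0<..<1}. cf_digits n v = cf_digits n (gauss_map x) \<and> (gauss_map ^^ n) v = t \<and> (\<forall>k<n. 0 < (gauss_map ^^ k) v)"
  proof (cases "n = 0")
    case True
    then show ?thesis using assms(3) by auto
  next
    case False
    have "0 < (gauss_map ^^ k) (gauss_map x)" if "k < n" for k
      using Suc.prems(2)[of "Suc k"] that by (simp add: funpow_swap1)
    moreover from this[of 0] have "gauss_map x \<in> {0<..<1}" using False gauss_map_range[of x] by auto
    ultimately show ?thesis by (intro Suc.IH) auto
  qed
  then obtain v where v: "v \<in> {0<..<1}" "cf_digits n v = cf_digits n (gauss_map x)" "(gauss_map ^^ n) v = t" "\<forall>k<n. 0 < (gauss_map ^^ k) v" by blast
  define a where "a = nat (\<lfloor>1 / x\<rfloor> - 1)"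
  have "1 \<le> \<lfloor>1 / x\<rfloor>" using Suc.prems(1) by (simp add: le_floor_iff)
  then have a: "\<lfloor>1 / x\<rfloor> = int a + 1" by (simp add: a_def)
  define w where "w = 1 / (real a + 1 + v)"
  have w01: "w \<in> {0<..<1}" using v(1) by (auto simp: w_def divide_simps)
  have Tw: "gauss_map w = v" unfolding w_def using v(1) by (intro gauss_map_branch) auto
  have "cf_digits (Suc n) w = cf_digits (Suc n) x"
    unfolding w_def using v(1,2) a by (subst cf_digits_branch) auto
  moreover have "(gauss_map ^^ Suc n) w = t" using v(3) Tw by (simp add: funpow_swap1)
  moreover have "0 < (gauss_map ^^ k) w" if "k < Suc n" for k
    using that v(4) w01 Tw by (cases k) (auto simp: funpow_swap1)
  ultimately show ?case using w01 by blast
qed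

text \<open>The witnesses are \<open>\<alpha> = q\<^sub>n\<close> and \<open>\<beta> = q\<^sub>n\<^sub>-\<^sub>1\<close>.\<close>
lemma orbit_prod_linear:
  assumes "u \<in> {0<..<1}" "v \<in> {0<..<1}" "cf_digits n u = cf_digits n v"
    and "\<And>k. k < n \<Longrightarrow> 0 < (gauss_map ^^ k) u" "\<And>k. k < n \<Longrightarrow> 0 < (gauss_map ^^ k) v"
  shows "\<exists>\<alpha> \<beta>. 0 \<le> \<beta> \<and> \<beta> \<le> \<alpha> \<and> 0 < \<alpha> \<and>
    (\<Prod>k<n. 1 / (gauss_map ^^ k) u) = \<alpha> + \<beta> * (gauss_map ^^ n) u \<and>
    (\<Prod>k<n. 1 / (gauss_map ^^ k) v) = \<alpha> + \<beta> * (gauss_map ^^ n) v"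
  using assms(3-5)
proof (induction n)
  case 0
  then show ?case by (intro exI[of _ 1] exI[of _ 0]) auto
next
  case (Suc n)
  have nth: "cf_digits (Suc n) x = cf_digits n x @ [\<lfloor>1 / (gauss_map ^^ n) x\<rfloor>]" for x
    by (induction n arbitrary: x) (auto simp: funpow_swap1)
  have d: "cf_digits n u = cf_digits n v" "\<lfloor>1 / (gauss_map ^^ n) u\<rfloor> = \<lfloor>1 / (gauss_map ^^ n) v\<rfloor>"
    using Suc.prems(1) unfolding nth by auto
  obtain \<alpha> \<beta> where ab: "0 \<le> \<beta>" "\<beta> \<le> \<alpha>" "0 < \<alpha>"
    "(\<Prod>k<n. 1 / (gauss_map ^^ k) u) = \<alpha> + \<beta> * (gauss_map ^^ n) u"
    "(\<Prod>k<n. 1 / (gauss_map ^^ k) v) = \<alpha> + \<beta> * (gauss_map ^^ n) v"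
    using Suc.IH[OF d(1)] Suc.prems by (metis less_SucI)
  define a where "a = \<lfloor>1 / (gauss_map ^^ n) u\<rfloor>"
  have pos: "0 < (gauss_map ^^ n) u" "0 < (gauss_map ^^ n) v" using Suc.prems by auto
  have lt1: "(gauss_map ^^ n) u < 1" using gauss_funpow_range[of u n] assms(1) by auto
  have a1: "1 \<le> a" unfolding a_def using pos lt1 by (simp add: le_floor_iff)
  \<comment> \<open>The recursion q_(n+1) = a q_n + q_(n-1) for the denominators, read off from 1 /
    y = a + T_G y.\<close>
  have step: "(\<alpha> + \<beta> * y) * (1 / y) = (\<alpha> * a + \<beta>) + \<alpha> * gauss_map y" if "0 < y" "\<lfloor>1 / y\<rfloor> = a" for y
  proof -
    have eq: "1 / y = gauss_map y + a" using that by (simp add: gauss_map_def frac_def)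
    have "(\<alpha> + \<beta> * y) * (1 / y) = \<alpha> * (1 / y) + \<beta>" using that by (simp add: field_simps)
    then show ?thesis unfolding eq by (simp add: algebra_simps)
  qed
  have "\<alpha> * 1 \<le> \<alpha> * of_int a" using ab a1 by (intro mult_left_mono) auto
  then have "0 \<le> \<alpha> \<and> \<alpha> \<le> \<alpha> * a + \<beta> \<and> 0 < \<alpha> * a + \<beta>" using ab by linarith
  moreover have "(\<Prod>k<Suc n. 1 / (gauss_map ^^ k) u) = (\<alpha> * a + \<beta>) + \<alpha> * (gauss_map ^^ Suc n) u"
    using step[OF pos(1)] ab(4) by (simp add: a_def)
  moreover have "(\<Prod>k<Suc n. 1 / (gauss_map ^^ k) v) = (\<alpha> * a + \<beta>) + \<alpha> * (gauss_map ^^ Suc n) v"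
    using step[OF pos(2)] ab(5) d(2) by (simp add: a_def)
  ultimately show ?case by blast
qed

text \<open>Bounded distortion: because \<open>\<beta> \<le> \<alpha>\<close>, the linear form
  \<open>\<alpha> + \<beta> * y\<close> stays between \<open>\<alpha>\<close> and
  \<open>2 * \<alpha>\<close> for \<open>y\<close> in [0, 1].\<close>

lemma orbit_prod_comparable:
  assumes "u \<in> {0<..<1}" "v \<in> {0<..<1}" "cf_digits n u = cf_digits n v"
    and "\<And>k. k < n \<Longrightarrow> 0 < (gauss_map ^^ k) u" "\<And>k. k < n \<Longrightarrow> 0 < (gauss_map ^^ k) v"
  shows "(\<Prod>k<n. (gauss_map ^^ k) v) \<le> 2 * (\<Prod>k<n. (gauss_map ^^ k) u)"
proof -
  obtain \<alpha> \<beta> where ab: "0 \<le> \<beta>" "\<beta> \<le> \<alpha>" "0 < \<alpha>"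
    "(\<Prod>k<n. 1 / (gauss_map ^^ k) u) = \<alpha> + \<beta> * (gauss_map ^^ n) u"
    "(\<Prod>k<n. 1 / (gauss_map ^^ k) v) = \<alpha> + \<beta> * (gauss_map ^^ n) v"
    using orbit_prod_linear[OF assms] by blast
  let ?P = "\<lambda>x. \<Prod>k<n. (gauss_map ^^ k) x"
  have inv: "(\<Prod>k<n. 1 / (gauss_map ^^ k) x) = 1 / ?P x" for x
    by (simp add: prod_dividef)
  have pos: "0 < ?P u" "0 < ?P v" using assms(4,5) by (auto intro: prod_pos)
  have r: "0 \<le> (gauss_map ^^ n) u" "(gauss_map ^^ n) u \<le> 1" "0 \<le> (gauss_map ^^ n) v"
    using gauss_funpow_range[of u n] gauss_funpow_range[of v n] assms(1,2) by auto
  have "1 / ?P u \<le> \<alpha> + \<alpha> * 1"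
    unfolding inv[symmetric] ab(4) using ab r by (intro add_mono mult_mono) auto
  also have "\<dots> \<le> 2 * (\<alpha> + \<beta> * (gauss_map ^^ n) v)" using ab r by simp
  also have "\<dots> = 2 * (1 / ?P v)" unfolding ab(5)[symmetric] inv ..
  finally show ?thesis using pos by (simp add: field_simps)
qed

section \<open>Density principles\<close>

text \<open>What a density argument in L^1 uses. It has two kinds of instances: vanishing of the
  integral against a fixed bounded function, for ergodicity, and convergence of weighted orbit
  averages, for the final result.\<close>

locale L1_closed_class =
  fixes P :: "(real \<Rightarrow> complex) \<Rightarrow> bool"
  assumes closed_add: "\<And>f g. integrable unit_measure f \<Longrightarrow> integrable unit_measure g \<Longrightarrow> P f \<Longrightarrow> P g \<Longrightarrow> P (\<lambda>x. f x + g x)"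
    and closed_scale: "\<And>f c. integrable unit_measure f \<Longrightarrow> P f \<Longrightarrow> P (\<lambda>x. c * f x)"
    and closed_approx: "\<And>f. integrable unit_measure f \<Longrightarrow>
      (\<And>e. 0 < e \<Longrightarrow> \<exists>h. integrable unit_measure h \<and> P h \<and> (\<integral>x. norm (f x - h x) \<partial>unit_measure) < e) \<Longrightarrow> P f"
begin

lemma limit:
  assumes s: "\<And>i. integrable unit_measure (s i)" "\<And>i. P (s i)"
    and lim: "AE x in unit_measure. (\<lambda>i::nat. s i x) \<longlonglongrightarrow> f x"
    and w: "integrable unit_measure w" "\<And>i. AE x in unit_measure. norm (s i x) \<le> w x"
    and f: "f \<in> borel_measurable borel"
  shows "P f"
proof -
  have [measurable]: "s i \<in> borel_measurable borel" for i using borel_measurable_integrable[OF s(1)[of i]] by simp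
  note [measurable] = f
  have f_int: "integrable unit_measure f"
    by (rule integrable_dominated_convergence[OF _ _ w(1) lim w(2)]) auto
  have f_le: "AE x in unit_measure. norm (f x) \<le> w x"
  proof -
    have "AE x in unit_measure. \<forall>i. norm (s i x) \<le> w x" using w(2) by (simp add: AE_all_countable)
    with lim show ?thesis
    proof eventually_elim
      case (elim x)
      then show ?case by (intro LIMSEQ_le_const2[OF tendsto_norm[OF elim(1)]]) auto
    qed
  qed
  have "(\<lambda>i. \<integral>x. norm (f x - s i x) \<partial>unit_measure) \<longlonglongrightarrow> (\<integral>x. 0 \<partial>unit_measure)"
  proof (rule integral_dominated_convergence[where w = "\<lambda>x. 2 * w x"])
    show "AE x in unit_measure. (\<lambda>i. norm (f x - s i x)) \<longlonglongrightarrow> 0"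
      using lim
    proof eventually_elim
      case (elim x)
      have "(\<lambda>i. norm (f x - s i x)) \<longlonglongrightarrow> norm (f x - f x)" by (intro tendsto_intros elim)
      then show ?case by simp
    qed
    show "AE x in unit_measure. norm (norm (f x - s i x)) \<le> 2 * w x" for i
      using f_le w(2)[of i]
    proof eventually_elim
      case (elim x)
      then show ?case using norm_triangle_ineq4[of "f x" "s i x"] by simp
    qed
  qed (use w in auto)
  then have lim0: "(\<lambda>i. \<integral>x. norm (f x - s i x) \<partial>unit_measure) \<longlonglongrightarrow> 0" by simp
  show ?thesis
  proof (rule closed_approx[OF f_int])
    fix e :: real assume "0 < e"
    then have "\<forall>\<^sub>F i in sequentially. (\<integral>x. norm (f x - s i x) \<partial>unit_measure) < e"
      by (rule order_tendstoD(2)[OF lim0])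
    then obtain i where "(\<integral>x. norm (f x - s i x) \<partial>unit_measure) < e"
      by (auto simp: eventually_sequentially)
    then show "\<exists>h. integrable unit_measure h \<and> P h \<and> (\<integral>x. norm (f x - h x) \<partial>unit_measure) < e"
      using s by blast
  qed
qed

lemma AE_eq:
  assumes "integrable unit_measure h" "P h" "AE x in unit_measure. h x = f x" "f \<in> borel_measurable borel"
  shows "P f"
proof (rule limit[where s = "\<lambda>_. h" and w = "\<lambda>x. norm (h x)"])
  show "AE x in unit_measure. (\<lambda>i. h x) \<longlonglongrightarrow> f x"
    using assms(3) by eventually_elim simp
qed (use assms in auto)

lemma diff:
  assumes "integrable unit_measure f" "integrable unit_measure g" "P f" "P g"
  shows "P (\<lambda>x. f x - g x)"
  using closed_add[OF assms(1) _ assms(3) closed_scale[OF assms(2,4), of "-1"]] assms(2) by simp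

lemma sum:
  fixes s :: "nat \<Rightarrow> real \<Rightarrow> complex"
  assumes "\<And>i. integrable unit_measure (s i)" "\<And>i. P (s i)"
  shows "P (\<lambda>x. \<Sum>i<n. s i x)"
proof (induction n)
  case 0
  then show ?case using closed_scale[OF assms, of 0 0] by simp
next
  case (Suc n)
  have "integrable unit_measure (\<lambda>x. \<Sum>i<n. s i x)" using assms(1) by (rule Bochner_Integration.integrable_sum)
  then show ?case using closed_add[OF _ assms(1) Suc assms(2)] by simp
qed

text \<open>With a measurable left inverse, \<open>\<iota>\<close> generates all Borel sets up to
  null sets. The passage is from continuous functions of \<open>\<iota> x\<close> to open sets, by
  disjoint unions and complements to Borel sets, then to integrable functions. The embedding will be
  the unit circle for characters and the identity for digits.\<close>

lemma dense:
  fixes \<iota> :: "real \<Rightarrow> 'b::euclidean_space" and \<kappa> :: "'b \<Rightarrow> real"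
  assumes [measurable]: "\<iota> \<in> borel_measurable borel" "\<kappa> \<in> borel_measurable borel"
    and inv: "AE x in unit_measure. \<kappa> (\<iota> x) = x"
    and cont: "\<And>\<phi> :: 'b \<Rightarrow> real. continuous_on UNIV \<phi> \<Longrightarrow> (\<And>z. \<bar>\<phi> z\<bar> \<le> 1) \<Longrightarrow> P (\<lambda>x. of_real (\<phi> (\<iota> x)))"
    and f: "integrable unit_measure f"
  shows "P f"
proof -
  have ind_int: "integrable unit_measure (\<lambda>x. indicator A (\<iota> x) :: complex)" if [measurable]: "A \<in> sets borel" for A
    by (rule unit.integrable_const_bound[where B = 1]) (auto simp: indicator_def)
  have one: "P (\<lambda>x. 1)" using cont[of "\<lambda>_. 1"] by simp
  have open_case: "P (\<lambda>x. indicator V (\<iota> x))" if V: "open V" for V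
  \<comment> \<open>The whole space is treated apart because \<open>infdist\<close> to the empty set
    is 0, which would make all the approximants vanish.\<close>
  proof (cases "V = UNIV")
    case True
    then show ?thesis using one by simp
  next
    case False
    have [measurable]: "V \<in> sets borel" using V by simp
    define \<phi> where "\<phi> n z = min 1 (real n * infdist z (- V))" for n z
    have \<phi>01: "\<bar>\<phi> n z\<bar> \<le> 1" for n z using infdist_nonneg[of z "- V"] by (auto simp: \<phi>_def)
    have \<phi>_cont: "continuous_on UNIV (\<phi> n)" for n
      unfolding \<phi>_def by (intro continuous_intros)
    have [measurable]: "\<phi> n \<in> borel_measurable borel" for n
      using \<phi>_cont by (intro borel_measurable_continuous_onI)
    have \<phi>_lim: "(\<lambda>n. \<phi> n z) \<longlonglongrightarrow> indicator V z" for z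
    proof (cases "z \<in> V")
      case True
      have "0 < infdist z (- V)"
        using V True False infdist_pos_not_in_closed[of "- V" z] by (auto simp: closed_Compl)
      then obtain N where N: "1 < real N * infdist z (- V)" using reals_Archimedean3 by blast
      have "eventually (\<lambda>n. \<phi> n z = 1) sequentially"
        using eventually_ge_at_top[of N]
      proof eventually_elim
        case (elim n)
        have "real N * infdist z (- V) \<le> real n * infdist z (- V)"
          using elim by (intro mult_right_mono infdist_nonneg) auto
        then show ?case using N by (auto simp: \<phi>_def)
      qed
      then show ?thesis using True by (auto intro: tendsto_eventually)
    next
      case False
      then have "\<phi> n z = 0" for n by (simp add: \<phi>_def)
      then show ?thesis using False by simp
    qed
    show ?thesis
    proof (rule limit[where s = "\<lambda>n x. of_real (\<phi> n (\<iota> x))" and w = "\<lambda>_. 1"])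
      show "integrable unit_measure (\<lambda>x. complex_of_real (\<phi> n (\<iota> x)))" for n
        by (rule unit.integrable_const_bound[where B = 1]) (use \<phi>01 in auto)
      have ind: "(indicator V z :: complex) = of_real (indicator V z)" for z by (simp add: indicator_def)
      show "AE x in unit_measure. (\<lambda>n. complex_of_real (\<phi> n (\<iota> x))) \<longlonglongrightarrow> indicator V (\<iota> x)"
        unfolding ind by (intro AE_I2 tendsto_of_real \<phi>_lim)
      show "(\<lambda>x. indicator V (\<iota> x)) \<in> borel_measurable borel" by measurable
    qed (use cont[OF \<phi>_cont \<phi>01] \<phi>01 in auto)
  qed
  have borel_case: "P (\<lambda>x. indicator A (\<iota> x))" if "A \<in> sets borel" for A
  proof -
    have "Int_stable {S::'b set. open S}" "{S::'b set. open S} \<subseteq> Pow UNIV"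
      "A \<in> sigma_sets UNIV {S::'b set. open S}"
      using that unfolding borel_def by (auto simp: Int_stable_def)
    then show ?thesis
    proof (induction rule: sigma_sets_induct_disjoint)
      fix A :: "'b set" assume A: "A \<in> {S. open S}"
      then show "P (\<lambda>x. indicator A (\<iota> x))" using open_case by simp
    next
      show "P (\<lambda>x. indicator {} (\<iota> x))" using open_case[of "{}"] by simp
    next
      fix A :: "'b set" assume A: "A \<in> sigma_sets UNIV {S. open S}" "P (\<lambda>x. indicator A (\<iota> x))"
      then have [measurable]: "A \<in> sets borel" by (simp add: borel_def)
      have "P (\<lambda>x. 1 - indicator A (\<iota> x))"
        using ind_int[of UNIV] by (intro diff ind_int A one) auto
      also have "(\<lambda>x. 1 - indicator A (\<iota> x)) = (\<lambda>x. indicator (UNIV - A) (\<iota> x) :: complex)"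
        by (auto simp: indicator_def)
      finally show "P (\<lambda>x. indicator (UNIV - A) (\<iota> x))" .
    next
      fix A :: "nat \<Rightarrow> 'b set"
      assume A: "disjoint_family A" "range A \<subseteq> sigma_sets UNIV {S. open S}" "\<And>i. P (\<lambda>x. indicator (A i) (\<iota> x))"
      then have [measurable]: "A i \<in> sets borel" for i by (auto simp: borel_def)
      have [measurable]: "\<Union> (range A) \<in> sets borel" by auto
      show "P (\<lambda>x. indicator (\<Union> (range A)) (\<iota> x))"
      proof (rule limit[where s = "\<lambda>n x. \<Sum>i<n. indicator (A i) (\<iota> x)" and w = "\<lambda>_. 1"])
        have fin: "(\<Sum>i<n. indicator (A i) z :: complex) = indicator (\<Union>i<n. A i) z" for n z
        proof -
          have "indicator (\<Union> (A ` {..<n})) z = (\<Sum>i<n. indicator (A i) z :: complex)"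
            by (rule indicator_UN_disjoint) (use A(1) in \<open>auto simp: disjoint_family_on_def\<close>)
          then show ?thesis by simp
        qed
        show "AE x in unit_measure. norm (\<Sum>i<n. indicator (A i) (\<iota> x) :: complex) \<le> 1" for n
          unfolding fin by (auto simp: indicator_def)
        have "(\<lambda>n. indicator (\<Union>i<n. A i) z :: complex) \<longlonglongrightarrow> indicator (\<Union>i. A i) z" for z
          by (rule LIMSEQ_indicator_UN)
        then show "AE x in unit_measure. (\<lambda>n. \<Sum>i<n. indicator (A i) (\<iota> x) :: complex) \<longlonglongrightarrow> indicator (\<Union> (range A)) (\<iota> x)"
          unfolding fin by simp
        show "P (\<lambda>x. \<Sum>i<n. indicator (A i) (\<iota> x))" for n by (intro sum ind_int A) auto
        show "integrable unit_measure (\<lambda>x. \<Sum>i<n. indicator (A i) (\<iota> x) :: complex)" for n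
          by (intro Bochner_Integration.integrable_sum ind_int) auto
      qed auto
    qed
  qed
  \<comment> \<open>Pulling \<open>A\<close> back along \<open>\<kappa>\<close> gives a Borel set in
    the target whose preimage under \<open>\<iota>\<close> is \<open>A\<close> up to a null
    set.\<close>
  have ind_case: "P (\<lambda>x. indicator A x)" if [measurable]: "A \<in> sets borel" for A :: "real set"
  proof (rule AE_eq)
    have [measurable]: "\<kappa> -` A \<in> sets borel" using measurable_sets_borel[of \<kappa> borel A] by simp
    show "integrable unit_measure (\<lambda>x. indicator (\<kappa> -` A) (\<iota> x) :: complex)" by (rule ind_int) simp
    show "P (\<lambda>x. indicator (\<kappa> -` A) (\<iota> x))" by (rule borel_case) simp
    show "AE x in unit_measure. (indicator (\<kappa> -` A) (\<iota> x) :: complex) = indicator A x"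
      using inv by eventually_elim (simp add: indicator_def)
  qed simp
  from f show ?thesis
  proof (induction rule: integrable_induct)
    case (base A c)
    then have "integrable unit_measure (\<lambda>x. indicator A x :: complex)"
      by (intro unit.integrable_const_bound[where B = 1]) (auto simp: indicator_def)
    moreover have "(\<lambda>x. c * indicator A x) = (\<lambda>x. indicator A x *\<^sub>R c)" by (auto simp: indicator_def)
    ultimately show ?case using closed_scale[OF _ ind_case, of A c] base by simp
  next
    case (add f g)
    then show ?case by (intro closed_add) auto
  next
    case (lim f s)
    show ?case
      by (rule limit[where s = s and w = "\<lambda>x. 2 * norm (f x)"]) (use lim in auto)
  qed
qed

end

section \<open>Characters and trigonometric polynomials\<close>

definition character :: "int \<Rightarrow> real \<Rightarrow> complex" where
  "character k x = cis (2 * pi * (of_int k * x))"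

lemma norm_character [simp]: "norm (character k x) = 1"
  by (simp add: character_def)

lemma character_measurable [measurable]: "character k \<in> borel_measurable borel"
  unfolding character_def by (intro borel_measurable_continuous_onI continuous_intros)

lemma character_mult: "character j x * character k x = character (j + k) x"
  by (simp add: character_def cis_mult algebra_simps)

lemma cnj_character: "cnj (character k x) = character (- k) x"
  by (simp add: character_def cis_cnj)

inductive trig_polynomial :: "(real \<Rightarrow> complex) \<Rightarrow> bool" where
  monomial: "trig_polynomial (\<lambda>x. c * character k x)"
| add: "trig_polynomial f \<Longrightarrow> trig_polynomial g \<Longrightarrow> trig_polynomial (\<lambda>x. f x + g x)"

lemma trig_polynomial_mult:
  assumes "trig_polynomial f" "trig_polynomial g"
  shows "trig_polynomial (\<lambda>x. f x * g x)"
  using assms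
proof (induction arbitrary: g)
  case (monomial c k)
  then show ?case
  proof (induction)
    case (monomial d j)
    then show ?case
      using trig_polynomial.monomial[of "c * d" "k + j"] by (simp add: character_mult[symmetric] mult_ac)
  next
    case (add f g)
    then show ?case using trig_polynomial.add by (simp add: distrib_left)
  qed
next
  case (add f1 f2)
  then show ?case using trig_polynomial.add by (simp add: distrib_right)
qed

text \<open>On the unit circle a real linear \<open>p\<close> equals
  \<open>cos t * p 1 + sin t * p \<i>\<close>, a combination of the characters of frequency 1 and
  -1. So the polynomials supplied by Stone-Weierstrass are trigonometric.\<close>

lemma trig_polynomial_of_polynomial:
  fixes p :: "complex \<Rightarrow> real"
  assumes "real_polynomial_function p"
  shows "trig_polynomial (\<lambda>x. of_real (p (character 1 x)))"
  using assms
proof induction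
  case (linear p)
  have re: "complex_of_real (cos t) = (cis t + cis (- t)) / 2"
    and im: "complex_of_real (sin t) = - \<i> / 2 * (cis t - cis (- t))" for t
    by (auto simp: complex_eq_iff)
  have "of_real (p (character 1 x)) =
      (of_real (p 1) / 2 - \<i> / 2 * of_real (p \<i>)) * character 1 x
      + (of_real (p 1) / 2 + \<i> / 2 * of_real (p \<i>)) * character (- 1) x" for x
  proof -
    let ?t = "2 * pi * x"
    have "cis ?t = cos ?t *\<^sub>R 1 + sin ?t *\<^sub>R \<i>" by (simp add: complex_eq_iff)
    then have "p (cis ?t) = cos ?t * p 1 + sin ?t * p \<i>"
      using linear by (simp only: linear_add[OF bounded_linear.linear] linear_scale[OF bounded_linear.linear] real_scaleR_def)
    then have "of_real (p (cis ?t)) = complex_of_real (cos ?t) * of_real (p 1) + complex_of_real (sin ?t) * of_real (p \<i>)"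
      by simp
    then show ?thesis unfolding re im by (simp add: character_def field_simps)
  qed
  then show ?case by (simp add: trig_polynomial.intros)
next
  case (const c)
  then show ?case using trig_polynomial.monomial[of "of_real c" 0] by (simp add: character_def)
next
  case (add f g)
  then show ?case using trig_polynomial.add by simp
next
  case (mult f g)
  then show ?case using trig_polynomial_mult by simp
qed

lemma trig_polynomial_measurable: "trig_polynomial f \<Longrightarrow> f \<in> borel_measurable borel"
  by (induction rule: trig_polynomial.induct) measurable

lemma trig_polynomial_integrable: "trig_polynomial f \<Longrightarrow> integrable unit_measure f"
proof (induction rule: trig_polynomial.induct)
  case (monomial c k)
  show ?case by (rule unit.integrable_const_bound[where B = "norm c"]) (auto simp: norm_mult)
qed auto

lemma integral_character_Icc:
  assumes "k \<noteq> 0" "a \<le> c"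
  shows "(\<integral>x. indicator {a..c} x *\<^sub>R character k x \<partial>lborel) =
    (character k c - character k a) / (\<i> * (2 * pi * of_int k))"
proof -
  let ?w = "2 * pi * of_int k"
  have deriv: "((\<lambda>x. cis (?w * x) / (\<i> * ?w)) has_vector_derivative character k x) (at x within A)" for x A
  proof -
    have "((\<lambda>x. ?w * x) has_derivative (\<lambda>t. ?w * t)) (at x within A)"
      by (auto intro!: derivative_eq_intros)
    from has_derivative_cis[OF this] have "((\<lambda>x. cis (?w * x)) has_vector_derivative ?w *\<^sub>R (\<i> * cis (?w * x))) (at x within A)"
      by (simp add: has_vector_derivative_def mult_ac)
    from has_vector_derivative_divide[OF this, of "\<i> * ?w"] show ?thesis
      using assms by (simp add: character_def scaleR_conv_of_real mult_ac)
  qed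
  have "(\<integral>x. indicator {a..c} x *\<^sub>R character k x \<partial>lborel) = cis (?w * c) / (\<i> * ?w) - cis (?w * a) / (\<i> * ?w)"
    by (rule integral_FTC_Icc) (use deriv assms in \<open>auto simp: character_def intro!: continuous_intros\<close>)
  then show ?thesis by (simp add: character_def diff_divide_distrib mult.assoc)
qed

lemma integral_character:
  assumes "k \<noteq> 0"
  shows "integral\<^sup>L unit_measure (character k) = 0"
proof -
  have "character k 1 = character k 0"
    using cis_multiple_2pi[of "of_int k"] by (simp add: character_def)
  then show ?thesis
    using integral_character_Icc[OF assms, of 0 1] by (simp add: integral_unit_measure)
qed

lemma Arg2pi_cis: "t \<in> {0..<2 * pi} \<Longrightarrow> Arg2pi (cis t) = t"
  by (rule Arg2pi_unique[of 1]) (auto simp: cis_conv_exp)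

text \<open>The argument is continuous off the closed ray of nonnegative reals, and constantly 0 on
  it.\<close>

lemma borel_measurable_Arg2pi: "Arg2pi \<in> borel_measurable borel"
proof -
  have cl: "closed (\<real>\<^sub>\<ge>\<^sub>0 :: complex set)" by (rule closed_nonneg_Reals_complex)
  have "continuous_on (- \<real>\<^sub>\<ge>\<^sub>0) Arg2pi"
    by (intro continuous_at_imp_continuous_on) (auto intro: continuous_at_Arg2pi)
  then have "(\<lambda>z. if z \<in> - \<real>\<^sub>\<ge>\<^sub>0 then Arg2pi z else 0) \<in> borel_measurable borel"
    using cl by (intro borel_measurable_continuous_on_if) auto
  also have "(\<lambda>z. if z \<in> - \<real>\<^sub>\<ge>\<^sub>0 then Arg2pi z else 0) = Arg2pi"
    by (auto simp: fun_eq_iff Arg2pi_eq_0 complex_nonneg_Reals_iff complex_is_Real_iff)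
  finally show ?thesis .
qed

text \<open>Continuous functions on [0, 1] need not be periodic, so the approximation takes place on
  the circle. There \<open>character 1\<close> embeds the interval up to its endpoints, and the
  argument inverts it.\<close>

lemma (in L1_closed_class) trigonometric_dense:
  assumes char: "\<And>k. P (character k)" and f: "integrable unit_measure f"
  shows "P f"
proof (rule dense[where \<iota> = "character 1" and \<kappa> = "\<lambda>z. Arg2pi z / (2 * pi)"])
  show "AE x in unit_measure. Arg2pi (character 1 x) / (2 * pi) = x"
    using AE_unit_interior
    by eventually_elim (simp add: character_def Arg2pi_cis)
next
  fix \<phi> :: "complex \<Rightarrow> real" assume \<phi>: "continuous_on UNIV \<phi>" "\<And>z. \<bar>\<phi> z\<bar> \<le> 1"
  have [measurable]: "\<phi> \<in> borel_measurable borel" using \<phi>(1) by (rule borel_measurable_continuous_onI)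
  have \<phi>_int: "integrable unit_measure (\<lambda>x. complex_of_real (\<phi> (character 1 x)))"
    by (rule unit.integrable_const_bound[where B = 1]) (use \<phi>(2) in auto)
  have trig: "P t" if "trig_polynomial t" for t
    using that
  proof (induction rule: trig_polynomial.induct)
    case (monomial c k)
    then show ?case
      using closed_scale[OF _ char] trig_polynomial_integrable[OF trig_polynomial.monomial[of 1 k]] by simp
  next
    case (add f g)
    then show ?case
      by (intro closed_add trig_polynomial_integrable)
  qed
  show "P (\<lambda>x. of_real (\<phi> (character 1 x)))"
  proof (rule closed_approx[OF \<phi>_int])
    fix e :: real assume e: "0 < e"
    obtain p where p: "real_polynomial_function p" "\<And>z. z \<in> sphere 0 1 \<Longrightarrow> \<bar>\<phi> z - p z\<bar> < e / 2"
    proof (rule Stone_Weierstrass_real_polynomial_function)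
      show "compact (sphere (0::complex) 1)" by simp
      show "continuous_on (sphere 0 1) \<phi>" using \<phi>(1) by (rule continuous_on_subset) simp
      show "0 < e / 2" using e by simp
    qed (rule that)
    let ?h = "\<lambda>x. complex_of_real (p (character 1 x))"
    have h: "trig_polynomial ?h" by (rule trig_polynomial_of_polynomial[OF p(1)])
    have "(\<integral>x. norm (complex_of_real (\<phi> (character 1 x)) - ?h x) \<partial>unit_measure) \<le> e / 2"
    proof (rule unit.integral_le_const)
      show "integrable unit_measure (\<lambda>x. norm (complex_of_real (\<phi> (character 1 x)) - ?h x))"
        by (intro integrable_norm Bochner_Integration.integrable_diff \<phi>_int trig_polynomial_integrable[OF h])
      have *: "norm (complex_of_real (\<phi> (character 1 x)) - ?h x) \<le> e / 2" for x
      proof -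
        have "norm (complex_of_real (\<phi> (character 1 x)) - ?h x) = \<bar>\<phi> (character 1 x) - p (character 1 x)\<bar>"
          unfolding of_real_diff[symmetric] by (rule norm_of_real)
        also have "\<dots> \<le> e / 2" using p(2)[of "character 1 x"] by (intro less_imp_le) simp
        finally show ?thesis .
      qed
      show "AE x in unit_measure. norm (complex_of_real (\<phi> (character 1 x)) - ?h x) \<le> e / 2" by (rule AE_I2) (rule *)
    qed
    also have "\<dots> < e" using e by simp
    finally have "(\<integral>x. norm (complex_of_real (\<phi> (character 1 x)) - ?h x) \<partial>unit_measure) < e" .
    then show "\<exists>h. integrable unit_measure h \<and> P h \<and> (\<integral>x. norm (complex_of_real (\<phi> (character 1 x)) - h x) \<partial>unit_measure) < e"
      by (intro exI[of _ ?h] conjI trig[OF h] trig_polynomial_integrable[OF h])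
  qed
next
  show "(\<lambda>z. Arg2pi z / (2 * pi)) \<in> borel_measurable borel"
    using borel_measurable_Arg2pi by measurable
qed (use f in auto)

section \<open>Functions of finitely many continued fraction digits\<close>

text \<open>A representative of each cylinder: evaluation there turns a function of the point into a
  function of its digits. The value at a word with empty cylinder is arbitrary.\<close>

definition cylinder_point :: "nat \<Rightarrow> int list \<Rightarrow> real" where
  "cylinder_point n l = (SOME u. u \<in> {0<..<1} \<and> cf_digits n u = l)"

lemma cylinder_point:
  assumes "x \<in> {0<..<1}"
  shows "cylinder_point n (cf_digits n x) \<in> {0<..<1}" "cf_digits n (cylinder_point n (cf_digits n x)) = cf_digits n x"
  using someI[of "\<lambda>u. u \<in> {0<..<1} \<and> cf_digits n u = cf_digits n x" x] assms
  unfolding cylinder_point_def by blast+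

text \<open>A continuous function evaluated at the representative of the cylinder depends on
  finitely many digits, and converges to the value at the point because cylinder diameters tend to
  0.\<close>

lemma (in L1_closed_class) cf_digits_dense:
  assumes dig: "\<And>r \<eta> K. (\<And>l. norm (\<eta> l) \<le> K) \<Longrightarrow> P (\<lambda>x. \<eta> (cf_digits r x))"
    and f: "integrable unit_measure f"
  shows "P f"
proof (rule dense[where \<iota> = "\<lambda>x. x" and \<kappa> = "\<lambda>x. x"])
  fix \<phi> :: "real \<Rightarrow> real" assume \<phi>: "continuous_on UNIV \<phi>" "\<And>z. \<bar>\<phi> z\<bar> \<le> 1"
  have [measurable]: "\<phi> \<in> borel_measurable borel" using \<phi>(1) by (rule borel_measurable_continuous_onI)
  define \<eta> where "\<eta> m l = complex_of_real (\<phi> (cylinder_point (2 * m) l))" for m l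
  have \<eta>1: "norm (\<eta> m l) \<le> 1" for m l using \<phi>(2) by (simp add: \<eta>_def)
  show "P (\<lambda>x. of_real (\<phi> x))"
  proof (rule limit[where s = "\<lambda>m x. \<eta> m (cf_digits (2 * m) x)" and w = "\<lambda>_. 1"])
    show "P (\<lambda>x. \<eta> m (cf_digits (2 * m) x))" for m by (rule dig[OF \<eta>1])
    show "integrable unit_measure (\<lambda>x. \<eta> m (cf_digits (2 * m) x))" for m
      by (rule unit.integrable_const_bound[where B = 1]) (use \<eta>1 in auto)
    show "AE x in unit_measure. (\<lambda>m. \<eta> m (cf_digits (2 * m) x)) \<longlonglongrightarrow> of_real (\<phi> x)"
      using AE_unit_interior
    proof eventually_elim
      case (elim x)
      then have x: "x \<in> {0<..<1}" by auto
      define u where "u m = cylinder_point (2 * m) (cf_digits (2 * m) x)" for m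
      have "norm (u m - x) \<le> (1 / 2) ^ m" for m
        using cylinder_diameter[of "u m" x m] cylinder_point[OF x, of "2 * m"] x unfolding u_def by auto
      moreover have "(\<lambda>m. (1 / 2 :: real) ^ m) \<longlonglongrightarrow> 0" by (rule LIMSEQ_power_zero) simp
      ultimately have "(\<lambda>m. u m - x) \<longlonglongrightarrow> 0" by (rule Lim_null_comparison[OF eventuallyI])
      then have "u \<longlonglongrightarrow> x" by (simp add: LIM_zero_iff)
      moreover have "isCont \<phi> x" using \<phi>(1) by (simp add: continuous_on_eq_continuous_at)
      ultimately have "(\<lambda>m. \<phi> (u m)) \<longlonglongrightarrow> \<phi> x" by (rule isCont_tendsto_compose[rotated])
      then show ?case unfolding \<eta>_def u_def by (rule tendsto_of_real)
    qed
  qed (use \<eta>1 in auto)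
qed (use f in auto)

section \<open>Ergodicity\<close>

text \<open>The kernel of a continuous functional on L^1: moving \<open>h\<close> by
  \<open>e\<close> in norm moves the integral by at most \<open>K * e\<close>.\<close>

lemma L1_closed_class_annihilator:
  assumes [measurable]: "\<psi> \<in> borel_measurable borel" and bd: "\<And>x. norm (\<psi> x) \<le> K"
  shows "L1_closed_class (\<lambda>h. (\<integral>x. h x * \<psi> x \<partial>unit_measure) = (0::complex))"
proof -
  have K0: "0 \<le> K" using order_trans[OF norm_ge_zero bd] .
  have int: "integrable unit_measure (\<lambda>x. h x * \<psi> x)" if h: "integrable unit_measure h" for h :: "real \<Rightarrow> complex"
  proof (rule Bochner_Integration.integrable_bound)
    show "integrable unit_measure (\<lambda>x. K * norm (h x))" using h by simp
    have "norm (h x * \<psi> x) \<le> K * norm (h x)" for x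
      unfolding norm_mult using bd[of x] by (subst mult.commute) (intro mult_right_mono; simp)
    then show "AE x in unit_measure. norm (h x * \<psi> x) \<le> norm (K * norm (h x))"
      using K0 by simp
    show "(\<lambda>x. h x * \<psi> x) \<in> borel_measurable unit_measure" using h by measurable
  qed
  show ?thesis
  proof
    fix f g :: "real \<Rightarrow> complex"
    assume "integrable unit_measure f" "integrable unit_measure g"
      "(\<integral>x. f x * \<psi> x \<partial>unit_measure) = 0" "(\<integral>x. g x * \<psi> x \<partial>unit_measure) = 0"
    then show "(\<integral>x. (f x + g x) * \<psi> x \<partial>unit_measure) = 0"
      by (simp add: distrib_right int)
  next
    fix f :: "real \<Rightarrow> complex" and c :: complex
    assume "integrable unit_measure f" "(\<integral>x. f x * \<psi> x \<partial>unit_measure) = 0"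
    then show "(\<integral>x. c * f x * \<psi> x \<partial>unit_measure) = 0"
      by (simp add: mult.assoc)
  next
    fix f :: "real \<Rightarrow> complex"
    assume f: "integrable unit_measure f"
      and ap: "\<And>e. 0 < e \<Longrightarrow> \<exists>h. integrable unit_measure h \<and> (\<integral>x. h x * \<psi> x \<partial>unit_measure) = 0 \<and> (\<integral>x. norm (f x - h x) \<partial>unit_measure) < e"
    have small: "norm (\<integral>x. f x * \<psi> x \<partial>unit_measure) \<le> K * e" if e: "0 < e" for e
    proof -
      obtain h where h: "integrable unit_measure h" "(\<integral>x. h x * \<psi> x \<partial>unit_measure) = 0" "(\<integral>x. norm (f x - h x) \<partial>unit_measure) < e"
        using ap[OF e] by blast
      have "(\<integral>x. f x * \<psi> x \<partial>unit_measure) = (\<integral>x. (f x - h x) * \<psi> x \<partial>unit_measure)"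
        using f h by (simp add: left_diff_distrib int)
      also have "norm \<dots> \<le> (\<integral>x. norm ((f x - h x) * \<psi> x) \<partial>unit_measure)" by (rule integral_norm_bound)
      also have "\<dots> \<le> (\<integral>x. K * norm (f x - h x) \<partial>unit_measure)"
      proof (rule integral_mono)
        show "integrable unit_measure (\<lambda>x. norm ((f x - h x) * \<psi> x))"
          using f h by (intro integrable_norm int) simp
        show "integrable unit_measure (\<lambda>x. K * norm (f x - h x))" using f h by simp
        show "norm ((f x - h x) * \<psi> x) \<le> K * norm (f x - h x)" for x
          unfolding norm_mult using bd[of x] by (subst mult.commute) (intro mult_right_mono; simp)
      qed
      also have "\<dots> = K * (\<integral>x. norm (f x - h x) \<partial>unit_measure)" by simp
      also have "\<dots> \<le> K * e" using h(3) K0 by (intro mult_left_mono) auto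
      finally show ?thesis by simp
    qed
    have "norm (\<integral>x. f x * \<psi> x \<partial>unit_measure) \<le> 0"
    proof (rule field_le_epsilon)
      fix d :: real assume d: "0 < d"
      have "norm (\<integral>x. f x * \<psi> x \<partial>unit_measure) \<le> K * (d / (K + 1))"
        using d K0 by (intro small divide_pos_pos) auto
      also have "\<dots> = d * (K / (K + 1))" by simp
      also have "\<dots> \<le> d * 1" using d K0 by (intro mult_left_mono) auto
      finally show "norm (\<integral>x. f x * \<psi> x \<partial>unit_measure) \<le> 0 + d" by simp
    qed
    then show "(\<integral>x. f x * \<psi> x \<partial>unit_measure) = 0" by simp
  qed
qed

text \<open>Test against the indicator of the complement of \<open>A\<close>, on which the other
  factor is the constant \<open>- c\<close>.\<close>

lemma trivial_if_annihilated:
  fixes c :: real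
  assumes [measurable]: "A \<in> sets borel"
    and ann: "\<And>h :: real \<Rightarrow> complex. integrable unit_measure h \<Longrightarrow> (\<integral>x. h x * (indicator A x - of_real c) \<partial>unit_measure) = 0"
  shows "c = 0 \<or> (AE x in unit_measure. x \<in> A)"
proof -
  have "(\<integral>x. indicator (- A) x * (indicator A x - of_real c) \<partial>unit_measure) = (0::complex)"
    by (intro ann unit.integrable_const_bound[where B = 1]) (auto simp: indicator_def)
  moreover have "indicator (- A) x * (indicator A x - complex_of_real c) = of_real (indicator (- A) x) * - of_real c" for x
    by (simp add: indicator_def)
  ultimately have "(\<integral>x. complex_of_real (indicator (- A) x) * - of_real c \<partial>unit_measure) = 0" by simp
  then have "complex_of_real (unit.prob (- A)) * - of_real c = 0"
    unfolding integral_mult_left_zero integral_complex_of_real by simp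
  then have "c = 0 \<or> unit.prob (- A) = 0" by auto
  then show ?thesis
  proof
    assume "unit.prob (- A) = 0"
    then have "AE x in unit_measure. x \<notin> - A" by (subst (asm) unit.prob_eq_0) auto
    then show ?thesis by simp
  qed simp
qed

lemma invariant_funpow: "T -` A \<inter> UNIV = A \<Longrightarrow> ((T ^^ n) x \<in> A) = (x \<in> A)"
  by (induction n) auto

text \<open>The centred indicator of an invariant set does not change under iteration, so the mixing
  bound holds for one fixed integral and all \<open>n\<close>, and that integral is 0. Density
  extends this from functions of digits to all of L^1.\<close>

lemma ergodic_gauss: "ergodic_map gauss_borel gauss_map"
proof
  fix A assume "A \<in> sets gauss_borel" and inv: "gauss_map -` A \<inter> space gauss_borel = A"
  then have [measurable]: "A \<in> sets borel" by simp
  define c where "c = gauss.prob A"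
  define \<psi> where "\<psi> x = indicator A x - complex_of_real c" for x
  have \<psi>_meas [measurable]: "\<psi> \<in> borel_measurable borel" unfolding \<psi>_def by measurable
  have \<psi>_bd: "norm (\<psi> x) \<le> 1 + \<bar>c\<bar>" for x
    unfolding \<psi>_def by (rule order_trans[OF norm_triangle_ineq4]) (auto simp: indicator_def)
  have ind_int: "integrable gauss_borel (\<lambda>x. complex_of_real (indicator A x))"
    by (rule gauss.integrable_const_bound[where B = 1]) (auto simp: indicator_def)
  have "(\<lambda>x. \<psi> x) = (\<lambda>x. complex_of_real (indicator A x) - complex_of_real c)" by (auto simp: \<psi>_def indicator_def)
  then have mean: "integral\<^sup>L gauss_borel \<psi> = 0"
    using ind_int gauss.prob_space by (simp add: c_def integral_complex_of_real)
  have \<psi>_inv: "\<psi> ((gauss_map ^^ n) x) = \<psi> x" for n x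
    using invariant_funpow[of gauss_map A n x] inv by (simp add: \<psi>_def indicator_def)
  interpret L1_closed_class "\<lambda>h. (\<integral>x. h x * \<psi> x \<partial>unit_measure) = 0"
    by (rule L1_closed_class_annihilator[OF \<psi>_meas \<psi>_bd])
  have "(\<integral>x. \<eta> (cf_digits r x) * \<psi> x \<partial>unit_measure) = 0" if "\<And>l. norm (\<eta> l) \<le> K" for r \<eta> K
  proof -
    have "norm (\<integral>x. \<eta> (cf_digits r x) * \<psi> x \<partial>unit_measure) \<le> 4 * (1 + \<bar>c\<bar>) * K * (7 / 8) ^ n" for n
      using digits_mixing[OF \<psi>_meas \<psi>_bd mean, of 0 \<eta> K r n] that by (simp add: \<psi>_inv levy_measure_0)
    moreover have "(\<lambda>n. 4 * (1 + \<bar>c\<bar>) * K * (7 / 8) ^ n) \<longlonglongrightarrow> 4 * (1 + \<bar>c\<bar>) * K * 0"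
      by (intro tendsto_intros LIMSEQ_power_zero) auto
    ultimately have "norm (\<integral>x. \<eta> (cf_digits r x) * \<psi> x \<partial>unit_measure) \<le> 4 * (1 + \<bar>c\<bar>) * K * 0"
      by (intro LIMSEQ_le_const) auto
    then show ?thesis by simp
  qed
  then have "(\<integral>x. h x * \<psi> x \<partial>unit_measure) = 0" if "integrable unit_measure h" for h
    using that by (rule cf_digits_dense)
  then have "c = 0 \<or> (AE x in unit_measure. x \<in> A)"
    unfolding \<psi>_def by (intro trivial_if_annihilated) auto
  then show "gauss.prob A = 0 \<or> gauss.prob A = 1"
    unfolding c_def AE_gauss_borel[symmetric] by (subst (asm) gauss.prob_eq_1[symmetric]) auto
qed (auto simp: gauss_borel_invariant)

interpretation gauss: ergodic_map gauss_borel gauss_map by (rule ergodic_gauss)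

section \<open>Ergodicity of the times b map\<close>

lemma integral_unit_subdivide:
  fixes F :: "real \<Rightarrow> 'b::{banach, second_countable_topology}"
  assumes [measurable]: "F \<in> borel_measurable borel" and bd: "\<And>x. norm (F x) \<le> K" and b: "0 < b"
  shows "integral\<^sup>L unit_measure F = (\<Sum>a<b. (1 / real b) *\<^sub>R (\<integral>y. F ((real a + y) / real b) \<partial>unit_measure))"
proof -
  \<comment> \<open>Half-open pieces tile [0, 1) without overlap, and the endpoint 1 is
    null.\<close>
  have half_open: "integral\<^sup>L unit_measure G = (\<integral>x. indicator {0..<1} x *\<^sub>R G x \<partial>lborel)"
    if [measurable]: "G \<in> borel_measurable borel" for G :: "real \<Rightarrow> 'b"
  proof -
    have "(\<integral>x. indicator {0..1} x *\<^sub>R G x \<partial>lborel) = (\<integral>x. indicator {0..<1} x *\<^sub>R G x \<partial>lborel)"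
    proof (rule integral_cong_AE)
      show "AE x in lborel. indicator {0..1} x *\<^sub>R G x = indicator {0..<1} x *\<^sub>R G x"
        using AE_lborel_singleton[of "1::real"] by eventually_elim (auto simp: indicator_def)
    qed auto
    then show ?thesis by (simp add: integral_unit_measure)
  qed
  let ?I = "\<lambda>a. {real a / real b..<(real a + 1) / real b}"
  have int: "integrable lborel (\<lambda>x. indicator (?I a) x *\<^sub>R F x)" for a
  proof (rule Bochner_Integration.integrable_bound)
    have "emeasure lborel (?I a) < \<infinity>"
      by (rule order_le_less_trans[OF emeasure_mono[of _ "{real a / real b..(real a + 1) / real b}"]]) (auto simp: emeasure_lborel_Icc_eq)
    then show "integrable lborel (\<lambda>x. K * indicator (?I a) x)"
      by (intro integrable_mult_right integrable_real_indicator) auto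
    show "AE x in lborel. norm (indicator (?I a) x *\<^sub>R F x) \<le> norm (K * indicator (?I a) x)"
      using bd order_trans[OF norm_ge_zero bd] by (auto simp: indicator_def intro!: AE_I2)
  qed auto
  have ind: "(\<Sum>a<b. indicator (?I a) x) = (indicator {0..<1} x :: real)" for x
  proof -
    have "(\<Sum>a<n. indicator (?I a) x) = (indicator {0..<real n / real b} x :: real)" for n
    proof (induction n)
      case (Suc n)
      have "0 \<le> real n / real b" "real n / real b \<le> (real n + 1) / real b" by (auto simp: divide_right_mono)
      then have "(indicator {0..<real n / real b} x + indicator (?I n) x :: real) = indicator {0..<(real n + 1) / real b} x"
        using order_trans[of 0 "real n / real b" x] order_less_le_trans[of x "real n / real b" "(real n + 1) / real b"]
        by (auto simp: indicator_def)
      then show ?case using Suc by (simp add: add.commute)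
    qed simp
    from this[of b] show ?thesis using b by simp
  qed
  have "integral\<^sup>L unit_measure F = (\<integral>x. (\<Sum>a<b. indicator (?I a) x *\<^sub>R F x) \<partial>lborel)"
    by (simp add: half_open ind flip: scaleR_sum_left)
  also have "\<dots> = (\<Sum>a<b. \<integral>x. indicator (?I a) x *\<^sub>R F x \<partial>lborel)"
    by (rule Bochner_Integration.integral_sum) (rule int)
  also have "\<dots> = (\<Sum>a<b. (1 / real b) *\<^sub>R (\<integral>y. F ((real a + y) / real b) \<partial>unit_measure))"
  proof (rule sum.cong)
    fix a
    have "(\<integral>x. indicator (?I a) x *\<^sub>R F x \<partial>lborel) = \<bar>1 / real b\<bar> *\<^sub>R (\<integral>x. indicator (?I a) (real a / real b + 1 / real b * x) *\<^sub>R F (real a / real b + 1 / real b * x) \<partial>lborel)"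
      using b by (intro lborel_integral_real_affine) auto
    also have "(\<lambda>x. indicator (?I a) (real a / real b + 1 / real b * x) *\<^sub>R F (real a / real b + 1 / real b * x)) =
      (\<lambda>x. indicator {0..<1} x *\<^sub>R F ((real a + x) / real b))"
    proof
      fix x
      have "real a / real b \<le> (real a + x) / real b \<longleftrightarrow> 0 \<le> x" using b by (simp add: divide_le_cancel)
      moreover have "(real a + x) / real b < (real a + 1) / real b \<longleftrightarrow> x < 1" using b by (simp add: divide_less_cancel)
      moreover have "real a / real b + 1 / real b * x = (real a + x) / real b" by (simp add: add_divide_distrib)
      ultimately show "indicator (?I a) (real a / real b + 1 / real b * x) *\<^sub>R F (real a / real b + 1 / real b * x) =
        indicator {0..<1} x *\<^sub>R F ((real a + x) / real b)"
        by (simp add: indicator_def)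
    qed
    also have "(\<integral>x. indicator {0..<1} x *\<^sub>R F ((real a + x) / real b) \<partial>lborel) = (\<integral>y. F ((real a + y) / real b) \<partial>unit_measure)"
      by (rule half_open[symmetric]) measurable
    finally show "(\<integral>x. indicator (?I a) x *\<^sub>R F x \<partial>lborel) = (1 / real b) *\<^sub>R (\<integral>y. F ((real a + y) / real b) \<partial>unit_measure)"
      by simp
  qed simp
  finally show ?thesis .
qed

lemma times_map_measurable [measurable]: "times_map b \<in> borel_measurable borel"
  unfolding times_map_def frac_def by measurable

lemma times_map_branch:
  assumes "0 < b" "0 < y" "y < 1"
  shows "times_map (int b) ((real a + y) / real b) = y"
proof -
  have "frac (real a + y) = y" using assms by (subst frac_unique_iff) auto
  then show ?thesis using assms by (simp add: times_map_def)
qed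

lemma times_map_preserves:
  assumes "0 < b"
  shows "distr unit_measure unit_measure (times_map (int b)) = unit_measure"
proof (rule measure_eqI)
  fix A assume "A \<in> sets (distr unit_measure unit_measure (times_map (int b)))"
  then have [measurable]: "A \<in> sets borel" by simp
  have pre: "times_map (int b) -` A \<in> sets borel" using measurable_sets_borel[OF times_map_measurable] by simp
  have "unit.prob (times_map (int b) -` A) = (\<integral>x. indicator A (times_map (int b) x) \<partial>unit_measure)"
  proof -
    have "(\<integral>x. indicator A (times_map (int b) x) \<partial>unit_measure) = (\<integral>x. indicat_real (times_map (int b) -` A) x \<partial>unit_measure)"
      by (intro Bochner_Integration.integral_cong) (auto simp: indicator_def)
    then show ?thesis using pre by simp
  qed
  also have "\<dots> = (\<Sum>a<b. (1 / real b) *\<^sub>R (\<integral>y. indicator A (times_map (int b) ((real a + y) / real b)) \<partial>unit_measure))"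
    by (rule integral_unit_subdivide[where K = 1]) (use assms in \<open>auto simp: indicator_def\<close>)
  also have "\<dots> = (\<Sum>a<b. (1 / real b) *\<^sub>R unit.prob A)"
  proof (rule sum.cong)
    fix a
    have "(\<integral>y. indicator A (times_map (int b) ((real a + y) / real b)) \<partial>unit_measure) = (\<integral>y. indicat_real A y \<partial>unit_measure)"
    proof (rule integral_cong_AE)
      show "AE y in unit_measure. indicator A (times_map (int b) ((real a + y) / real b)) = indicat_real A y"
        using AE_unit_interior by eventually_elim (simp add: times_map_branch assms)
    qed auto
    then show "(1 / real b) *\<^sub>R (\<integral>y. indicator A (times_map (int b) ((real a + y) / real b)) \<partial>unit_measure) = (1 / real b) *\<^sub>R unit.prob A"
      by simp
  qed simp
  also have "\<dots> = unit.prob A" using assms by simp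
  finally show "emeasure (distr unit_measure unit_measure (times_map (int b))) A = emeasure unit_measure A"
    by (subst emeasure_distr) (auto simp: unit.emeasure_eq_measure)
qed simp

lemma character_times_map: "character k (times_map b x) = character (k * b) x"
proof -
  have "2 * pi * (of_int k * times_map b x) = 2 * pi * (of_int (k * b) * x) - 2 * pi * of_int (k * \<lfloor>of_int b * x\<rfloor>)"
    by (simp add: times_map_def frac_def algebra_simps)
  then have "character k (times_map b x) = cis (2 * pi * (of_int (k * b) * x)) / cis (2 * pi * of_int (k * \<lfloor>of_int b * x\<rfloor>))"
    unfolding character_def by (simp only: cis_divide)
  also have "cis (2 * pi * of_int (k * \<lfloor>of_int b * x\<rfloor>)) = 1" by (rule cis_multiple_2pi) simp
  finally show ?thesis by (simp add: character_def)
qed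

lemma character_funpow_times_map: "character k ((times_map b ^^ n) x) = character (k * b ^ n) x"
  by (induction n arbitrary: k) (simp_all add: character_times_map mult_ac)

lemma sum_character_roots:
  assumes "0 < b" "\<not> int b dvd k"
  shows "(\<Sum>a<b. character k (real a / real b)) = 0"
proof -
  let ?w = "character k (1 / real b)"
  have pow: "character k (real a / real b) = ?w ^ a" for a
  proof -
    have "?w ^ a = cis (real a * (2 * pi * (of_int k * (1 / real b))))"
      unfolding character_def by (rule Complex.DeMoivre)
    also have "\<dots> = character k (real a / real b)"
      unfolding character_def by (rule arg_cong[where f = cis]) simp
    finally show ?thesis ..
  qed
  have "?w ^ b = 1" using pow[of b] assms(1) cis_multiple_2pi[of "of_int k"] by (simp add: character_def)
  moreover have "?w \<noteq> 1"
  proof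
    assume "?w = 1"
    then have "cos (2 * pi * (of_int k * (1 / real b))) = 1" by (simp add: character_def complex_eq_iff)
    then obtain n :: int where "2 * pi * (of_int k * (1 / real b)) = of_int n * 2 * pi"
      using cos_one_2pi_int by blast
    then have "of_int k = real_of_int (int b * n)" using assms(1) by (simp add: field_simps)
    then show False using assms(2) by (metis dvd_triv_left of_int_eq_iff)
  qed
  ultimately show ?thesis unfolding pow by (simp add: geometric_sum)
qed

text \<open>On the piece of points (a + y) / b the second factor does not depend on
  \<open>a\<close>, and the character contributes a b-th root of unity; these roots sum to 0 unless
  \<open>b\<close> divides \<open>k\<close>.\<close>

lemma integral_character_times_map:
  fixes \<psi> :: "real \<Rightarrow> complex"
  assumes [measurable]: "\<psi> \<in> borel_measurable borel" and bd: "\<And>x. norm (\<psi> x) \<le> K" and b: "0 < b" "\<not> int b dvd k"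
  shows "(\<integral>x. character k x * \<psi> (times_map (int b) x) \<partial>unit_measure) = 0"
proof -
  let ?J = "\<integral>y. character k (y / real b) * \<psi> y \<partial>unit_measure"
  have "(\<integral>x. character k x * \<psi> (times_map (int b) x) \<partial>unit_measure) =
    (\<Sum>a<b. (1 / real b) *\<^sub>R (\<integral>y. character k ((real a + y) / real b) * \<psi> (times_map (int b) ((real a + y) / real b)) \<partial>unit_measure))"
    by (rule integral_unit_subdivide[where K = K]) (use bd b in \<open>auto simp: norm_mult\<close>)
  also have "\<dots> = (\<Sum>a<b. (1 / real b) *\<^sub>R (character k (real a / real b) * ?J))"
  proof (rule sum.cong)
    fix a
    have "(\<integral>y. character k ((real a + y) / real b) * \<psi> (times_map (int b) ((real a + y) / real b)) \<partial>unit_measure) =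
      (\<integral>y. character k (real a / real b) * (character k (y / real b) * \<psi> y) \<partial>unit_measure)"
    proof (rule integral_cong_AE)
      show "AE y in unit_measure. character k ((real a + y) / real b) * \<psi> (times_map (int b) ((real a + y) / real b)) =
          character k (real a / real b) * (character k (y / real b) * \<psi> y)"
        using AE_unit_interior
      proof eventually_elim
        case (elim y)
        have "character k ((real a + y) / real b) = character k (real a / real b) * character k (y / real b)"
          by (simp add: character_def cis_mult add_divide_distrib distrib_left)
        then show ?case using times_map_branch[of b y a] b elim by simp
      qed
    qed auto
    then show "(1 / real b) *\<^sub>R (\<integral>y. character k ((real a + y) / real b) * \<psi> (times_map (int b) ((real a + y) / real b)) \<partial>unit_measure)
      = (1 / real b) *\<^sub>R (character k (real a / real b) * ?J)" by simp
  qed simp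
  also have "\<dots> = (1 / real b) *\<^sub>R ((\<Sum>a<b. character k (real a / real b)) * ?J)"
    by (simp add: sum_distrib_right scaleR_sum_right)
  finally show ?thesis by (simp add: sum_character_roots b)
qed

text \<open>Fourier coefficients of the centred indicator of an invariant set. Those at frequencies
  not divisible by \<open>b\<close> vanish, and the one at \<open>j * b\<close> equals the one at
  \<open>j\<close>. Frequency 0 is settled by centring, the others by descent on |k|.\<close>

lemma ergodic_times:
  assumes b: "2 \<le> b"
  shows "ergodic_map unit_measure (times_map b)"
proof
  obtain c where c: "b = int c" "2 \<le> c" using b by (metis nat_int zero_le_imp_eq_int nat_le_eq_zle numeral_le_iff of_nat_le_iff of_nat_numeral order_trans zero_le_numeral)
  show "distr unit_measure unit_measure (times_map b) = unit_measure"
    unfolding c(1) by (rule times_map_preserves) (use c in auto)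
  fix A assume "A \<in> sets unit_measure" and inv: "times_map b -` A \<inter> space unit_measure = A"
  then have [measurable]: "A \<in> sets borel" by simp
  define m where "m = unit.prob A"
  define \<psi> where "\<psi> x = indicator A x - complex_of_real m" for x
  have \<psi>_meas [measurable]: "\<psi> \<in> borel_measurable borel" unfolding \<psi>_def by measurable
  have \<psi>_bd: "norm (\<psi> x) \<le> 1 + \<bar>m\<bar>" for x
    unfolding \<psi>_def by (rule order_trans[OF norm_triangle_ineq4]) (auto simp: indicator_def)
  have ind_int: "integrable unit_measure (\<lambda>x. complex_of_real (indicator A x))"
    by (rule unit.integrable_const_bound[where B = 1]) (auto simp: indicator_def)
  have "(\<lambda>x. \<psi> x) = (\<lambda>x. complex_of_real (indicator A x) - complex_of_real m)" by (auto simp: \<psi>_def indicator_def)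
  then have mean: "integral\<^sup>L unit_measure \<psi> = 0"
    using ind_int unit.prob_space by (simp add: m_def integral_complex_of_real)
  have \<psi>_inv: "\<psi> (times_map b x) = \<psi> x" for x
    using inv by (auto simp: \<psi>_def indicator_def)
  interpret L1_closed_class "\<lambda>h. (\<integral>x. h x * \<psi> x \<partial>unit_measure) = 0"
    by (rule L1_closed_class_annihilator[OF \<psi>_meas \<psi>_bd])
  have "(\<integral>x. character k x * \<psi> x \<partial>unit_measure) = 0" for k
  proof (induction "nat \<bar>k\<bar>" arbitrary: k rule: less_induct)
    case less
    show ?case
    proof (cases "k = 0")
      case True
      then show ?thesis using mean by (simp add: character_def)
    next
      case False
      show ?thesis
      proof (cases "b dvd k")
        case True
        then obtain j where j: "k = j * b" by (metis dvd_def mult.commute)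
        then have "\<bar>k\<bar> = \<bar>j\<bar> * b" using b by (simp add: abs_mult)
        moreover have "\<bar>j\<bar> \<noteq> 0" using False j by auto
        ultimately have "nat \<bar>j\<bar> < nat \<bar>k\<bar>" using b by (simp add: zless_nat_eq_int_zless)
        from less.hyps[OF this] have "(\<integral>x. character j x * \<psi> x \<partial>unit_measure) = 0" .
        also have "(\<integral>x. character j x * \<psi> x \<partial>unit_measure) = (\<integral>x. character j (times_map b x) * \<psi> (times_map b x) \<partial>unit_measure)"
          using integral_distr[of "times_map b" unit_measure unit_measure "\<lambda>x. character j x * \<psi> x"] times_map_preserves[of c] c by simp
        finally show ?thesis by (simp add: \<psi>_inv character_times_map j)
      next
        case False
        then show ?thesis
          using integral_character_times_map[OF \<psi>_meas \<psi>_bd, of c k] c \<psi>_inv by simp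
      qed
    qed
  qed
  then have "(\<integral>x. h x * \<psi> x \<partial>unit_measure) = 0" if "integrable unit_measure h" for h
    using that by (rule trigonometric_dense)
  then have "m = 0 \<or> (AE x in unit_measure. x \<in> A)"
    unfolding \<psi>_def by (intro trivial_if_annihilated) auto
  then show "unit.prob A = 0 \<or> unit.prob A = 1"
    unfolding m_def by (subst (asm) unit.prob_eq_1[symmetric]) auto
qed auto

section \<open>Lengths of cylinders\<close>

text \<open>The integrand is the logarithm of |T_G'(x)| = 1 / x^2, so its Gauss mean is the Lyapunov
  exponent.\<close>

lemma gauss_lyapunov:
  shows "integrable gauss_borel (\<lambda>x. - 2 * ln x)"
    and "integral\<^sup>L gauss_borel (\<lambda>x. - 2 * ln x) = 2 * (LINT x::real|lborel. indicator {0..1} x * (- ln x / (1 + x))) / ln 2"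
proof -
  let ?f = "\<lambda>x::real. indicator {0..1} x * (- ln x / (1 + x))"
  have eq: "indicator {0..1} x *\<^sub>R (gauss_density x *\<^sub>R (- 2 * ln x)) = 2 / ln 2 * ?f x" for x
    by (simp add: gauss_density_def)
  have um: "unit_measure = density lborel (\<lambda>x. ennreal (indicator {0..1} x))"
    unfolding unit_measure_def by (intro density_cong) (auto simp: indicator_def)
  have "integrable lborel (\<lambda>x. indicator {0..1} x *\<^sub>R (gauss_density x *\<^sub>R (- 2 * ln x)))"
    unfolding eq by (intro integrable_mult_right integrable_ln_over_1_plus)
  then have "integrable unit_measure (\<lambda>x. gauss_density x *\<^sub>R (- 2 * ln x))"
    unfolding um by (subst integrable_density) auto
  then show "integrable gauss_borel (\<lambda>x. - 2 * ln x)"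
    unfolding gauss_borel_def
    by (subst integrable_density) (use AE_unit_interior in \<open>auto elim!: eventually_mono intro: less_imp_le[OF gauss_density_pos]\<close>)
  have "integral\<^sup>L gauss_borel (\<lambda>x. - 2 * ln x) = (\<integral>x. gauss_density x *\<^sub>R (- 2 * ln x) \<partial>unit_measure)"
    by (rule integral_gauss_borel) measurable
  also have "\<dots> = (\<integral>x. indicator {0..1} x *\<^sub>R (gauss_density x *\<^sub>R (- 2 * ln x)) \<partial>lborel)"
    by (rule integral_unit_measure) measurable
  also have "\<dots> = (\<integral>x. 2 / ln 2 * ?f x \<partial>lborel)" by (simp only: eq)
  also have "\<dots> = 2 / ln 2 * integral\<^sup>L lborel ?f" by (rule integral_mult_right_zero)
  finally show "integral\<^sup>L gauss_borel (\<lambda>x. - 2 * ln x) = 2 * integral\<^sup>L lborel ?f / ln 2" by simp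
qed

lemma AE_orbit_pos: "AE x in unit_measure. \<forall>k. 0 < (gauss_map ^^ k) x"
proof -
  have "AE x in gauss_borel. 0 < x"
    unfolding AE_gauss_borel using AE_unit_interior by eventually_elim simp
  from gauss.AE_funpow[OF this] show ?thesis unfolding AE_gauss_borel .
qed

lemma orbit_prod_eq_exp:
  assumes "\<forall>k. 0 < (gauss_map ^^ k) x"
  shows "(\<Prod>k<n. (gauss_map ^^ k) x)\<^sup>2 = exp (- gauss.birkhoff_sum (\<lambda>x. - 2 * ln x) n x)"
proof -
  have "exp (- gauss.birkhoff_sum (\<lambda>x. - 2 * ln x) n x) = (\<Prod>k<n. exp (2 * ln ((gauss_map ^^ k) x)))"
    by (simp add: gauss.birkhoff_sum_def sum_negf[symmetric] exp_sum)
  also have "\<dots> = (\<Prod>k<n. ((gauss_map ^^ k) x)\<^sup>2)"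
    using assms by (intro prod.cong) (auto simp: exp_double)
  finally show ?thesis by (simp add: prod_power_distrib)
qed

text \<open>The squared orbit product is 1 / |(T_G^n)'(x)|, and its logarithm is minus a Birkhoff
  sum. A rate \<open>c\<close> strictly between the exponent and ln 11 absorbs all fluctuations into
  a constant depending on \<open>x\<close>.\<close>

lemma orbit_prod_lower:
  "\<exists>c<ln 11. AE x in unit_measure. \<exists>B. \<forall>n. exp (- (c * real n) - B) \<le> (\<Prod>k<n. (gauss_map ^^ k) x)\<^sup>2"
proof -
  have "integral\<^sup>L gauss_borel (\<lambda>x. - 2 * ln x) < ln 11"
    unfolding gauss_lyapunov(2) by (rule gauss_exponent_bounds(2))
  then obtain c where c: "integral\<^sup>L gauss_borel (\<lambda>x. - 2 * ln x) < c" "c < ln 11" using dense by blast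
  have "AE x in unit_measure. \<exists>B. \<forall>n. gauss.birkhoff_sum (\<lambda>x. - 2 * ln x) n x \<le> c * real n + B"
    using gauss.birkhoff_sum_le[OF gauss_lyapunov(1) c(1)] unfolding AE_gauss_borel .
  with AE_orbit_pos have "AE x in unit_measure. \<exists>B. \<forall>n. exp (- (c * real n) - B) \<le> (\<Prod>k<n. (gauss_map ^^ k) x)\<^sup>2"
  proof eventually_elim
    case (elim x)
    then obtain B where "\<And>n. gauss.birkhoff_sum (\<lambda>x. - 2 * ln x) n x \<le> c * real n + B" by blast
    then have "exp (- (c * real n) - B) \<le> (\<Prod>k<n. (gauss_map ^^ k) x)\<^sup>2" for n
      unfolding orbit_prod_eq_exp[OF elim(1)] exp_le_cancel_iff by (smt (verit))
    then show ?case by blast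
  qed
  with c(2) show ?thesis by blast
qed

lemma orbit_prod_upper:
  "\<exists>c>ln 10. AE x in unit_measure. \<exists>B. \<forall>n. (\<Prod>k<n. (gauss_map ^^ k) x)\<^sup>2 \<le> exp (B - c * real n)"
proof -
  have "ln 10 < integral\<^sup>L gauss_borel (\<lambda>x. - 2 * ln x)"
    unfolding gauss_lyapunov(2) by (rule gauss_exponent_bounds(1))
  then obtain c where c: "ln 10 < c" "c < integral\<^sup>L gauss_borel (\<lambda>x. - 2 * ln x)" using dense by blast
  have "integrable gauss_borel (\<lambda>x. - (- 2 * ln x))" using gauss_lyapunov(1) by (rule integrable_minus)
  moreover have "integral\<^sup>L gauss_borel (\<lambda>x. - (- 2 * ln x)) < - c"
    unfolding integral_minus using c(2) by simp
  ultimately have "AE x in unit_measure. \<exists>B. \<forall>n. gauss.birkhoff_sum (\<lambda>x. - (- 2 * ln x)) n x \<le> - c * real n + B"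
    using gauss.birkhoff_sum_le unfolding AE_gauss_borel[symmetric] by blast
  with AE_orbit_pos have "AE x in unit_measure. \<exists>B. \<forall>n. (\<Prod>k<n. (gauss_map ^^ k) x)\<^sup>2 \<le> exp (B - c * real n)"
  proof eventually_elim
    case (elim x)
    then obtain B where B: "\<And>n. gauss.birkhoff_sum (\<lambda>x. - (- 2 * ln x)) n x \<le> - c * real n + B" by blast
    have neg: "gauss.birkhoff_sum (\<lambda>x. - (- 2 * ln x)) n x = - gauss.birkhoff_sum (\<lambda>x. - 2 * ln x) n x" for n
      unfolding gauss.birkhoff_sum_def by (rule sum_negf)
    have "(\<Prod>k<n. (gauss_map ^^ k) x)\<^sup>2 \<le> exp (B - c * real n)" for n
      unfolding orbit_prod_eq_exp[OF elim(1)] exp_le_cancel_iff using B[of n] unfolding neg by simp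
    then show ?case by blast
  qed
  with c(1) show ?thesis by blast
qed

section \<open>Averages under vanishing perturbations\<close>

lemma cesaro_null:
  fixes a :: "nat \<Rightarrow> 'a::real_normed_field"
  assumes "a \<longlonglongrightarrow> 0"
  shows "(\<lambda>N. (\<Sum>n<N. a n) / of_nat N) \<longlonglongrightarrow> 0"
proof (rule tendstoI)
  fix e :: real assume e: "0 < e"
  then have "\<forall>\<^sub>F n in sequentially. norm (a n) < e / 2"
    using tendstoD[OF assms, of "e / 2"] by simp
  then obtain M where M: "\<And>n. M \<le> n \<Longrightarrow> norm (a n) < e / 2" by (auto simp: eventually_sequentially)
  define C where "C = (\<Sum>n<M. norm (a n))"
  have "(\<lambda>N. C / real N) \<longlonglongrightarrow> 0" by (rule lim_const_over_n)
  then have "\<forall>\<^sub>F N in sequentially. C / real N < e / 2" using e by (intro order_tendstoD(2)) auto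
  then show "\<forall>\<^sub>F N in sequentially. dist ((\<Sum>n<N. a n) / of_nat N) 0 < e"
    using eventually_ge_at_top[of "Suc M"]
  proof eventually_elim
    case (elim N)
    have "norm (\<Sum>n<N. a n) \<le> (\<Sum>n<N. norm (a n))" by (rule norm_sum)
    also have "\<dots> = C + (\<Sum>n=M..<N. norm (a n))"
      unfolding C_def using elim by (metis Suc_leD lessThan_atLeast0 sum.atLeastLessThan_concat zero_le)
    also have "(\<Sum>n=M..<N. norm (a n)) \<le> (\<Sum>n=M..<N. e / 2)"
      by (intro sum_mono) (use M in \<open>auto intro: less_imp_le\<close>)
    also have "\<dots> \<le> real N * (e / 2)" using e by simp
    finally have "norm (\<Sum>n<N. a n) / real N \<le> (C + real N * (e / 2)) / real N"
      by (intro divide_right_mono) auto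
    also have "\<dots> = C / real N + e / 2" using elim by (simp add: add_divide_distrib)
    also have "\<dots> < e" using elim(1) by linarith
    finally show ?case by (simp add: norm_divide)
  qed
qed

lemma average_limit_cong:
  fixes a b :: "nat \<Rightarrow> 'a::real_normed_field"
  assumes "(\<lambda>N. (\<Sum>n<N. a n) / of_nat N) \<longlonglongrightarrow> l" "(\<lambda>n. b n - a n) \<longlonglongrightarrow> 0"
  shows "(\<lambda>N. (\<Sum>n<N. b n) / of_nat N) \<longlonglongrightarrow> l"
  using tendsto_add[OF assms(1) cesaro_null[OF assms(2)]]
  by (simp add: sum_subtractf diff_divide_distrib)

definition cylinder :: "nat \<Rightarrow> int list \<Rightarrow> real set" where
  "cylinder n l = {x \<in> {0<..<1}. cf_digits n x = l}"

lemma cylinder_measurable [measurable]: "cylinder n l \<in> sets borel"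
proof -
  have "cylinder n l = {0<..<1} \<inter> (cf_digits n -` {l} \<inter> space borel)" by (auto simp: cylinder_def)
  moreover have "cf_digits n -` {l} \<inter> space borel \<in> sets borel"
    by (rule measurable_sets[OF cf_digits_measurable]) simp
  ultimately show ?thesis by simp
qed

lemma cylinder_bounds:
  assumes "u \<in> cylinder n l" "v \<in> cylinder n l" "u \<le> v"
  shows "{u..v} \<subseteq> cylinder n l"
  using assms cylinder_convex[of u v n] by (auto simp: cylinder_def)

lemma cylinder_fmeasurable: "emeasure lborel (cylinder n l) < \<infinity>"
proof -
  have "emeasure lborel (cylinder n l) \<le> emeasure lborel {0<..<1::real}"
    by (intro emeasure_mono) (auto simp: cylinder_def)
  also have "\<dots> < \<infinity>" by simp
  finally show ?thesis .
qed

lemma cylinder_measure_ge: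
  assumes "u \<in> cylinder n l" "v \<in> cylinder n l"
  shows "\<bar>u - v\<bar> \<le> measure lborel (cylinder n l)"
proof -
  have "v - u \<le> measure lborel (cylinder n l)" if "u \<le> v" "u \<in> cylinder n l" "v \<in> cylinder n l" for u v
  proof -
    have "measure lborel {u..v} \<le> measure lborel (cylinder n l)"
      using cylinder_bounds[OF that(2,3,1)] cylinder_fmeasurable[of n l]
      by (intro measure_mono_fmeasurable) (auto simp: fmeasurable_def)
    then show ?thesis using that by simp
  qed
  from this[of u v] this[of v u] assms show ?thesis by linarith
qed

lemma cylinder_measure_lower:
  assumes x: "x \<in> {0<..<1}" and pos: "\<forall>k. 0 < (gauss_map ^^ k) x"
  shows "(\<Prod>k<n. (gauss_map ^^ k) x)\<^sup>2 / 8 \<le> measure lborel (cylinder n (cf_digits n x))"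
proof -
  \<comment> \<open>Two points of the cylinder whose n-th iterates differ by 1/2. Their distance is
    half the product of their orbit products, each at least half of that of \<open>x\<close>; this
    gives the factor 1/8.\<close>
  obtain u where u: "u \<in> {0<..<1}" "cf_digits n u = cf_digits n x" "(gauss_map ^^ n) u = 1 / 4" "\<forall>k<n. 0 < (gauss_map ^^ k) u"
    using cylinder_surjective[OF x, of n "1 / 4"] pos by auto
  obtain v where v: "v \<in> {0<..<1}" "cf_digits n v = cf_digits n x" "(gauss_map ^^ n) v = 3 / 4" "\<forall>k<n. 0 < (gauss_map ^^ k) v"
    using cylinder_surjective[OF x, of n "3 / 4"] pos by auto
  let ?P = "\<lambda>x. \<Prod>k<n. (gauss_map ^^ k) x"
  have Pu: "?P x \<le> 2 * ?P u" and Pv: "?P x \<le> 2 * ?P v"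
    using u v x pos by (auto intro!: orbit_prod_comparable)
  have Px: "0 \<le> ?P x" using pos by (intro prod_nonneg) (auto intro: less_imp_le)
  have "?P x * ?P x \<le> (2 * ?P u) * (2 * ?P v)"
    using Pu Pv Px by (intro mult_mono) auto
  then have "(?P x)\<^sup>2 / 8 \<le> 1 / 2 * (?P u * ?P v)" by (simp add: power2_eq_square)
  also have "\<dots> = \<bar>u - v\<bar>"
    using u v by (subst cylinder_distance[of u v n]) (auto simp: prod.distrib)
  also have "\<dots> \<le> measure lborel (cylinder n (cf_digits n x))"
    using u v by (intro cylinder_measure_ge) (auto simp: cylinder_def)
  finally show ?thesis .
qed

lemma cylinder_point_distance:
  assumes x: "x \<in> {0<..<1}" and pos: "\<forall>k. 0 < (gauss_map ^^ k) x"
  shows "\<bar>x - cylinder_point n (cf_digits n x)\<bar> \<le> 2 * (\<Prod>k<n. (gauss_map ^^ k) x)\<^sup>2"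
proof -
  let ?u = "cylinder_point n (cf_digits n x)" and ?P = "\<lambda>x. \<Prod>k<n. (gauss_map ^^ k) x"
  have u: "?u \<in> {0<..<1}" "cf_digits n ?u = cf_digits n x" using cylinder_point[OF x] by auto
  have Px: "0 \<le> ?P x" using x by (intro orbit_prod_nonneg) auto
  have "\<bar>x - ?u\<bar> \<le> ?P x * ?P ?u" using x u by (intro cylinder_distance_le) auto
  also have "\<dots> \<le> ?P x * (2 * ?P x)"
  proof (rule mult_left_mono[OF _ Px])
    show "?P ?u \<le> 2 * ?P x"
    \<comment> \<open>The representative may be rational with an orbit that reaches 0, where the
      distortion bound does not apply; its orbit product is then 0.\<close>
    proof (cases "\<forall>k<n. 0 < (gauss_map ^^ k) ?u")
      case True
      then show ?thesis using x u pos by (intro orbit_prod_comparable) auto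
    next
      case False
      then obtain k where k: "k < n" "\<not> 0 < (gauss_map ^^ k) ?u" by blast
      then have "(gauss_map ^^ k) ?u = 0" using gauss_funpow_range[of ?u k] u by auto
      then have "?P ?u = 0" using k by (intro prod_zero) auto
      then show ?thesis using Px by linarith
    qed
  qed
  finally show ?thesis by (simp add: power2_eq_square)
qed

section \<open>Decorrelation\<close>

lemma drop_cf_digits: "drop n (cf_digits (n + r) x) = cf_digits r ((gauss_map ^^ n) x)"
  by (induction n arbitrary: x) (auto simp: funpow_swap1)

lemma take_cf_digits: "m \<le> n \<Longrightarrow> take m (cf_digits n x) = cf_digits m x"
proof (induction m arbitrary: n x)
  case (Suc m)
  then show ?case by (cases n) auto
qed simp

section \<open>Long cylinders: b at least 11\<close>

lemma integral_character_interval: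
  assumes "k \<noteq> 0" "a \<le> c"
  shows "norm (\<integral>x. indicator {a..c} x *\<^sub>R character k x \<partial>lborel) \<le> 1 / (pi * \<bar>of_int k\<bar>)"
proof -
  have "norm (character k c - character k a) \<le> 2"
    using norm_triangle_ineq4[of "character k c" "character k a"] by simp
  then have "norm (character k c - character k a) / (2 * (pi * \<bar>of_int k\<bar>)) \<le> 2 / (2 * (pi * \<bar>of_int k\<bar>))"
    by (rule divide_right_mono) simp
  then show ?thesis
    unfolding integral_character_Icc[OF assms] by (simp add: norm_divide norm_mult abs_mult)
qed

text \<open>By convexity a cylinder is an interval up to its endpoints, so the bound from the
  antiderivative of the character is independent of its length.\<close>

lemma integral_character_cylinder:
  assumes "k \<noteq> 0"
  shows "norm (\<integral>x. indicator (cylinder n l) x *\<^sub>R character k x \<partial>lborel) \<le> 1 / (pi * \<bar>of_int k\<bar>)"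
proof (cases "cylinder n l = {}")
  case True
  then show ?thesis by simp
next
  case False
  let ?I = "cylinder n l"
  define a where "a = Inf ?I"
  define c where "c = Sup ?I"
  have bdd: "bdd_below ?I" "bdd_above ?I"
    by (auto simp: cylinder_def intro: bdd_belowI[of _ 0] bdd_aboveI[of _ 1])
  have sub: "?I \<subseteq> {a..c}" unfolding a_def c_def using bdd by (auto intro: cInf_lower cSup_upper)
  have sup: "{a<..<c} \<subseteq> ?I"
  proof
    fix x assume x: "x \<in> {a<..<c}"
    obtain u where "u \<in> ?I" "u < x" using cInf_lessD[OF False, of x] x unfolding a_def by auto
    moreover obtain v where "v \<in> ?I" "x < v" using less_cSupD[OF False, of x] x unfolding c_def by auto
    ultimately show "x \<in> ?I" using cylinder_bounds[of u n l v] by auto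
  qed
  have "a \<le> c" using False sub by force
  have "(\<integral>x. indicator ?I x *\<^sub>R character k x \<partial>lborel) = (\<integral>x. indicator {a..c} x *\<^sub>R character k x \<partial>lborel)"
  proof (rule integral_cong_AE)
    show "AE x in lborel. indicator ?I x *\<^sub>R character k x = indicator {a..c} x *\<^sub>R character k x"
      using AE_lborel_singleton[of a] AE_lborel_singleton[of c]
    proof eventually_elim
      case (elim x)
      then have "x \<in> ?I \<longleftrightarrow> x \<in> {a..c}" using sub sup by auto
      then show ?case by (simp add: indicator_def)
    qed
  qed auto
  then show ?thesis using integral_character_interval[OF assms \<open>a \<le> c\<close>] by simp
qed

text \<open>At most \<open>1 / \<delta>\<close> cylinders are longer than \<open>\<delta>\<close>, and each of them contributes \<open>O(1 / \<bar>k\<bar>)\<close>.\<close>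
lemma integral_character_long_cylinders:
  fixes H :: "int list \<Rightarrow> complex"
  assumes k: "k \<noteq> 0" and \<delta>: "0 < \<delta>" and bd: "\<And>l. norm (H l) \<le> K"
    and supp: "\<And>l. H l \<noteq> 0 \<Longrightarrow> \<delta> \<le> measure lborel (cylinder n l)"
  shows "norm (\<integral>x. character k x * H (cf_digits n x) \<partial>unit_measure) \<le> K / (pi * \<bar>of_int k\<bar> * \<delta>)"
proof -
  have K0: "0 \<le> K" using order_trans[OF norm_ge_zero bd] .
  define L where "L = {l. H l \<noteq> 0}"
  have card_le: "real (card F) * \<delta> \<le> 1" if F: "finite F" "F \<subseteq> L" for F
  proof -
    have "real (card F) * \<delta> = (\<Sum>l\<in>F. \<delta>)" by simp
    also have "\<dots> \<le> (\<Sum>l\<in>F. measure lborel (cylinder n l))"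
      using F supp by (intro sum_mono) (auto simp: L_def)
    also have "\<dots> = measure lborel (\<Union>l\<in>F. cylinder n l)"
    proof (rule measure_finite_Union[symmetric])
      show "disjoint_family_on (cylinder n) F" by (auto simp: disjoint_family_on_def cylinder_def)
      show "emeasure lborel (cylinder n l) \<noteq> \<infinity>" for l using cylinder_fmeasurable[of n l] by simp
    qed (use F in auto)
    also have "\<dots> \<le> measure lborel {0<..<1::real}"
      by (intro measure_mono_fmeasurable) (use F in \<open>auto simp: cylinder_def fmeasurable_def\<close>)
    finally show ?thesis by simp
  qed
  have "finite L"
  proof (rule ccontr)
    assume "infinite L"
    then obtain F where F: "F \<subseteq> L" "finite F" "card F = Suc (nat \<lceil>1 / \<delta>\<rceil>)"
      using infinite_arbitrarily_large by blast
    have "1 / \<delta> < real (card F)" using F(3) by simp linarith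
    then have "1 < real (card F) * \<delta>" using \<delta> by (simp add: field_simps)
    then show False using card_le[OF F(2,1)] by simp
  qed
  have eq: "(\<integral>x. character k x * H (cf_digits n x) \<partial>unit_measure) =
    (\<integral>x. (\<Sum>l\<in>L. H l * (indicator (cylinder n l) x *\<^sub>R character k x)) \<partial>lborel)"
  proof -
    have "(\<integral>x. character k x * H (cf_digits n x) \<partial>unit_measure) =
      (\<integral>x. indicator {0..1} x *\<^sub>R (character k x * H (cf_digits n x)) \<partial>lborel)"
      by (rule integral_unit_measure) measurable
    also have "\<dots> = (\<integral>x. (\<Sum>l\<in>L. H l * (indicator (cylinder n l) x *\<^sub>R character k x)) \<partial>lborel)"
    proof (rule integral_cong_AE)
      show "AE x in lborel. indicator {0..1} x *\<^sub>R (character k x * H (cf_digits n x)) =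
          (\<Sum>l\<in>L. H l * (indicator (cylinder n l) x *\<^sub>R character k x))"
        using AE_lborel_singleton[of "0::real"] AE_lborel_singleton[of "1::real"]
      proof eventually_elim
        case (elim x)
        show ?case
        proof (cases "x \<in> {0<..<1}")
          case True
          have "(\<Sum>l\<in>L. H l * (indicator (cylinder n l) x *\<^sub>R character k x)) =
              (\<Sum>l\<in>L. if l = cf_digits n x then H l * character k x else 0)"
            using True by (intro sum.cong) (auto simp: indicator_def cylinder_def)
          also have "\<dots> = character k x * H (cf_digits n x)"
            using \<open>finite L\<close> by (subst sum.delta) (auto simp: L_def)
          finally show ?thesis using True by simp
        next
          case False
          then have "x \<notin> {0..1}" using elim by auto
          moreover have "x \<notin> cylinder n l" for l using False by (auto simp: cylinder_def)
          ultimately show ?thesis by simp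
        qed
      qed
    qed auto
    finally show ?thesis .
  qed
  have int: "integrable lborel (\<lambda>x. indicator (cylinder n l) x *\<^sub>R character k x)" for l
  proof (rule Bochner_Integration.integrable_bound)
    show "integrable lborel (indicat_real (cylinder n l))"
      using cylinder_fmeasurable[of n l] by (intro integrable_real_indicator) auto
  qed auto
  have "norm (\<integral>x. character k x * H (cf_digits n x) \<partial>unit_measure) =
      norm (\<Sum>l\<in>L. H l * (\<integral>x. indicator (cylinder n l) x *\<^sub>R character k x \<partial>lborel))"
  proof -
    have "(\<integral>x. (\<Sum>l\<in>L. H l * (indicator (cylinder n l) x *\<^sub>R character k x)) \<partial>lborel) =
        (\<Sum>l\<in>L. \<integral>x. H l * (indicator (cylinder n l) x *\<^sub>R character k x) \<partial>lborel)"
      by (rule Bochner_Integration.integral_sum) (intro integrable_mult_right int)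
    then show ?thesis unfolding eq by (simp only: integral_mult_right_zero)
  qed
  also have "\<dots> \<le> (\<Sum>l\<in>L. K * (1 / (pi * \<bar>of_int k\<bar>)))"
    by (rule sum_norm_le) (unfold norm_mult, intro mult_mono bd integral_character_cylinder k K0, simp)
  also have "\<dots> = real (card L) * \<delta> * (K / (pi * \<bar>of_int k\<bar> * \<delta>))"
    using \<delta> by simp
  also have "\<dots> \<le> 1 * (K / (pi * \<bar>of_int k\<bar> * \<delta>))"
    using card_le[OF \<open>finite L\<close>] K0 \<delta> by (intro mult_right_mono) auto
  finally show ?thesis by simp
qed

lemma long_cylinder_case:
  fixes \<eta> :: "int list \<Rightarrow> complex"
  assumes b: "11 \<le> b" and k: "k \<noteq> 0" and bd: "\<And>l. norm (\<eta> l) \<le> K"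
  shows "AE x in unit_measure. (\<lambda>N. (\<Sum>n<N. character k ((times_map b ^^ n) x) * \<eta> (cf_digits r ((gauss_map ^^ n) x))) / of_nat N) \<longlonglongrightarrow> 0"
proof -
  have K0: "0 \<le> K" using order_trans[OF norm_ge_zero bd] .
  obtain c where c: "c < ln 11" and AE_low: "AE x in unit_measure. \<exists>B. \<forall>n. exp (- (c * real n) - B) \<le> (\<Prod>k<n. (gauss_map ^^ k) x)\<^sup>2"
    using orbit_prod_lower by blast
  \<comment> \<open>Almost every orbit has cylinders shrinking no faster than rate \<open>c\<close>.
    The gap \<open>d - c\<close> will absorb the constants depending on the point, and
    \<open>d < ln 11\<close> keeps \<open>\<theta>\<close> below 1.\<close>
  obtain d where d: "max 0 c < d" "d < ln 11" using dense[of "max 0 c" "ln 11"] c by auto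
  define \<theta> where "\<theta> = exp d / real_of_int b"
  have \<theta>: "0 \<le> \<theta>" "\<theta> < 1"
  proof -
    have "exp d < exp (ln 11)" by (subst exp_less_cancel_iff) (rule d)
    also have "\<dots> \<le> real_of_int b" using b by simp
    finally show "\<theta> < 1" using b by (simp add: \<theta>_def)
    show "0 \<le> \<theta>" using b by (simp add: \<theta>_def)
  qed
  define \<delta> where "\<delta> n = exp (- (d * real n))" for n
  \<comment> \<open>Words with cylinders shorter than \<open>\<delta>\<close> are discarded, so that
    the estimate for long cylinders applies to every \<open>n\<close> with no exceptional set. The
    depth is \<open>n + r\<close> because \<open>\<eta>\<close> reads \<open>r\<close> digits after
    time \<open>n\<close>.\<close>
  define G where "G n l = (if \<delta> (n + r) \<le> measure lborel (cylinder (n + r) l) then \<eta> (drop n l) else 0)" for n l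
  define Y where "Y n x = character (k * b ^ n) x * G n (cf_digits (n + r) x)" for n x
  have G_bd: "norm (G n l) \<le> K" for n l using bd K0 by (simp add: G_def)
  have Y_meas [measurable]: "Y n \<in> borel_measurable borel" for n unfolding Y_def by measurable
  have Y_bd: "norm (Y n x) \<le> K" for n x using G_bd by (simp add: Y_def norm_mult)
  define C where "C = K * K * (1 + 2 * exp (d * real r))"
  have C_ge: "K * K \<le> C" "K * K * (2 * exp (d * real r)) \<le> C" "0 \<le> C"
    unfolding C_def using K0 by (auto simp: algebra_simps)
  have "AE x in unit_measure. (\<lambda>N. (\<Sum>n<N. Y n x) / of_nat N) \<longlonglongrightarrow> 0"
  proof (rule unit.averages_tendsto_0[OF _ Y_bd \<theta>])
    fix m n :: nat assume mn: "m \<le> n"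
    have bound: "norm (\<integral>x. Y m x * cnj (Y n x) \<partial>unit_measure) \<le> C * \<theta> ^ n" if "m < n"
    proof -
      define H where "H l = G m (take (m + r) l) * cnj (G n l)" for l
      \<comment> \<open>The product of the two terms has frequency \<open>j\<close>, of size at
        least \<open>b^n / 2\<close> because \<open>b^m \<le> b^n / 2\<close>, and an amplitude
        determined by \<open>n + r\<close> digits.\<close>
      define j where "j = k * b ^ m - k * b ^ n"
      have bm: "real_of_int b ^ m * 2 \<le> real_of_int b ^ n"
      proof -
        have "real_of_int b ^ m * 2 \<le> real_of_int b ^ m * real_of_int b" using b by (intro mult_left_mono) auto
        also have "\<dots> = real_of_int b ^ Suc m" by simp
        also have "\<dots> \<le> real_of_int b ^ n" using that b by (intro power_increasing) auto
        finally show ?thesis .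
      qed
      have j_eq: "\<bar>real_of_int j\<bar> = \<bar>real_of_int k\<bar> * (real_of_int b ^ n - real_of_int b ^ m)"
      proof -
        have "real_of_int j = real_of_int k * (real_of_int b ^ m - real_of_int b ^ n)"
          by (simp add: j_def algebra_simps)
        moreover have "real_of_int b ^ m \<le> real_of_int b ^ n" using b mn by (intro power_increasing) auto
        ultimately show ?thesis by (simp add: abs_mult)
      qed
      have "real_of_int b ^ n / 2 \<le> 1 * (real_of_int b ^ n - real_of_int b ^ m)" using bm by simp
      also have "\<dots> \<le> \<bar>real_of_int k\<bar> * (real_of_int b ^ n - real_of_int b ^ m)"
      proof (rule mult_right_mono)
        show "1 \<le> \<bar>real_of_int k\<bar>" using k by (metis of_int_1_le_iff of_int_abs int_one_le_iff_zero_less zero_less_abs_iff)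
        show "0 \<le> real_of_int b ^ n - real_of_int b ^ m" using bm zero_le_power[of "real_of_int b" m] b by linarith
      qed
      finally have j_ge: "real_of_int b ^ n / 2 \<le> \<bar>real_of_int j\<bar>" using j_eq by simp
      have b0: "0 < real_of_int b ^ n" using b by simp
      have "j \<noteq> 0" using j_ge b0 by auto
      have "(\<integral>x. Y m x * cnj (Y n x) \<partial>unit_measure) = (\<integral>x. character j x * H (cf_digits (n + r) x) \<partial>unit_measure)"
      proof (intro Bochner_Integration.integral_cong refl)
        fix x
        have "take (m + r) (cf_digits (n + r) x) = cf_digits (m + r) x" using mn by (intro take_cf_digits) simp
        moreover have "character j x = character (k * b ^ m) x * cnj (character (k * b ^ n) x)"
          by (simp add: j_def cnj_character character_mult)
        ultimately show "Y m x * cnj (Y n x) = character j x * H (cf_digits (n + r) x)"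
          by (simp add: Y_def H_def mult_ac)
      qed
      also have "norm \<dots> \<le> (K * K) / (pi * \<bar>of_int j\<bar> * \<delta> (n + r))"
      proof (rule integral_character_long_cylinders[OF \<open>j \<noteq> 0\<close>])
        show "0 < \<delta> (n + r)" by (simp add: \<delta>_def)
        show "norm (H l) \<le> K * K" for l
          unfolding H_def norm_mult complex_mod_cnj by (intro mult_mono G_bd K0) auto
        show "\<delta> (n + r) \<le> measure lborel (cylinder (n + r) l)" if "H l \<noteq> 0" for l
          using that by (auto simp: H_def G_def split: if_splits)
      qed
      also have "\<dots> \<le> (K * K) / (1 * (real_of_int b ^ n / 2) * \<delta> (n + r))"
        using K0 b0 j_ge pi_ge_two by (intro divide_left_mono mult_right_mono mult_mono mult_pos_pos) (auto simp: \<delta>_def)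
      \<comment> \<open>The number of long cylinders is at most \<open>exp (d * (n + r))\<close>,
        and the frequency contributes \<open>b^(-n)\<close>. The ratio is
        \<open>\<theta> ^ n\<close>; reading \<open>r\<close> digits ahead costs only
        \<open>exp (d * r)\<close>.\<close>
      also have "\<dots> = K * K * (2 * exp (d * real r)) * \<theta> ^ n"
      proof -
        have "\<delta> (n + r) = 1 / (exp d ^ n * exp (d * real r))"
          unfolding \<delta>_def exp_minus inverse_eq_divide exp_of_nat2_mult[symmetric] exp_add[symmetric] by (simp add: distrib_left)
        then show ?thesis by (simp add: \<theta>_def power_divide)
      qed
      also have "\<dots> \<le> C * \<theta> ^ n" using C_ge \<theta> by (intro mult_right_mono) auto
      finally show ?thesis .
    qed
    show "norm (\<integral>x. Y m x * cnj (Y n x) \<partial>unit_measure) \<le> C * (\<theta> ^ n + \<theta> ^ (n - m))"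
    proof (cases "m < n")
      case True
      have "C * \<theta> ^ n \<le> C * (\<theta> ^ n + \<theta> ^ (n - m))" using C_ge \<theta> by (intro mult_left_mono) auto
      then show ?thesis using bound[OF True] by linarith
    next
      case False
      have "norm (\<integral>x. Y m x * cnj (Y n x) \<partial>unit_measure) \<le> K * K"
        by (rule unit.norm_integral_le) (auto simp: norm_mult intro!: mult_mono Y_bd K0)
      also have "\<dots> \<le> C * 1" using C_ge by simp
      also have "\<dots> \<le> C * (\<theta> ^ n + \<theta> ^ (n - m))" using C_ge \<theta> False mn by (intro mult_left_mono) auto
      finally show ?thesis .
    qed
  qed auto
  with AE_low AE_orbit_pos AE_unit_interior show ?thesis
  proof eventually_elim
    case (elim x)
    then obtain B where B: "\<And>n. exp (- (c * real n) - B) \<le> (\<Prod>k<n. (gauss_map ^^ k) x)\<^sup>2" by blast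
    have x: "x \<in> {0<..<1}" using elim by auto
    \<comment> \<open>Beyond \<open>M\<close> the gap \<open>d - c\<close> outweighs
      \<open>B\<close> and the ln 8 from the lower bound for cylinder measures, so nothing is
      discarded along this orbit.\<close>
    obtain M :: nat where M: "(B + ln 8) / (d - c) \<le> real M" using real_arch_simple by blast
    have good: "\<delta> n \<le> measure lborel (cylinder n (cf_digits n x))" if "M \<le> n" for n
    proof -
      have "B + ln 8 \<le> (d - c) * real M" using M d by (simp add: field_simps)
      also have "\<dots> \<le> (d - c) * real n" using d that by (intro mult_left_mono) auto
      finally have "- (d * real n) \<le> - (c * real n) - B - ln 8" by (simp add: algebra_simps)
      then have "\<delta> n \<le> exp (- (c * real n) - B) / 8"
        unfolding \<delta>_def by (subst (asm) exp_le_cancel_iff[symmetric]) (simp add: exp_diff)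
      also have "\<dots> \<le> (\<Prod>k<n. (gauss_map ^^ k) x)\<^sup>2 / 8" using B[of n] by simp
      also have "\<dots> \<le> measure lborel (cylinder n (cf_digits n x))"
        using elim by (intro cylinder_measure_lower x) auto
      finally show ?thesis .
    qed
    have eqv: "character k ((times_map b ^^ n) x) * \<eta> (cf_digits r ((gauss_map ^^ n) x)) - Y n x = 0" if "M \<le> n" for n
      using good[of "n + r"] that
      by (simp add: Y_def G_def character_funpow_times_map drop_cf_digits)
    have "(\<lambda>n. character k ((times_map b ^^ n) x) * \<eta> (cf_digits r ((gauss_map ^^ n) x)) - Y n x) \<longlonglongrightarrow> 0"
      by (rule tendsto_eventually) (use eqv in \<open>auto simp: eventually_sequentially\<close>)
    with elim(4) show ?case by (rule average_limit_cong)
  qed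
qed

section \<open>Short cylinders: b at most 10\<close>

text \<open>A chord of the unit circle is no longer than its arc: |cis u - 1| = 2 |sin (u / 2)|
  \<le> |u|.\<close>

lemma character_lipschitz: "norm (character k x - character k y) \<le> 2 * pi * \<bar>of_int k\<bar> * \<bar>x - y\<bar>"
proof -
  have "norm (cis s - cis t) \<le> \<bar>s - t\<bar>" for s t :: real
  proof -
    have "norm (cis s - cis t) = norm (cis (s - t) - 1)"
    proof -
      have "cis s - cis t = cis t * (cis (s - t) - 1)" by (simp add: algebra_simps cis_mult)
      then show ?thesis by (simp add: norm_mult)
    qed
    also have "\<dots> \<le> \<bar>s - t\<bar>"
    proof -
      have "(norm (cis (s - t) - 1))\<^sup>2 = (2 * sin ((s - t) / 2))\<^sup>2"
      proof -
        have "(norm (cis u - 1))\<^sup>2 = 2 - 2 * cos u" for u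
        proof -
          have "(norm (cis u - 1))\<^sup>2 = (cos u - 1)\<^sup>2 + (sin u)\<^sup>2" by (simp add: cmod_power2)
          then show ?thesis using sin_cos_squared_add[of u] by (simp add: power2_diff)
        qed
        moreover have "2 - 2 * cos u = (2 * sin (u / 2))\<^sup>2" for u :: real
          using cos_double_sin[of "u / 2"] by (simp add: power2_eq_square)
        ultimately show ?thesis by simp
      qed
      then have "norm (cis (s - t) - 1) = \<bar>2 * sin ((s - t) / 2)\<bar>"
        using power2_eq_imp_eq[of "norm (cis (s - t) - 1)" "\<bar>2 * sin ((s - t) / 2)\<bar>"] by simp
      also have "\<dots> = 2 * \<bar>sin ((s - t) / 2)\<bar>" by (simp add: abs_mult)
      also have "\<dots> \<le> 2 * \<bar>(s - t) / 2\<bar>" by (intro mult_left_mono abs_sin_x_le_abs_x) auto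
      finally show ?thesis by simp
    qed
    finally show ?thesis .
  qed
  from this[of "2 * pi * (of_int k * x)" "2 * pi * (of_int k * y)"]
  have "norm (character k x - character k y) \<le> \<bar>2 * pi * (of_int k * x) - 2 * pi * (of_int k * y)\<bar>"
    unfolding character_def .
  also have "2 * pi * (of_int k * x) - 2 * pi * (of_int k * y) = 2 * pi * of_int k * (x - y)"
    by (simp only: right_diff_distrib mult.assoc)
  finally show ?thesis by (simp add: abs_mult)
qed

text \<open>The cancellation comes from the digits read by \<open>\<eta>\<close>, so
  \<open>\<eta>\<close> is centred and \<open>k\<close> is arbitrary. Freezing the character uses
  \<open>\<nu> n\<close> digits; the remaining \<open>n div q\<close> steps before time
  \<open>n\<close> are left for mixing.\<close>

lemma short_cylinder_case:
  fixes \<eta> :: "int list \<Rightarrow> complex"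
  assumes b: "2 \<le> b" "b \<le> 10" and bd: "\<And>l. norm (\<eta> l) \<le> K"
    and mean: "(\<integral>x. \<eta> (cf_digits r x) \<partial>gauss_borel) = 0"
  shows "AE x in unit_measure. (\<lambda>N. (\<Sum>n<N. character k ((times_map b ^^ n) x) * \<eta> (cf_digits r ((gauss_map ^^ n) x))) / of_nat N) \<longlonglongrightarrow> 0"
proof -
  have K0: "0 \<le> K" using order_trans[OF norm_ge_zero bd] .
  obtain c where c: "ln 10 < c" and AE_up: "AE x in unit_measure. \<exists>B. \<forall>n. (\<Prod>k<n. (gauss_map ^^ k) x)\<^sup>2 \<le> exp (B - c * real n)"
    using orbit_prod_upper by blast
  have c0: "0 < c" using c ln_gt_zero[of "10::real"] by linarith
  \<comment> \<open>Large enough that giving up a fraction 1 / q of the digits keeps the cylinders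
    shorter than 10^(-n): the rate \<open>c * (1 - 1 / q)\<close> still exceeds ln 10.\<close>
  obtain q :: nat where q: "c / (c - ln 10) < real q" using reals_Archimedean2 by blast
  have "0 < c / (c - ln 10)" using c c0 by simp
  then have q0: "0 < q" using q by (cases "q = 0") auto
  have q_gap: "ln 10 < c * (1 - 1 / real q)"
  proof -
    have "c < (c - ln 10) * real q" using q c by (simp add: field_simps)
    then show ?thesis using q0 by (simp add: field_simps)
  qed
  define \<nu> where "\<nu> n = n - n div q" for n
  have \<nu>_le: "\<nu> n \<le> n" for n by (simp add: \<nu>_def)
  have \<nu>_add: "\<nu> n + n div q = n" for n by (simp add: \<nu>_def)
  have \<nu>_mono: "\<nu> m \<le> \<nu> n" if "m \<le> n" for m n
  proof -
    have "\<nu> n \<le> \<nu> (Suc n)" for n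
      using q0 div_le_mono[of n "Suc n" q] by (auto simp: \<nu>_def div_Suc)
    then show ?thesis using that by (rule lift_Suc_mono_le)
  qed
  define g where "g x = \<eta> (cf_digits r x)" for x
  have g_meas [measurable]: "g \<in> borel_measurable borel" unfolding g_def by measurable
  have g_bd: "norm (g x) \<le> K" for x unfolding g_def by (rule bd)
  \<comment> \<open>The character at time \<open>n\<close>, evaluated at the representative of the
    cylinder instead of the point, so that it becomes a function of \<open>\<nu> n\<close>
    digits.\<close>
  define F where "F n l = character (k * b ^ n) (cylinder_point (\<nu> n) l)" for n l
  have F_bd: "norm (F n l) = 1" for n l by (simp add: F_def)
  define Y where "Y n x = F n (cf_digits (\<nu> n) x) * g ((gauss_map ^^ n) x)" for n x
  have Y_meas [measurable]: "Y n \<in> borel_measurable borel" for n unfolding Y_def by measurable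
  have Y_bd: "norm (Y n x) \<le> K" for n x using g_bd by (simp add: Y_def norm_mult F_bd)
  define \<rho> :: real where "\<rho> = 7 / 8"
  have \<rho>: "0 < \<rho>" "\<rho> < 1" by (auto simp: \<rho>_def)
  define \<theta> where "\<theta> = root q \<rho>"
  have \<theta>_pow: "\<theta> ^ q = \<rho>" using q0 \<rho> by (simp add: \<theta>_def)
  have \<theta>: "0 < \<theta>" "\<theta> < 1" using q0 \<rho> by (auto simp: \<theta>_def)
  have \<rho>\<theta>: "\<rho> \<le> \<theta>" unfolding \<theta>_pow[symmetric] using power_decreasing[of 1 q \<theta>] q0 \<theta> by simp
  have div_pow: "\<rho> ^ (n div q) \<le> \<theta> ^ n / \<rho>" for n
  proof -
    have "\<theta> ^ n = \<rho> ^ (n div q) * \<theta> ^ (n mod q)"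
      unfolding \<theta>_pow[symmetric] power_mult[symmetric] power_add[symmetric] by simp
    moreover have "\<rho> \<le> \<theta> ^ (n mod q)"
      unfolding \<theta>_pow[symmetric] using \<theta> q0 by (intro power_decreasing) auto
    ultimately have "\<rho> ^ (n div q) * \<rho> \<le> \<theta> ^ n" using \<rho> by (simp add: mult_left_mono)
    then show ?thesis using \<rho> by (simp add: field_simps)
  qed
  \<comment> \<open>The power \<open>\<rho> ^ Suc r\<close> pays for the rounding in
    \<open>n div q\<close> and for the window of \<open>r\<close> digits that \<open>\<eta>\<close>
    reads after time \<open>m\<close>.\<close>
  define C where "C = 4 * K * K / \<rho> ^ Suc r"
  have "AE x in unit_measure. (\<lambda>N. (\<Sum>n<N. Y n x) / of_nat N) \<longlonglongrightarrow> 0"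
  proof (rule unit.averages_tendsto_0[OF _ Y_bd less_imp_le[OF \<theta>(1)] \<theta>(2)])
    fix m n :: nat assume mn: "m \<le> n"
    have C_ge: "4 * K * K \<le> C * \<rho> ^ Suc r" "0 \<le> C" using K0 \<rho> by (auto simp: C_def)
    have tail: "4 * K * K * \<rho> ^ i \<le> C * (\<theta> ^ n + \<theta> ^ (n - m))" if "i = n div q \<or> n \<le> m + r + i" for i
    proof -
      have "\<rho> ^ Suc r * \<rho> ^ i \<le> \<theta> ^ n + \<theta> ^ (n - m)"
        using that
      proof
        assume i: "i = n div q"
        have "\<rho> ^ Suc r * \<rho> ^ i \<le> \<rho> * (\<theta> ^ n / \<rho>)"
          unfolding i using \<rho> power_le_one[of \<rho> r] by (intro mult_mono div_pow) (auto intro: mult_left_le)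
        also have "\<dots> = \<theta> ^ n" using \<rho> by simp
        finally show ?thesis using \<theta> by (simp add: add_increasing2)
      next
        assume i: "n \<le> m + r + i"
        have "\<rho> ^ Suc r * \<rho> ^ i = \<rho> ^ (Suc r + i)" by (simp add: power_add)
        also have "\<dots> \<le> \<rho> ^ (n - m)" using \<rho> i by (intro power_decreasing) auto
        also have "\<dots> \<le> \<theta> ^ (n - m)" using \<rho> \<rho>\<theta> by (intro power_mono) auto
        finally show ?thesis using \<theta> by (simp add: add_increasing)
      qed
      have "4 * K * K * \<rho> ^ i \<le> C * \<rho> ^ Suc r * \<rho> ^ i" using C_ge \<rho> by (intro mult_right_mono) auto
      also have "\<dots> = C * (\<rho> ^ Suc r * \<rho> ^ i)" by (simp only: mult.assoc)
      also have "\<dots> \<le> C * (\<theta> ^ n + \<theta> ^ (n - m))" by (rule mult_left_mono) fact+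
      finally show ?thesis .
    qed
    show "norm (\<integral>x. Y m x * cnj (Y n x) \<partial>unit_measure) \<le> C * (\<theta> ^ n + \<theta> ^ (n - m))"
    proof (cases "m + r \<le> n")
      case True
      define p where "p = max (\<nu> n) (m + r)"
      have p: "\<nu> n \<le> p" "m + r \<le> p" "p \<le> n" "\<nu> m \<le> p"
        using True \<nu>_le[of n] \<nu>_mono[OF mn] by (auto simp: p_def)
      define H where "H l = F m (take (\<nu> m) l) * \<eta> (drop m (take (m + r) l)) * cnj (F n (take (\<nu> n) l))" for l
      have H_bd: "norm (H l) \<le> K" for l using bd by (simp add: H_def norm_mult F_bd)
      have "norm (\<integral>x. H (cf_digits p x) * cnj (g ((gauss_map ^^ (p + (n - p))) x)) \<partial>levy_measure 0) \<le> 4 * K * K * (7 / 8) ^ (n - p)"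
      proof (rule digits_mixing)
        show "integral\<^sup>L gauss_borel (\<lambda>x. cnj (g x)) = 0"
          using mean by (simp add: g_def[symmetric])
      qed (use g_bd H_bd in auto)
      also have "(\<lambda>x. H (cf_digits p x) * cnj (g ((gauss_map ^^ (p + (n - p))) x))) = (\<lambda>x. Y m x * cnj (Y n x))"
      proof
        fix x
        have "drop m (take (m + r) (cf_digits p x)) = cf_digits r ((gauss_map ^^ m) x)"
          using p by (simp add: take_cf_digits drop_cf_digits)
        then show "H (cf_digits p x) * cnj (g ((gauss_map ^^ (p + (n - p))) x)) = Y m x * cnj (Y n x)"
          using p by (simp add: H_def Y_def g_def take_cf_digits mult_ac)
      qed
      also have "4 * K * K * (7 / 8) ^ (n - p) \<le> C * (\<theta> ^ n + \<theta> ^ (n - m))"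
        unfolding \<rho>_def[symmetric]
      proof (rule tail)
        show "n - p = n div q \<or> n \<le> m + r + (n - p)"
          using \<nu>_add[of n] True unfolding p_def by (auto simp: max_def)
      qed
      finally show ?thesis by (simp add: levy_measure_0)
    next
      \<comment> \<open>No gap is left behind the window, but \<open>n - m < r\<close>, so the
        trivial bound suffices.\<close>
      case False
      have "norm (\<integral>x. Y m x * cnj (Y n x) \<partial>unit_measure) \<le> K * K"
        by (rule unit.norm_integral_le) (auto simp: norm_mult intro!: mult_mono Y_bd K0)
      also have "\<dots> \<le> 4 * K * K * \<rho> ^ 0" using K0 by simp
      also have "\<dots> \<le> C * (\<theta> ^ n + \<theta> ^ (n - m))" by (rule tail) (use False in auto)
      finally show ?thesis .
    qed
  qed auto
  with AE_up AE_orbit_pos AE_unit_interior show ?thesis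
  proof eventually_elim
    case (elim x)
    then obtain B where B: "\<And>n. (\<Prod>k<n. (gauss_map ^^ k) x)\<^sup>2 \<le> exp (B - c * real n)" by blast
    have x: "x \<in> {0<..<1}" using elim(3) by auto
    \<comment> \<open>Excess of the shrinking rate of cylinders of \<open>\<nu> n\<close> digits
      over the largest possible growth rate of \<open>b ^ n\<close>. The freezing error is of order
      \<open>exp (- d) ^ n\<close>.\<close>
    define d where "d = c * (1 - 1 / real q) - ln 10"
    have d: "0 < d" using q_gap by (simp add: d_def)
    have err: "norm (character k ((times_map b ^^ n) x) * \<eta> (cf_digits r ((gauss_map ^^ n) x)) - Y n x)
        \<le> (4 * pi * \<bar>of_int k\<bar> * exp B * K) * exp (- d) ^ n" for n
    proof -
      let ?u = "cylinder_point (\<nu> n) (cf_digits (\<nu> n) x)"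
      have "real (n div q) \<le> real n / real q" by (rule of_nat_div_le_of_nat)
      then have nu: "real n * (1 - 1 / real q) \<le> real (\<nu> n)"
        using \<nu>_add[of n] by (simp add: algebra_simps flip: of_nat_add)
      have bn: "real_of_int b ^ n \<le> exp (ln 10 * real n)"
        unfolding exp_of_nat2_mult using b by (intro power_mono) auto
      have "norm (character (k * b ^ n) x - character (k * b ^ n) ?u) \<le> 2 * pi * \<bar>of_int (k * b ^ n)\<bar> * \<bar>x - ?u\<bar>"
        by (rule character_lipschitz)
      also have "\<bar>x - ?u\<bar> \<le> 2 * exp (B - c * real (\<nu> n))"
        using cylinder_point_distance[OF x elim(2), of "\<nu> n"] B[of "\<nu> n"] by linarith
      also have "exp (B - c * real (\<nu> n)) \<le> exp (B - c * (real n * (1 - 1 / real q)))"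
        using nu c0 by simp
      also have "2 * pi * \<bar>of_int (k * b ^ n)\<bar> * (2 * exp (B - c * (real n * (1 - 1 / real q)))) =
          4 * pi * \<bar>of_int k\<bar> * exp (B - c * (real n * (1 - 1 / real q))) * real_of_int b ^ n"
        using b by (simp add: abs_mult)
      also have "\<dots> \<le> 4 * pi * \<bar>of_int k\<bar> * exp (B - c * (real n * (1 - 1 / real q))) * exp (ln 10 * real n)"
        using bn by (intro mult_left_mono) auto
      also have "\<dots> = 4 * pi * \<bar>of_int k\<bar> * exp B * exp (- d) ^ n"
      proof -
        have "exp (B - c * (real n * (1 - 1 / real q))) * exp (ln 10 * real n) = exp B * exp (- d * real n)"
          unfolding exp_add[symmetric] by (simp add: d_def algebra_simps)
        then show ?thesis unfolding exp_of_nat2_mult by (simp only: mult.assoc)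
      qed
      finally have 1: "norm (character (k * b ^ n) x - character (k * b ^ n) ?u) \<le> 4 * pi * \<bar>of_int k\<bar> * exp B * exp (- d) ^ n"
        using pi_ge_zero by (simp add: mult_left_mono)
      have "character k ((times_map b ^^ n) x) * \<eta> (cf_digits r ((gauss_map ^^ n) x)) - Y n x =
          (character (k * b ^ n) x - character (k * b ^ n) ?u) * g ((gauss_map ^^ n) x)"
        by (simp add: Y_def F_def g_def character_funpow_times_map left_diff_distrib)
      then have "norm (character k ((times_map b ^^ n) x) * \<eta> (cf_digits r ((gauss_map ^^ n) x)) - Y n x) =
          norm (character (k * b ^ n) x - character (k * b ^ n) ?u) * norm (g ((gauss_map ^^ n) x))"
        by (simp add: norm_mult)
      also have "\<dots> \<le> (4 * pi * \<bar>of_int k\<bar> * exp B * exp (- d) ^ n) * K"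
        by (intro mult_mono 1 g_bd) auto
      finally show ?thesis by (simp add: mult_ac)
    qed
    have "(\<lambda>n. (4 * pi * \<bar>of_int k\<bar> * exp B * K) * exp (- d) ^ n) \<longlonglongrightarrow> (4 * pi * \<bar>of_int k\<bar> * exp B * K) * 0"
      using d by (intro tendsto_intros LIMSEQ_power_zero) auto
    then have "(\<lambda>n. (4 * pi * \<bar>of_int k\<bar> * exp B * K) * exp (- d) ^ n) \<longlonglongrightarrow> 0" by simp
    then have "(\<lambda>n. character k ((times_map b ^^ n) x) * \<eta> (cf_digits r ((gauss_map ^^ n) x)) - Y n x) \<longlonglongrightarrow> 0"
      by (rule Lim_null_comparison[rotated]) (use err in auto)
    with elim(4) show ?case by (rule average_limit_cong)
  qed
qed

section \<open>Averages of products\<close>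

text \<open>Replacing \<open>f\<close> by \<open>h\<close> alters the weighted averages by at most
  \<open>K\<close> times the Birkhoff averages of |f - h|, which ergodicity bounds asymptotically by
  its integral over \<open>M'\<close>. The bound on \<open>w\<close> compares that integral with the
  L^1 distance for Lebesgue measure. A sequence of approximants keeps the exceptional sets countable
  in number.\<close>

lemma L1_closed_averages:
  fixes S :: "real \<Rightarrow> real" and W :: "nat \<Rightarrow> real \<Rightarrow> complex" and w :: "real \<Rightarrow> real"
  assumes M': "M' = density unit_measure (\<lambda>x. ennreal (w x))"
    and w [measurable]: "w \<in> borel_measurable borel" and wD: "\<And>x. x \<in> {0..1} \<Longrightarrow> 0 < w x \<and> w x \<le> D"
    and erg: "ergodic_map M' S"
    and W: "\<And>n x. norm (W n x) \<le> K"
  shows "L1_closed_class (\<lambda>f. AE x in unit_measure.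
    (\<lambda>N. (\<Sum>n<N. f ((S ^^ n) x) * W n x) / of_nat N) \<longlonglongrightarrow> c * integral\<^sup>L M' f)"
proof -
  interpret ergodic_map M' S by (rule erg)
  have K0: "0 \<le> K" using order_trans[OF norm_ge_zero W] .
  have D0: "0 \<le> D" using wD[of 0] by auto
  have sets_M' [simp]: "sets M' = sets borel" and space_M' [simp]: "space M' = UNIV" by (simp_all add: M')
  have AE01: "AE x in unit_measure. x \<in> {0..1}" using AE_unit_interior by eventually_elim auto
  have w_nn: "AE x in unit_measure. 0 \<le> w x" using AE01 by eventually_elim (use wD in \<open>auto intro: less_imp_le\<close>)
  have AE_M': "(AE x in M'. P x) \<longleftrightarrow> (AE x in unit_measure. P x)" for P
  proof -
    have "(AE x in M'. P x) \<longleftrightarrow> (AE x in unit_measure. 0 < w x \<longrightarrow> P x)"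
      unfolding M' by (subst AE_density) auto
    also have "\<dots> \<longleftrightarrow> (AE x in unit_measure. P x)"
    proof
      assume "AE x in unit_measure. 0 < w x \<longrightarrow> P x"
      with AE01 show "AE x in unit_measure. P x" by eventually_elim (use wD in auto)
    qed (auto elim: eventually_mono)
    finally show ?thesis .
  qed
  have wf_int: "integrable unit_measure (\<lambda>x. w x *\<^sub>R f x)" if f: "integrable unit_measure f"
    for f :: "real \<Rightarrow> 'c::{banach, second_countable_topology}"
  proof (rule Bochner_Integration.integrable_bound)
    show "integrable unit_measure (\<lambda>x. D * norm (f x))" using f by simp
    show "AE x in unit_measure. norm (w x *\<^sub>R f x) \<le> norm (D * norm (f x))"
      using AE01
    proof eventually_elim
      case (elim x)
      then have "\<bar>w x\<bar> * norm (f x) \<le> D * norm (f x)" using wD[OF elim] by (intro mult_right_mono) auto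
      then show ?case using D0 by simp
    qed
    show "(\<lambda>x. w x *\<^sub>R f x) \<in> borel_measurable unit_measure" using f by measurable
  qed
  have int_complex: "integrable M' f" if f: "integrable unit_measure f" for f :: "real \<Rightarrow> complex"
    unfolding M' by (subst integrable_density) (use f w_nn wf_int[OF f] in auto)
  have int_real: "integrable M' f" if f: "integrable unit_measure f" for f :: "real \<Rightarrow> real"
    unfolding M' by (subst integrable_density) (use f w_nn wf_int[OF f] in auto)
  have dom: "integral\<^sup>L M' f \<le> D * integral\<^sup>L unit_measure f"
    if f: "integrable unit_measure f" "\<And>x. 0 \<le> f x" for f :: "real \<Rightarrow> real"
  proof -
    have "integral\<^sup>L M' f = (\<integral>x. w x *\<^sub>R f x \<partial>unit_measure)"
      unfolding M' by (subst integral_density) (use f w_nn in auto)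
    also have "\<dots> \<le> (\<integral>x. D * f x \<partial>unit_measure)"
    proof (rule integral_mono_AE)
      show "AE x in unit_measure. w x *\<^sub>R f x \<le> D * f x"
        using AE01 by eventually_elim (use wD f in \<open>auto intro: mult_right_mono\<close>)
      show "integrable unit_measure (\<lambda>x. w x *\<^sub>R f x)" by (rule wf_int[OF f(1)])
    qed (use f in auto)
    finally show ?thesis by simp
  qed
  let ?A = "\<lambda>f x N. (\<Sum>n<N. f ((S ^^ n) x) * W n x) / of_nat N"
  show ?thesis
  proof
    fix f g :: "real \<Rightarrow> complex"
    assume fg: "integrable unit_measure f" "integrable unit_measure g"
    assume "AE x in unit_measure. ?A f x \<longlonglongrightarrow> c * integral\<^sup>L M' f" "AE x in unit_measure. ?A g x \<longlonglongrightarrow> c * integral\<^sup>L M' g"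
    then show "AE x in unit_measure. ?A (\<lambda>x. f x + g x) x \<longlonglongrightarrow> c * integral\<^sup>L M' (\<lambda>x. f x + g x)"
    proof eventually_elim
      case (elim x)
      have "integral\<^sup>L M' (\<lambda>x. f x + g x) = integral\<^sup>L M' f + integral\<^sup>L M' g"
        using fg by (intro Bochner_Integration.integral_add int_complex)
      then show ?case
        using tendsto_add[OF elim] by (simp add: distrib_left distrib_right sum.distrib add_divide_distrib)
    qed
  next
    fix f :: "real \<Rightarrow> complex" and d :: complex
    assume "AE x in unit_measure. ?A f x \<longlonglongrightarrow> c * integral\<^sup>L M' f"
    then show "AE x in unit_measure. ?A (\<lambda>x. d * f x) x \<longlonglongrightarrow> c * integral\<^sup>L M' (\<lambda>x. d * f x)"
    proof eventually_elim
      case (elim x)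
      have "?A (\<lambda>x. d * f x) x = (\<lambda>N. d * ?A f x N)"
        by (simp add: sum_distrib_left mult.assoc)
      moreover have "c * integral\<^sup>L M' (\<lambda>x. d * f x) = d * (c * integral\<^sup>L M' f)" by simp
      ultimately show ?case by (simp only:) (rule tendsto_mult_left[OF elim])
    qed
  next
    fix f :: "real \<Rightarrow> complex"
    assume f: "integrable unit_measure f"
    assume ap: "\<And>e. 0 < e \<Longrightarrow> \<exists>h. integrable unit_measure h \<and>
      (AE x in unit_measure. ?A h x \<longlonglongrightarrow> c * integral\<^sup>L M' h) \<and> (\<integral>x. norm (f x - h x) \<partial>unit_measure) < e"
    have "\<forall>j::nat. \<exists>h. integrable unit_measure h \<and>
      (AE x in unit_measure. ?A h x \<longlonglongrightarrow> c * integral\<^sup>L M' h) \<and> (\<integral>x. norm (f x - h x) \<partial>unit_measure) < 1 / real (Suc j)"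
      by (intro allI ap) simp
    from choice[OF this] obtain h where *: "\<forall>j. integrable unit_measure (h j) \<and>
      (AE x in unit_measure. ?A (h j) x \<longlonglongrightarrow> c * integral\<^sup>L M' (h j)) \<and> (\<integral>x. norm (f x - h j x) \<partial>unit_measure) < 1 / real (Suc j)" ..
    have h: "\<And>j. integrable unit_measure (h j)"
      "\<And>j. AE x in unit_measure. ?A (h j) x \<longlonglongrightarrow> c * integral\<^sup>L M' (h j)"
      "\<And>j. (\<integral>x. norm (f x - h j x) \<partial>unit_measure) < 1 / real (Suc j)"
      by (rule *[THEN spec, THEN conjunct1], rule *[THEN spec, THEN conjunct2, THEN conjunct1], rule *[THEN spec, THEN conjunct2, THEN conjunct2])
    define I where "I j = integral\<^sup>L M' (\<lambda>x. norm (f x - h j x))" for j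
    have diff_int: "integrable unit_measure (\<lambda>x. norm (f x - h j x))" for j using f h(1) by simp
    have I_le: "I j \<le> D / real (Suc j)" for j
    proof -
      have "I j \<le> D * (\<integral>x. norm (f x - h j x) \<partial>unit_measure)"
        unfolding I_def by (rule dom[OF diff_int]) simp
      also have "\<dots> \<le> D * (1 / real (Suc j))" using h(3)[of j] D0 by (intro mult_left_mono) auto
      finally show ?thesis by simp
    qed
    have "AE x in unit_measure. \<forall>j. ?A (h j) x \<longlonglongrightarrow> c * integral\<^sup>L M' (h j)"
      using h(2) by (simp add: AE_all_countable)
    moreover have "AE x in unit_measure. \<forall>j. \<forall>e>0. \<forall>\<^sub>F n in sequentially.
        birkhoff_sum (\<lambda>x. norm (f x - h j x)) n x / real n \<le> I j + e"
      unfolding AE_all_countable AE_M'[symmetric] I_def by (intro allI birkhoff_upper int_real diff_int)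
    ultimately show "AE x in unit_measure. ?A f x \<longlonglongrightarrow> c * integral\<^sup>L M' f"
    proof eventually_elim
      case (elim x)
      show ?case
      proof (rule tendstoI)
        fix e :: real assume e: "0 < e"
        define B where "B = K * D + norm c * D"
        have B0: "0 \<le> B" using K0 D0 by (simp add: B_def)
        obtain j :: nat where j: "B / real (Suc j) < e / 2"
        proof -
          obtain j :: nat where "B / (e / 2) < real j" using reals_Archimedean2 by blast
          then have "B / (e / 2) < real (Suc j)" by simp
          then have "B / real (Suc j) < e / 2" using e by (simp add: field_simps)
          then show ?thesis by (rule that)
        qed
        \<comment> \<open>One half of \<open>e\<close> is shared by the Birkhoff excess, with weight
          \<open>K\<close>, and the convergence for \<open>h j\<close>; the other half went into the
          choice of \<open>j\<close>.\<close>
        define d where "d = (e / 2) / (K + 1)"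
        have d: "0 < d" "K * d + d = e / 2"
        proof -
          show "0 < d" using K0 e by (simp add: d_def)
          have "K * d + d = (K + 1) * d" by (simp add: distrib_right)
          also have "\<dots> = e / 2"
            proof -
            have "x * (y / x) = y" if "x \<noteq> 0" for x y :: real using that by simp
            then show ?thesis unfolding d_def using K0 by (metis add_nonneg_pos less_irrefl zero_less_one)
          qed
          finally show "K * d + d = e / 2" .
        qed
        have cint: "norm (c * integral\<^sup>L M' (h j) - c * integral\<^sup>L M' f) \<le> norm c * I j"
        proof -
          have "integral\<^sup>L M' f - integral\<^sup>L M' (h j) = integral\<^sup>L M' (\<lambda>x. f x - h j x)"
            using int_complex[OF f] int_complex[OF h(1)] by simp
          then have "norm (integral\<^sup>L M' f - integral\<^sup>L M' (h j)) \<le> I j"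
            unfolding I_def by (simp add: integral_norm_bound)
          then have "norm c * norm (integral\<^sup>L M' (h j) - integral\<^sup>L M' f) \<le> norm c * I j"
            by (intro mult_left_mono) (auto simp: norm_minus_commute)
          then show ?thesis by (simp add: norm_mult[symmetric] right_diff_distrib)
        qed
        have "\<forall>\<^sub>F N in sequentially. birkhoff_sum (\<lambda>x. norm (f x - h j x)) N x / real N \<le> I j + d"
          using elim(2) d by blast
        moreover have "\<forall>\<^sub>F N in sequentially. dist (?A (h j) x N) (c * integral\<^sup>L M' (h j)) < d"
          using elim(1) d by (intro tendstoD) auto
        ultimately show "\<forall>\<^sub>F N in sequentially. dist (?A f x N) (c * integral\<^sup>L M' f) < e"
        proof eventually_elim
          case (elim N)
          have "norm (?A f x N - ?A (h j) x N) \<le> K * (birkhoff_sum (\<lambda>x. norm (f x - h j x)) N x / real N)"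
          proof -
            have "?A f x N - ?A (h j) x N = (\<Sum>n<N. (f ((S ^^ n) x) - h j ((S ^^ n) x)) * W n x) / of_nat N"
              by (simp add: left_diff_distrib sum_subtractf diff_divide_distrib)
            also have "norm \<dots> = norm (\<Sum>n<N. (f ((S ^^ n) x) - h j ((S ^^ n) x)) * W n x) / real N"
              by (simp add: norm_divide)
            also have "\<dots> \<le> (\<Sum>n<N. norm (f ((S ^^ n) x) - h j ((S ^^ n) x)) * K) / real N"
              by (intro divide_right_mono sum_norm_le) (auto simp: norm_mult intro!: mult_left_mono W)
            also have "\<dots> = K * (birkhoff_sum (\<lambda>x. norm (f x - h j x)) N x / real N)"
              by (simp add: birkhoff_sum_def sum_distrib_right[symmetric])
            finally show ?thesis .
          qed
          also have "\<dots> \<le> K * (I j + d)" using elim(1) K0 by (intro mult_left_mono)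
          finally have 1: "norm (?A f x N - ?A (h j) x N) \<le> K * I j + K * d" by (simp add: distrib_left)
          have "?A f x N - c * integral\<^sup>L M' f = (?A f x N - ?A (h j) x N) + (?A (h j) x N - c * integral\<^sup>L M' (h j))
              + (c * integral\<^sup>L M' (h j) - c * integral\<^sup>L M' f)" by simp
          then have "dist (?A f x N) (c * integral\<^sup>L M' f) \<le> norm (?A f x N - ?A (h j) x N)
              + norm (?A (h j) x N - c * integral\<^sup>L M' (h j)) + norm (c * integral\<^sup>L M' (h j) - c * integral\<^sup>L M' f)"
            unfolding dist_norm by (simp only:) (intro norm_triangle_le add_right_mono norm_triangle_ineq)
          also have "\<dots> < (K * I j + K * d) + d + norm c * I j"
            using 1 elim(2) cint unfolding dist_norm by linarith
          also have "\<dots> = (K + norm c) * I j + e / 2" using d(2) by (simp add: algebra_simps)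
          also have "(K + norm c) * I j \<le> (K + norm c) * (D / real (Suc j))"
            using I_le[of j] K0 by (intro mult_left_mono) auto
          also have "\<dots> = B / real (Suc j)" by (simp add: B_def distrib_right)
          also have "B / real (Suc j) + e / 2 < e" using j by linarith
          finally show ?case by simp
        qed
      qed
    qed
  qed
qed

lemma unit_measure_density: "unit_measure = density unit_measure (\<lambda>x. ennreal ((\<lambda>_. 1) x))"
  by (simp add: density_1)

text \<open>For large \<open>b\<close>, frequency 0 is Birkhoff's theorem for T_G, and other
  frequencies have mean 0. For small \<open>b\<close> the mean of \<open>\<eta>\<close> is split
  off; it multiplies Birkhoff averages of the character under T_b.\<close>

lemma character_digit_averages:
  fixes \<eta> :: "int list \<Rightarrow> complex"
  assumes b: "2 \<le> b" and bd: "\<And>l. norm (\<eta> l) \<le> K"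
  shows "AE x in unit_measure. (\<lambda>N. (\<Sum>n<N. character k ((times_map b ^^ n) x) * \<eta> (cf_digits r ((gauss_map ^^ n) x))) / of_nat N)
    \<longlonglongrightarrow> integral\<^sup>L unit_measure (character k) * (\<integral>x. \<eta> (cf_digits r x) \<partial>gauss_borel)"
proof (cases "11 \<le> b")
  case True
  show ?thesis
  proof (cases "k = 0")
    case True
    have int: "integrable gauss_borel (\<lambda>x. \<eta> (cf_digits r x))"
      by (rule gauss.integrable_const_bound[where B = K]) (use bd in auto)
    have [simp]: "character 0 x = 1" for x by (simp add: character_def)
    have "integral\<^sup>L unit_measure (character 0) = (\<integral>x. 1 \<partial>unit_measure)" by (intro Bochner_Integration.integral_cong) auto
    then have one: "integral\<^sup>L unit_measure (character 0) = 1" using unit.prob_space by simp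
    show ?thesis
      using gauss.birkhoff_complex[OF int] unfolding AE_gauss_borel True one by simp
  next
    case False
    then show ?thesis using long_cylinder_case[where \<eta> = \<eta> and r = r, OF True False bd] by (simp add: integral_character)
  qed
next
  case False
  define m where "m = (\<integral>x. \<eta> (cf_digits r x) \<partial>gauss_borel)"
  define \<eta>' where "\<eta>' l = \<eta> l - m" for l
  have int: "integrable gauss_borel (\<lambda>x. \<eta> (cf_digits r x))"
    by (rule gauss.integrable_const_bound[where B = K]) (use bd in auto)
  have bd': "norm (\<eta>' l) \<le> K + norm m" for l
    unfolding \<eta>'_def using bd[of l] by (intro order_trans[OF norm_triangle_ineq4]) simp
  have mean': "(\<integral>x. \<eta>' (cf_digits r x) \<partial>gauss_borel) = 0"
    unfolding \<eta>'_def using int gauss.prob_space by (simp add: m_def)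
  interpret times: ergodic_map unit_measure "times_map b" using b by (rule ergodic_times)
  have "integrable unit_measure (character k)"
    by (rule unit.integrable_const_bound[where B = 1]) auto
  from times.birkhoff_complex[OF this] short_cylinder_case[where \<eta> = \<eta>' and r = r and k = k, OF b _ bd' mean'] False
  have "AE x in unit_measure. (\<lambda>N. (\<Sum>n<N. character k ((times_map b ^^ n) x)) / of_nat N) \<longlonglongrightarrow> integral\<^sup>L unit_measure (character k)"
    "AE x in unit_measure. (\<lambda>N. (\<Sum>n<N. character k ((times_map b ^^ n) x) * \<eta>' (cf_digits r ((gauss_map ^^ n) x))) / of_nat N) \<longlonglongrightarrow> 0"
    by auto
  then show ?thesis
  proof eventually_elim
    case (elim x)
    have "(\<Sum>n<N. character k ((times_map b ^^ n) x) * \<eta> (cf_digits r ((gauss_map ^^ n) x))) / of_nat N =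
      (\<Sum>n<N. character k ((times_map b ^^ n) x) * \<eta>' (cf_digits r ((gauss_map ^^ n) x))) / of_nat N
      + (\<Sum>n<N. character k ((times_map b ^^ n) x)) / of_nat N * m" for N
      unfolding \<eta>'_def by (simp add: right_diff_distrib sum_subtractf sum_distrib_right diff_divide_distrib)
    then show ?case
      using tendsto_add[OF elim(2) tendsto_mult_right[OF elim(1), of m]] by (simp add: m_def)
  qed
qed

text \<open>One factor is approximated at a time while the other acts as a bounded weight:
  \<open>f\<close> against functions of digits, and then \<open>g\<close> with the general
  \<open>f\<close> as weight.\<close>

lemma borel_product_averages:
  fixes f g :: "real \<Rightarrow> complex"
  assumes b: "2 \<le> b"
    and f [measurable]: "f \<in> borel_measurable borel" and f_bd: "\<And>x. norm (f x) \<le> Kf"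
    and g [measurable]: "g \<in> borel_measurable borel" and g_bd: "\<And>x. norm (g x) \<le> Kg"
  shows "AE x in unit_measure. (\<lambda>N. (\<Sum>n<N. f ((times_map b ^^ n) x) * g ((gauss_map ^^ n) x)) / of_nat N)
    \<longlonglongrightarrow> integral\<^sup>L unit_measure f * integral\<^sup>L gauss_borel g"
proof -
  have f_int: "integrable unit_measure f" by (rule unit.integrable_const_bound[where B = Kf]) (use f_bd in auto)
  have g_int: "integrable unit_measure g" by (rule unit.integrable_const_bound[where B = Kg]) (use g_bd in auto)
  have digits: "AE x in unit_measure. (\<lambda>N. (\<Sum>n<N. f ((times_map b ^^ n) x) * \<eta> (cf_digits r ((gauss_map ^^ n) x))) / of_nat N)
    \<longlonglongrightarrow> integral\<^sup>L unit_measure f * (\<integral>x. \<eta> (cf_digits r x) \<partial>gauss_borel)"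
    if bd: "\<And>l. norm (\<eta> l) \<le> K" for r \<eta> K
  proof -
    let ?m = "\<integral>x. \<eta> (cf_digits r x) \<partial>gauss_borel"
    interpret L1_closed_class "\<lambda>f. AE x in unit_measure.
      (\<lambda>N. (\<Sum>n<N. f ((times_map b ^^ n) x) * \<eta> (cf_digits r ((gauss_map ^^ n) x))) / of_nat N) \<longlonglongrightarrow> ?m * integral\<^sup>L unit_measure f"
      by (rule L1_closed_averages[OF unit_measure_density _ _ ergodic_times[OF b], where D = 1 and K = K]) (use bd in auto)
    have "AE x in unit_measure.
      (\<lambda>N. (\<Sum>n<N. f ((times_map b ^^ n) x) * \<eta> (cf_digits r ((gauss_map ^^ n) x))) / of_nat N) \<longlonglongrightarrow> ?m * integral\<^sup>L unit_measure f"
    proof (rule trigonometric_dense[OF _ f_int])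
      fix k
      show "AE x in unit_measure.
        (\<lambda>N. (\<Sum>n<N. character k ((times_map b ^^ n) x) * \<eta> (cf_digits r ((gauss_map ^^ n) x))) / of_nat N) \<longlonglongrightarrow> ?m * integral\<^sup>L unit_measure (character k)"
        using character_digit_averages[where \<eta> = \<eta> and r = r and k = k, OF b bd] by (simp only: mult.commute[of ?m])
    qed
    then show ?thesis by (simp only: mult.commute[of ?m])
  qed
  interpret L1_closed_class "\<lambda>g. AE x in unit_measure.
    (\<lambda>N. (\<Sum>n<N. g ((gauss_map ^^ n) x) * f ((times_map b ^^ n) x)) / of_nat N) \<longlonglongrightarrow> integral\<^sup>L unit_measure f * integral\<^sup>L gauss_borel g"
    by (rule L1_closed_averages[OF gauss_borel_def _ _ ergodic_gauss, where D = "1 / ln 2" and K = Kf])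
      (use f_bd gauss_density_pos gauss_density_le in auto)
  have "AE x in unit_measure.
    (\<lambda>N. (\<Sum>n<N. g ((gauss_map ^^ n) x) * f ((times_map b ^^ n) x)) / of_nat N) \<longlonglongrightarrow> integral\<^sup>L unit_measure f * integral\<^sup>L gauss_borel g"
  proof (rule cf_digits_dense[OF _ g_int])
    fix r :: nat and \<eta> :: "int list \<Rightarrow> complex" and K assume "\<And>l. norm (\<eta> l) \<le> K"
    from digits[where \<eta> = \<eta> and r = r, OF this]
    show "AE x in unit_measure. (\<lambda>N. (\<Sum>n<N. \<eta> (cf_digits r ((gauss_map ^^ n) x)) * f ((times_map b ^^ n) x)) / of_nat N)
      \<longlonglongrightarrow> integral\<^sup>L unit_measure f * (\<integral>x. \<eta> (cf_digits r x) \<partial>gauss_borel)"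
      by (simp only: mult.commute[of "f _"])
  qed
  then show ?thesis by (simp only: mult.commute[of "f _"])
qed

section \<open>From Lebesgue measurable to Borel functions\<close>

lemma AE_unit_lebesgue: "(AE x in unit_lebesgue. P x) \<longleftrightarrow> (AE x in unit_measure. P x)"
  unfolding AE_unit_measure_iff by (subst AE_restrict_space_iff) (auto simp: AE_completion_iff)

lemma integral_unit_lebesgue:
  fixes f :: "real \<Rightarrow> complex"
  assumes [measurable]: "f \<in> borel_measurable borel"
  shows "integral\<^sup>L unit_lebesgue f = integral\<^sup>L unit_measure f"
proof -
  have "integral\<^sup>L unit_lebesgue f = (\<integral>x. indicator {0..1} x *\<^sub>R f x \<partial>lebesgue)"
    by (rule integral_restrict_space) simp
  also have "\<dots> = (\<integral>x. indicator {0..1} x *\<^sub>R f x \<partial>lborel)"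
    by (rule integral_completion) measurable
  finally show ?thesis by (simp add: integral_unit_measure)
qed

lemma integral_gauss_measure:
  fixes f :: "real \<Rightarrow> complex"
  assumes f: "f \<in> borel_measurable unit_lebesgue" and g: "g \<in> borel_measurable borel"
    and eq: "AE x in unit_lebesgue. f x = g x"
  shows "integral\<^sup>L gauss_measure f = integral\<^sup>L gauss_borel g"
proof -
  note [measurable] = g
  have meas: "h \<in> borel_measurable unit_lebesgue" if "h \<in> borel_measurable borel" for h :: "real \<Rightarrow> 'c::topological_space"
    using that by (intro measurable_restrict_space1 measurable_completion) simp
  have w: "(\<lambda>x. 1 / ln 2 * (1 / (1 + x))) \<in> borel_measurable unit_lebesgue"
    by (rule meas) measurable
  have "integral\<^sup>L gauss_measure f = (\<integral>x. (1 / ln 2 * (1 / (1 + x))) *\<^sub>R f x \<partial>unit_lebesgue)"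
    unfolding gauss_measure_def
    by (rule integral_density[OF f w]) (auto simp: AE_restrict_space_iff)
  also have "\<dots> = (\<integral>x. gauss_density x *\<^sub>R g x \<partial>unit_lebesgue)"
  proof (rule integral_cong_AE)
    show "(\<lambda>x. (1 / ln 2 * (1 / (1 + x))) *\<^sub>R f x) \<in> borel_measurable unit_lebesgue"
      using w f by (rule borel_measurable_scaleR)
    show "(\<lambda>x. gauss_density x *\<^sub>R g x) \<in> borel_measurable unit_lebesgue" by (rule meas) measurable
    show "AE x in unit_lebesgue. (1 / ln 2 * (1 / (1 + x))) *\<^sub>R f x = gauss_density x *\<^sub>R g x"
      using eq by eventually_elim (simp add: gauss_density_def)
  qed
  also have "\<dots> = (\<integral>x. gauss_density x *\<^sub>R g x \<partial>unit_measure)" by (rule integral_unit_lebesgue) measurable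
  also have "\<dots> = integral\<^sup>L gauss_borel g" by (rule integral_gauss_borel[symmetric]) measurable
  finally show ?thesis .
qed

text \<open>The given functions are measurable for the completed measure and bounded only
  essentially, while orbit averages were treated for Borel functions bounded everywhere. Values
  above the essential bound are reset to 0, which affects a null set.\<close>

lemma L_infinity_borel_representative:
  assumes "f \<in> L_infinity unit_lebesgue"
  obtains f' :: "real \<Rightarrow> complex" and K
  where "f' \<in> borel_measurable borel" "\<And>x. norm (f' x) \<le> K" "AE x in unit_lebesgue. f x = f' x"
proof -
  have f: "f \<in> borel_measurable unit_lebesgue" using assms by (simp add: L_infinity_def)
  obtain C where C: "AE x in unit_lebesgue. norm (f x) \<le> C" using assms by (auto simp: L_infinity_def)
  have ex: "\<exists>h'\<in>borel_measurable borel. AE x in lborel. x \<in> {0..1} \<longrightarrow> h x = h' x"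
    if h: "h \<in> borel_measurable unit_lebesgue" for h :: "real \<Rightarrow> real"
  proof -
    have "(\<lambda>x. if x \<in> {0..1} then h x else 0) \<in> borel_measurable lebesgue"
      using h by (intro borel_measurable_if_I) auto
    then obtain h' where "h' \<in> borel_measurable lborel" "AE x in lborel. (if x \<in> {0..1} then h x else 0) = h' x"
      using completion_ex_borel_measurable_real by blast
    then show ?thesis by (intro bexI[of _ h']) (auto elim!: eventually_mono split: if_splits)
  qed
  have re: "(\<lambda>x. Re (f x)) \<in> borel_measurable unit_lebesgue" and im: "(\<lambda>x. Im (f x)) \<in> borel_measurable unit_lebesgue"
    using f by measurable
  obtain u where u: "u \<in> borel_measurable borel" "AE x in lborel. x \<in> {0..1} \<longrightarrow> Re (f x) = u x" using ex[OF re] by blast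
  obtain v where v: "v \<in> borel_measurable borel" "AE x in lborel. x \<in> {0..1} \<longrightarrow> Im (f x) = v x" using ex[OF im] by blast
  note [measurable] = u(1) v(1)
  define f' where "f' x = (if norm (Complex (u x) (v x)) \<le> C then Complex (u x) (v x) else 0)" for x
  have f'_eq: "f' = (\<lambda>x. if norm (of_real (u x) + \<i> * of_real (v x)) \<le> C then of_real (u x) + \<i> * of_real (v x) else 0)"
    by (auto simp: f'_def Complex_eq)
  show ?thesis
  proof
    show "f' \<in> borel_measurable borel" unfolding f'_eq by measurable
    show "norm (f' x) \<le> max 0 C" for x by (auto simp: f'_def)
    have "AE x in unit_measure. norm (f x) \<le> C" using C unfolding AE_unit_lebesgue .
    with u(2)[folded AE_unit_measure_iff] v(2)[folded AE_unit_measure_iff]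
    have "AE x in unit_measure. f x = f' x"
    proof eventually_elim
      case (elim x)
      then have "f x = Complex (u x) (v x)" by (simp add: complex_eq_iff)
      then show ?case using elim by (simp add: f'_def)
    qed
    then show "AE x in unit_lebesgue. f x = f' x" unfolding AE_unit_lebesgue .
  qed
qed

theorem theorem1p1:
  fixes b :: int and f g :: "real \<Rightarrow> complex"
  assumes "b \<ge> 2"
    and "f \<in> L_infinity unit_lebesgue"
    and "g \<in> L_infinity unit_lebesgue"
  shows "AE x in unit_lebesgue.
    (\<lambda>N::nat. 1 / of_nat N *
       (\<Sum>n<N. f ((times_map b ^^ n) x) * g ((gauss_map ^^ n) x)))
    \<longlonglongrightarrow> (LINT y|unit_lebesgue. f y) * (LINT y|gauss_measure. g y)"
proof -
  obtain f' Kf where f': "f' \<in> borel_measurable borel" "\<And>x. norm (f' x) \<le> Kf" "AE x in unit_lebesgue. f x = f' x"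
    using L_infinity_borel_representative[OF assms(2)] by blast
  obtain g' Kg where g': "g' \<in> borel_measurable borel" "\<And>x. norm (g' x) \<le> Kg" "AE x in unit_lebesgue. g x = g' x"
    using L_infinity_borel_representative[OF assms(3)] by blast
  interpret times: ergodic_map unit_measure "times_map b" using assms(1) by (rule ergodic_times)
  \<comment> \<open>The representatives have to agree along entire orbits: T_b preserves Lebesgue
    measure, and T_G preserves the Gauss measure, which has the same null sets.\<close>
  have "AE x in unit_measure. \<forall>n. f ((times_map b ^^ n) x) = f' ((times_map b ^^ n) x)"
    using f'(3) unfolding AE_unit_lebesgue by (rule times.AE_funpow)
  moreover have "AE x in gauss_borel. \<forall>n. g ((gauss_map ^^ n) x) = g' ((gauss_map ^^ n) x)"
    using g'(3) unfolding AE_unit_lebesgue AE_gauss_borel[symmetric] by (rule gauss.AE_funpow)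
  moreover have "integral\<^sup>L unit_lebesgue f = integral\<^sup>L unit_measure f'"
  proof -
    have "f' \<in> borel_measurable unit_lebesgue"
      using f'(1) by (intro measurable_restrict_space1 measurable_completion) simp
    then have "integral\<^sup>L unit_lebesgue f = integral\<^sup>L unit_lebesgue f'"
      using assms(2) f'(3) by (intro integral_cong_AE) (auto simp: L_infinity_def)
    then show ?thesis using f'(1) by (simp add: integral_unit_lebesgue)
  qed
  moreover have "integral\<^sup>L gauss_measure g = integral\<^sup>L gauss_borel g'"
    using assms(3) g' by (intro integral_gauss_measure) (auto simp: L_infinity_def)
  moreover note borel_product_averages[OF assms(1) f'(1,2) g'(1,2)]
  ultimately show ?thesis
    unfolding AE_unit_lebesgue AE_gauss_borel by (auto elim!: eventually_elim2)
qed

end
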